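(* Let $k\ge 2$ be an integer. Every finite simple $k$-regular graph is antimagic.
   Context: All graphs are finite and simple. For a graph $G=(V,E)$ and a vertex $v\in V$, $E(v)$ denotes the set of edges incident to $v$. A labeling of $G$ is an injective function $f:E\to\{1,2,\dots,|E|\}$ (hence a bijection), and for $F\subseteq E$ we write $f(F)=\sum_{e\in F}f(e)$. A labeling is antimagic if $f(E(u))\ne f(E(v))$ for every pair of distinct vertices $u,v\in V$. A graph is antimagic if it admits an antimagic labeling. A graph is $k$-regular if every vertex has degree exactly $k$. *)

theory Defs
  imports Main
begin

text \<open>A graph is a vertex set together with a set of edges, each edge being the
  two-element set of its endpoints.\<close>

definition simple_graph :: "'a set \<Rightarrow> 'a set set \<Rightarrow> bool" where
  "simple_graph V E \<longleftrightarrow> finite V \<and> (\<forall>e\<in>E. e \<subseteq> V \<and> card e = 2)"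

definition incident_edges :: "'a set set \<Rightarrow> 'a \<Rightarrow> 'a set set" where
  "incident_edges E v = {e \<in> E. v \<in> e}"

definition regular_graph :: "nat \<Rightarrow> 'a set \<Rightarrow> 'a set set \<Rightarrow> bool" where
  "regular_graph k V E \<longleftrightarrow> (\<forall>v\<in>V. card (incident_edges E v) = k)"

definition labeling :: "'a set set \<Rightarrow> ('a set \<Rightarrow> nat) \<Rightarrow> bool" where
  "labeling E f \<longleftrightarrow> inj_on f E \<and> f ` E \<subseteq> {1..card E}"

definition antimagic_labeling :: "'a set \<Rightarrow> 'a set set \<Rightarrow> ('a set \<Rightarrow> nat) \<Rightarrow> bool" where
  "antimagic_labeling V E f \<longleftrightarrow> labeling E f \<and>
     (\<forall>u\<in>V. \<forall>v\<in>V. u \<noteq> v \<longrightarrow> sum f (incident_edges E u) \<noteq> sum f (incident_edges E v))"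

definition antimagic :: "'a set \<Rightarrow> 'a set set \<Rightarrow> bool" where
  "antimagic V E \<longleftrightarrow> (\<exists>f. antimagic_labeling V E f)"

end

(* Components are treated one after another, and the layers around a root of a component from the
   outermost inwards, always with the smallest labels still free; the edges at the root come last.
   The finished vertices must have distinct sums, all of them below every sum that is still
   possible at an unfinished vertex.

   The critical step is the bipartite block between a layer U and the next layer W towards the root,
   where every vertex of W has at most k - 1 edges. At each vertex of U an edge is reserved for one of
   the largest labels, assigned in the order of the sums collected so far, which makes the sums
   distinct. The other edges are grouped in pairs with constant label sum s, almost all pairs meeting
   at a vertex of U; this bounds the sums on U from above. Two edges that are consecutive at a vertex
   of W belong to different pairs, so the pairs form trails; numbering the pairs along these trails
   matches low labels with high ones at each vertex of W and bounds the sums there from below by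
   the same multiple of s. For odd k this suffices. For even k a vertex of W with k - 1 edges has an
   unmatched one, which therefore should be among the reserved edges. Such edges can be
   chosen with at most one at each vertex of U, except for a few vertices with k edges in the block
   that receive two; a second edge is then reserved at all vertices with k edges. *)

theory Submission
  imports Defs
begin

text \<open>Labels 1, s - 1, 2, s - 2, ... along a trail give s + 1 at every passage, but a closed
  trail fails at its start. In the reverse order s - 1, 1, s - 2, 2, ... closed trails do no harm,
  but a passage gives only s - 1. Both orders are needed. The first requires that no union of
  components of the trail graph has only even degrees; this is arranged by exchanging reserved
  edges, so the reserved class must not be prescribed. For even k one class is prescribed because it
  has to contain the unmatched edges; as long as one such class suffices, a second one is still
  free. If some vertices of U have to receive two of these edges, both classes are prescribed, and
  with k = 2h + 2 the second order loses up to h at a vertex of W. A counting argument pays for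
  this: if d vertices receive two edges, at least (k - 1)d vertices have all k edges in the block.
  With n of these, spreading their sums over a window costs only about n/2, and the remaining half
  of n covers h + d.\<close>

subsection \<open>Even closed sets\<close>

text \<open>In a closed set with even degrees every trail returns to its start, where the low label of its
  first edge meets a high label that is too small.\<close>

definition even_closed :: "('e \<Rightarrow> 'e) \<Rightarrow> ('e \<Rightarrow> 'w) \<Rightarrow> 'e set \<Rightarrow> 'e set \<Rightarrow> bool" where
  "even_closed \<alpha> b R C \<longleftrightarrow> C \<noteq> {} \<and> C \<subseteq> R \<and> \<alpha> ` C \<subseteq> C \<and>
     (\<forall>e\<in>C. \<forall>e'\<in>R. b e' = b e \<longrightarrow> e' \<in> C) \<and> (\<forall>w. even (card {e\<in>C. b e = w}))"

definition fdeg :: "('e \<Rightarrow> 'w) \<Rightarrow> 'e set \<Rightarrow> 'w \<Rightarrow> nat" where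
  "fdeg b R w = card {e\<in>R. b e = w}"

definition fsum :: "('e \<Rightarrow> 'w) \<Rightarrow> 'e set \<Rightarrow> ('e \<Rightarrow> int) \<Rightarrow> 'w \<Rightarrow> int" where
  "fsum b R f w = (\<Sum>e\<in>{e\<in>R. b e = w}. f e)"

text \<open>The pairs \<open>{e, \<alpha> e}\<close> are the edges of an auxiliary multigraph on the
  values of \<open>b\<close>, with the elements of \<open>R\<close> as half-edges and
  \<open>fdeg\<close> as degree; loops are possible. An even closed set is a nonempty union of
  components without odd vertices.\<close>

definition pairing :: "('e \<Rightarrow> 'e) \<Rightarrow> 'e set \<Rightarrow> bool" where
  "pairing \<alpha> R \<longleftrightarrow> (\<forall>e\<in>R. \<alpha> e \<in> R \<and> \<alpha> e \<noteq> e \<and> \<alpha> (\<alpha> e) = e)"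

lemma pairing_subset: "pairing \<alpha> R \<Longrightarrow> C \<subseteq> R \<Longrightarrow> \<alpha> ` C \<subseteq> C \<Longrightarrow> pairing \<alpha> C"
  unfolding pairing_def by blast

lemma pairing_diff: "pairing \<alpha> R \<Longrightarrow> e \<in> R \<Longrightarrow> pairing \<alpha> (R - {e, \<alpha> e})"
  unfolding pairing_def by (metis Diff_iff insert_iff empty_iff)

lemma pairing_even_card: "finite R \<Longrightarrow> pairing \<alpha> R \<Longrightarrow> even (card R)"
proof (induction "card R" arbitrary: R rule: less_induct)
  case less
  show ?case
  proof (cases "R = {}")
    case False
    then obtain e where e: "e \<in> R" by blast
    have 1: "\<alpha> e \<in> R" "\<alpha> e \<noteq> e" using less.prems e unfolding pairing_def by auto
    have c: "card (R - {e, \<alpha> e}) = card R - 2"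
      using e 1 less.prems(1) by (subst card_Diff_subset) auto
    have "card R \<ge> 2"
      using card_mono[of R "{e, \<alpha> e}"] e 1 less.prems(1) by auto
    moreover have "even (card (R - {e, \<alpha> e}))"
      using less.hyps[of "R - {e, \<alpha> e}"] c \<open>card R \<ge> 2\<close> pairing_diff[OF less.prems(2) e] less.prems(1) by auto
    ultimately show ?thesis using c by simp
  qed simp
qed

lemma sum_fibre_card: "finite C \<Longrightarrow> (\<Sum>w\<in>b ` C. card {e\<in>C. b e = w}) = card C"
  using sum.image_gen[of C "\<lambda>_. 1::nat" b] by simp

text \<open>If every choice were bad, intersecting the components left behind by two bad choices
  would give a set with exactly one odd vertex.\<close>

lemma fleury_step:
  assumes fin: "finite R" and p: "pairing \<alpha> R"
    and I: "\<And>C. even_closed \<alpha> b R C \<Longrightarrow> \<exists>e\<in>C. b e = w"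
    and ne: "e0 \<in> R" "b e0 = w"
  shows "\<exists>e\<in>R. b e = w \<and> (\<forall>C. even_closed \<alpha> b (R - {e, \<alpha> e}) C \<longrightarrow> (\<exists>g\<in>C. b g = b (\<alpha> e)))"
proof (rule ccontr)
  assume no: "\<not> ?thesis"
  have key: "\<exists>C. even_closed \<alpha> b (R - {e, \<alpha> e}) C \<and> (\<forall>g\<in>C. b g \<noteq> b (\<alpha> e)) \<and> b (\<alpha> e) \<noteq> w
        \<and> (\<exists>g\<in>C. b g = w)" if e: "e \<in> R" "b e = w" for e
  proof -
    obtain C where C: "even_closed \<alpha> b (R - {e, \<alpha> e}) C" "\<forall>g\<in>C. b g \<noteq> b (\<alpha> e)"
      using no e by blast
    \<comment> \<open>A closed set of the remainder that avoids both ends of the removed pair is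
      closed in \<open>R\<close> as well, so \<open>I\<close> applies to it.\<close>
    have g: "\<exists>g\<in>C. b g = w"
    proof (rule ccontr)
      assume n: "\<not> ?thesis"
      have "even_closed \<alpha> b R C"
        unfolding even_closed_def
      proof (intro conjI ballI impI)
        fix x y assume "x \<in> C" "y \<in> R" "b y = b x"
        moreover from this have "y \<noteq> e" "y \<noteq> \<alpha> e" using n e C(2) by auto
        ultimately show "y \<in> C" using C(1) unfolding even_closed_def by blast
      qed (use C(1) in \<open>auto simp: even_closed_def\<close>)
      with I n show False by blast
    qed
    with C show ?thesis by metis
  qed
  obtain C1 where C1: "even_closed \<alpha> b (R - {e0, \<alpha> e0}) C1" "\<forall>g\<in>C1. b g \<noteq> b (\<alpha> e0)"
      "b (\<alpha> e0) \<noteq> w" "\<exists>g\<in>C1. b g = w" using key[OF ne] by blast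
  then obtain q where q: "q \<in> C1" "b q = w" by blast
  have qR: "q \<in> R" "q \<noteq> e0" using q C1(1) unfolding even_closed_def by auto
  obtain C2 where C2: "even_closed \<alpha> b (R - {q, \<alpha> q}) C2" "\<forall>g\<in>C2. b g \<noteq> b (\<alpha> q)"
      "b (\<alpha> q) \<noteq> w" "\<exists>g\<in>C2. b g = w" using key[OF qR(1) q(2)] by blast
  define D where "D = C1 \<inter> C2"
  have sub: "C1 \<subseteq> R" "C2 \<subseteq> R" using C1(1) C2(1) unfolding even_closed_def by auto
  have finD: "finite D" unfolding D_def using sub fin finite_subset by blast
  have pD: "pairing \<alpha> D"
  proof (rule pairing_subset[OF p])
    have "\<alpha> ` C1 \<subseteq> C1" using C1(1) unfolding even_closed_def by simp
    moreover have "\<alpha> ` C2 \<subseteq> C2" using C2(1) unfolding even_closed_def by simp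
    ultimately show "\<alpha> ` D \<subseteq> D" unfolding D_def by blast
    show "D \<subseteq> R" using sub(1) unfolding D_def by auto
  qed
  \<comment> \<open>\<open>C1\<close> misses only \<open>e0\<close> at \<open>w\<close>, and
    \<open>C2\<close> misses only \<open>q\<close>. So the intersection has exactly one edge less at
    \<open>w\<close> than \<open>C1\<close>, which is an odd number.\<close>
  have C1w: "{e\<in>C1. b e = w} = {e\<in>R. b e = w} - {e0}"
  proof -
    have "x \<in> C1" if "x \<in> R" "b x = w" "x \<noteq> e0" for x
    proof -
      have "x \<in> R - {e0, \<alpha> e0}" using that C1(3) by auto
      then show ?thesis using C1(1) q that unfolding even_closed_def by metis
    qed
    then show ?thesis using C1(1) unfolding even_closed_def by blast
  qed
  have C2w: "{e\<in>C2. b e = w} = {e\<in>R. b e = w} - {q}"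
  proof -
    obtain g where g: "g \<in> C2" "b g = w" using C2(4) by blast
    have "x \<in> C2" if "x \<in> R" "b x = w" "x \<noteq> q" for x
    proof -
      have "x \<in> R - {q, \<alpha> q}" using that C2(3) by auto
      then show ?thesis using C2(1) g that unfolding even_closed_def by metis
    qed
    then show ?thesis using C2(1) unfolding even_closed_def by blast
  qed
  have "{e\<in>D. b e = w} = {e\<in>C1. b e = w} - {q}"
    using C1w C2w unfolding D_def by blast
  then have "card {e\<in>C1. b e = w} = Suc (card {e\<in>D. b e = w})"
    using card.remove[of "{e\<in>C1. b e = w}" q] q finite_subset[OF sub(1) fin] by simp
  moreover have "even (card {e\<in>C1. b e = w})" using C1(1) unfolding even_closed_def by blast
  ultimately have oddw: "odd (card {e\<in>D. b e = w})" by simp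
  have evz: "even (card {e\<in>D. b e = z})" if z: "z \<noteq> w" for z
  proof (cases "{e\<in>D. b e = z} = {}")
    case False
    then obtain g where g: "g \<in> C1" "g \<in> C2" "b g = z" unfolding D_def by blast
    \<comment> \<open>Each of the two sets avoids the far end of its removed pair. At any vertex
      other than \<open>w\<close> that both meet, nothing was removed, so \<open>D\<close> has the
      same even degree there as \<open>C1\<close>.\<close>
    have zn: "z \<noteq> b (\<alpha> e0)" "z \<noteq> b (\<alpha> q)" using g C1(2) C2(2) by auto
    have "x \<in> C2" if "x \<in> C1" "b x = z" for x
    proof -
      have "x \<in> R - {q, \<alpha> q}" using that sub zn q z by auto
      then show ?thesis using C2(1) g that unfolding even_closed_def by metis
    qed
    then have "{e\<in>D. b e = z} = {e\<in>C1. b e = z}" unfolding D_def by blast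
    then show ?thesis using C1(1) unfolding even_closed_def by simp
  qed (metis card.empty even_zero)
  have "w \<in> b ` D" using oddw by (metis (mono_tags, lifting) Collect_empty_eq card.empty even_zero image_eqI)
  have "card D = card {e\<in>D. b e = w} + (\<Sum>z\<in>b ` D - {w}. card {e\<in>D. b e = z})"
    using sum_fibre_card[OF finD, of b] \<open>w \<in> b ` D\<close> finD by (metis (no_types, lifting) finite_imageI sum.remove)
  moreover have "even (\<Sum>z\<in>b ` D - {w}. card {e\<in>D. b e = z})"
    by (rule dvd_sum) (use evz in auto)
  ultimately have "odd (card D)" using oddw by simp
  with pairing_even_card[OF finD pD] show False by simp
qed

subsection \<open>Labellings from a pairing\<close>

text \<open>A vertex with \<open>D\<close> edges is passed \<open>D div 2\<close> times, with sum at least \<open>c\<close> each time;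
  an unmatched edge contributes at least 1.\<close>

definition pass_bound :: "int \<Rightarrow> nat \<Rightarrow> int \<Rightarrow> bool" where
  "pass_bound c D t \<longleftrightarrow> int (D div 2) * c + int (D mod 2) \<le> t"

lemma pass_bound_pair: "pass_bound c D t \<Longrightarrow> c \<le> c' \<Longrightarrow> pass_bound c (Suc (Suc D)) (t + c')"
  unfolding pass_bound_def by (simp add: algebra_simps)

text \<open>A single unmatched label is affordable where it makes the degree odd; this is why all
  trails are started and ended with an eye on parity.\<close>

lemma pass_bound_single: "pass_bound c D t \<Longrightarrow> even D \<Longrightarrow> 1 \<le> x \<Longrightarrow> pass_bound c (Suc D) (t + x)"
  unfolding pass_bound_def by (auto elim!: evenE)

text \<open>The interval is symmetric about \<open>s / 2\<close>. Giving \<open>x\<close> and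
  \<open>s - x\<close> to one pair leaves the same problem with \<open>x + 1\<close> and unchanged
  \<open>s\<close>, so labels are spent from the outside in.\<close>

definition exact_labelling :: "('e \<Rightarrow> 'e) \<Rightarrow> 'e set \<Rightarrow> int \<Rightarrow> int \<Rightarrow> ('e \<Rightarrow> int) \<Rightarrow> bool" where
  "exact_labelling \<alpha> R x s f \<longleftrightarrow> bij_betw f R {x..s - x} \<and> (\<forall>e\<in>R. f e + f (\<alpha> e) = s)"

lemma fdeg_empty [simp]: "fdeg b {} w = 0" and fsum_empty [simp]: "fsum b {} f w = 0"
  by (simp_all add: fdeg_def fsum_def)

lemma fdeg_insert: "finite R \<Longrightarrow> e \<notin> R \<Longrightarrow> fdeg b (insert e R) w = fdeg b R w + (if b e = w then 1 else 0)"
  unfolding fdeg_def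
  by (cases "b e = w") (simp_all add: Collect_conj_eq Int_insert_left flip: Int_def, simp_all add: conj_disj_distribR Collect_disj_eq)

lemma fsum_insert: "finite R \<Longrightarrow> e \<notin> R \<Longrightarrow> fsum b (insert e R) f w = fsum b R f w + (if b e = w then f e else 0)"
proof -
  assume a: "finite R" "e \<notin> R"
  have "{g \<in> insert e R. b g = w} = (if b e = w then insert e {g\<in>R. b g = w} else {g\<in>R. b g = w})" by auto
  then show ?thesis using a unfolding fsum_def by (simp add: add.commute)
qed

lemma fsum_cong: "(\<And>e. e \<in> R \<Longrightarrow> f e = g e) \<Longrightarrow> fsum b R f w = fsum b R g w"
  unfolding fsum_def by (rule sum.cong) auto

text \<open>The new pair takes the two outermost labels. \<open>q\<close> is the direction of
  travel: the trail leaves along \<open>e\<close> with the low label when the labels run forward,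
  with the high one when they run backward.\<close>

lemma exact_extend:
  assumes fin: "finite R" and p: "pairing \<alpha> R" and e: "e \<in> R"
    and ex: "exact_labelling \<alpha> (R - {e, \<alpha> e}) (x + 1) s f'"
    and q: "q = x \<or> q = s - x" and xs: "2 * x < s"
    and f: "f = f'(e := q, \<alpha> e := s - q)"
  shows "exact_labelling \<alpha> R x s f"
    and "fsum b R f z = fsum b (R - {e, \<alpha> e}) f' z + (if b e = z then q else 0) + (if b (\<alpha> e) = z then s - q else 0)"
    and "fdeg b R z = fdeg b (R - {e, \<alpha> e}) z + (if b e = z then 1 else 0) + (if b (\<alpha> e) = z then 1 else 0)"
proof -
  define R' where "R' = R - {e, \<alpha> e}"
  have a: "\<alpha> e \<in> R" "\<alpha> e \<noteq> e" "\<alpha> (\<alpha> e) = e" using p e unfolding pairing_def by auto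
  have R: "R = insert e (insert (\<alpha> e) R')" and n: "e \<notin> R'" "\<alpha> e \<notin> R'" "finite R'"
    using e a fin unfolding R'_def by auto
  have fe: "f e = q" "f (\<alpha> e) = s - q" using f a by auto
  have fR: "f g = f' g" if "g \<in> R'" for g using that n f by auto
  have bij: "bij_betw f' R' {x+1..s-(x+1)}" using ex unfolding exact_labelling_def R'_def by blast
  have "bij_betw f R' {x+1..s-(x+1)}" using bij_betw_cong[of R' f f'] fR bij by blast
  moreover have "bij_betw f {e, \<alpha> e} {x, s - x}" using fe q xs a by (auto simp: bij_betw_def inj_on_def)
  ultimately have "bij_betw f (R' \<union> {e, \<alpha> e}) ({x+1..s-(x+1)} \<union> {x, s - x})"
    by (rule bij_betw_combine) (use xs in auto)
  moreover have "R' \<union> {e, \<alpha> e} = R" using R by auto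
  moreover have "{x+1..s-(x+1)} \<union> {x, s - x} = {x..s-x}" using xs by auto
  ultimately have b1: "bij_betw f R {x..s-x}" by simp
  have b2: "f g + f (\<alpha> g) = s" if g: "g \<in> R" for g
  proof (cases "g \<in> R'")
    case True
    then have "\<alpha> g \<in> R'" using pairing_diff[OF p e] unfolding pairing_def R'_def by blast
    then show ?thesis using True fR ex unfolding exact_labelling_def R'_def by simp
  next
    case False
    then show ?thesis using g R fe a by auto
  qed
  show "exact_labelling \<alpha> R x s f" unfolding exact_labelling_def using b1 b2 by blast
  have "fsum b R f z = fsum b R' f z + (if b e = z then q else 0) + (if b (\<alpha> e) = z then s - q else 0)"
    unfolding R using n a fe by (subst fsum_insert, simp, simp, subst fsum_insert) simp_all
  moreover have "fsum b R' f z = fsum b R' f' z" by (rule fsum_cong) (rule fR)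
  ultimately show "fsum b R f z = fsum b (R - {e, \<alpha> e}) f' z + (if b e = z then q else 0) + (if b (\<alpha> e) = z then s - q else 0)"
    unfolding R'_def by simp
  have "fdeg b R z = fdeg b R' z + (if b e = z then 1 else 0) + (if b (\<alpha> e) = z then 1 else 0)"
    unfolding R using n a by (subst fdeg_insert, simp, simp, subst fdeg_insert) simp_all
  then show "fdeg b R z = fdeg b (R - {e, \<alpha> e}) z + (if b e = z then 1 else 0) + (if b (\<alpha> e) = z then 1 else 0)"
    unfolding R'_def by simp
qed

lemma exact_empty: "s = 2 * x - 1 \<Longrightarrow> exact_labelling \<alpha> {} x s f"
  unfolding exact_labelling_def by (simp add: bij_betw_def)

lemma pairing_card_diff:
  assumes "finite R" "pairing \<alpha> R" "e \<in> R"
  shows "card R = card (R - {e, \<alpha> e}) + 2"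
proof -
  have "\<alpha> e \<in> R" "\<alpha> e \<noteq> e" using assms unfolding pairing_def by auto
  then have "card (R - {e, \<alpha> e}) = card R - 2" "card {e, \<alpha> e} \<le> card R"
    using assms card_mono[of R "{e, \<alpha> e}"] by (auto simp: card_Diff_subset)
  then show ?thesis using \<open>\<alpha> e \<noteq> e\<close> by simp
qed

text \<open>In the second part the edge last labelled \<open>s - x + 1\<close> waits at \<open>w\<close> to be matched.\<close>

lemma forward_labelling_aux:
  assumes "finite R" "pairing \<alpha> R" "1 \<le> x" "int (card R) = s - 2 * x + 1"
  shows "((\<forall>C. \<not> even_closed \<alpha> b R C) \<longrightarrow>
            (\<exists>f. exact_labelling \<alpha> R x s f \<and> (\<forall>z. pass_bound s (fdeg b R z) (fsum b R f z))))
       \<and> (\<forall>w. (\<forall>C. even_closed \<alpha> b R C \<longrightarrow> (\<exists>e\<in>C. b e = w)) \<longrightarrow>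
            (\<exists>f. exact_labelling \<alpha> R x s f \<and>
              (\<forall>z. pass_bound s (fdeg b R z + (if z = w then 1 else 0)) (fsum b R f z + (if z = w then s - x + 1 else 0)))))"
  using assms
proof (induction "card R" arbitrary: R x rule: less_induct)
  case less
  note fin = less.prems(1) and p = less.prems(2)
  have step: "\<exists>f' f. f = f'(e := x, \<alpha> e := s - x) \<and> exact_labelling \<alpha> (R - {e, \<alpha> e}) (x+1) s f' \<and>
       exact_labelling \<alpha> R x s f \<and>
       (\<forall>z. pass_bound s (fdeg b (R - {e, \<alpha> e}) z + (if z = b (\<alpha> e) then 1 else 0)) (fsum b (R - {e, \<alpha> e}) f' z + (if z = b (\<alpha> e) then s - x else 0)))
       \<and> (\<forall>z. fsum b R f z = fsum b (R - {e, \<alpha> e}) f' z + (if b e = z then x else 0) + (if b (\<alpha> e) = z then s - x else 0))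
       \<and> (\<forall>z. fdeg b R z = fdeg b (R - {e, \<alpha> e}) z + (if b e = z then 1 else 0) + (if b (\<alpha> e) = z then 1 else 0))"
    if e: "e \<in> R" and I: "\<forall>C. even_closed \<alpha> b (R - {e, \<alpha> e}) C \<longrightarrow> (\<exists>g\<in>C. b g = b (\<alpha> e))" for e
  proof -
    have c: "card R = card (R - {e, \<alpha> e}) + 2" using pairing_card_diff[OF fin p e] .
    then have xs: "2 * x < s" and c1: "card (R - {e, \<alpha> e}) < card R" using less.prems(4) by linarith+
    have eq: "s - (x + 1) + 1 = s - x" by simp
    have "(\<forall>w. (\<forall>C. even_closed \<alpha> b (R - {e, \<alpha> e}) C \<longrightarrow> (\<exists>g\<in>C. b g = w)) \<longrightarrow>
            (\<exists>f. exact_labelling \<alpha> (R - {e, \<alpha> e}) (x+1) s f \<and>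
              (\<forall>z. pass_bound s (fdeg b (R - {e, \<alpha> e}) z + (if z = w then 1 else 0)) (fsum b (R - {e, \<alpha> e}) f z + (if z = w then s - x else 0)))))"
      by (rule less.hyps[OF c1 _ pairing_diff[OF p e], of "x + 1", unfolded eq, THEN conjunct2])
        (use c less.prems in auto)
    then obtain f' where f': "exact_labelling \<alpha> (R - {e, \<alpha> e}) (x+1) s f'"
      "\<forall>z. pass_bound s (fdeg b (R - {e, \<alpha> e}) z + (if z = b (\<alpha> e) then 1 else 0)) (fsum b (R - {e, \<alpha> e}) f' z + (if z = b (\<alpha> e) then s - x else 0))"
      using I by blast
    note ext = exact_extend[OF fin p e f'(1) disjI1[OF refl] xs refl]
    show ?thesis
      by (intro exI[of _ f'] exI[of _ "f'(e := x, \<alpha> e := s - x)"] conjI allI) (rule refl f'(1) ext f'(2)[rule_format])+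
  qed
  have A0: "\<exists>f. exact_labelling \<alpha> R x s f \<and> (\<forall>z. pass_bound s (fdeg b R z) (fsum b R f z))"
    if H: "\<forall>C. \<not> even_closed \<alpha> b R C"
  proof (cases "R = {}")
    case True
    then show ?thesis using less.prems by (auto simp: pass_bound_def intro!: exact_empty)
  next
    case False
    \<comment> \<open>If all degrees were even, \<open>R\<close> itself would be even closed. So the
      new trail can start at an odd vertex, where its first label may stay unmatched.\<close>
    have "\<not> even_closed \<alpha> b R R" using H by blast
    then obtain w where w: "odd (fdeg b R w)"
      using False p unfolding even_closed_def fdeg_def pairing_def by auto
    then obtain e0 where e0: "e0 \<in> R" "b e0 = w"
      unfolding fdeg_def by (metis (mono_tags, lifting) Collect_empty_eq card.empty even_zero)
    obtain e where e: "e \<in> R" "b e = w" "\<forall>C. even_closed \<alpha> b (R - {e, \<alpha> e}) C \<longrightarrow> (\<exists>g\<in>C. b g = b (\<alpha> e))"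
      using fleury_step[where b = b and w = w, OF fin p _ e0] H by blast
    obtain f f' where f: "exact_labelling \<alpha> R x s f"
       "\<And>z. pass_bound s (fdeg b (R - {e, \<alpha> e}) z + (if z = b (\<alpha> e) then 1 else 0)) (fsum b (R - {e, \<alpha> e}) f' z + (if z = b (\<alpha> e) then s - x else 0))"
       "\<And>z. fsum b R f z = fsum b (R - {e, \<alpha> e}) f' z + (if b e = z then x else 0) + (if b (\<alpha> e) = z then s - x else 0)"
       "\<And>z. fdeg b R z = fdeg b (R - {e, \<alpha> e}) z + (if b e = z then 1 else 0) + (if b (\<alpha> e) = z then 1 else 0)"
      using step[OF e(1,3)] by blast
    have "pass_bound s (fdeg b R z) (fsum b R f z)" for z
    proof (cases "z = w")
      case True
      have d: "fdeg b R z = Suc (fdeg b (R - {e, \<alpha> e}) z + (if z = b (\<alpha> e) then 1 else 0))"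
        "fsum b R f z = (fsum b (R - {e, \<alpha> e}) f' z + (if z = b (\<alpha> e) then s - x else 0)) + x"
        using f(3,4)[of z] True e by auto
      show ?thesis unfolding d
        by (rule pass_bound_single[OF f(2)]) (use d(1) w True less.prems in auto)
    next
      case False
      have "fdeg b R z = fdeg b (R - {e, \<alpha> e}) z + (if z = b (\<alpha> e) then 1 else 0)"
        "fsum b R f z = fsum b (R - {e, \<alpha> e}) f' z + (if z = b (\<alpha> e) then s - x else 0)"
        using f(3,4)[of z] False e by auto
      then show ?thesis using f(2)[of z] by simp
    qed
    then show ?thesis using f(1) by blast
  qed
  have A1: "\<exists>f. exact_labelling \<alpha> R x s f \<and>
       (\<forall>z. pass_bound s (fdeg b R z + (if z = w then 1 else 0)) (fsum b R f z + (if z = w then s - x + 1 else 0)))"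
    if I: "\<forall>C. even_closed \<alpha> b R C \<longrightarrow> (\<exists>e\<in>C. b e = w)" for w
  proof (cases "\<exists>e\<in>R. b e = w")
    \<comment> \<open>The trail is stuck at \<open>w\<close>. Every even closed set meets
      \<open>w\<close>, so none is left and a new trail can start; the waiting label is the only one
      counted at \<open>w\<close>.\<close>
    case False
    moreover have "\<And>C. even_closed \<alpha> b R C \<Longrightarrow> C \<subseteq> R" unfolding even_closed_def by simp
    ultimately have "\<forall>C. \<not> even_closed \<alpha> b R C" using I by blast
    from A0[OF this] obtain f where f: "exact_labelling \<alpha> R x s f" "\<And>z. pass_bound s (fdeg b R z) (fsum b R f z)" by blast
    have emp: "{e\<in>R. b e = w} = {}" using False by blast
    have "fdeg b R w = 0" "fsum b R f w = 0" unfolding fdeg_def fsum_def emp by simp_all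
    moreover have "s - x + 1 \<ge> 1" using less.prems by linarith
    ultimately show ?thesis using f by (intro exI[of _ f]) (auto simp: pass_bound_def)
  next
    case True
    then obtain e0 where e0: "e0 \<in> R" "b e0 = w" by blast
    obtain e where e: "e \<in> R" "b e = w" "\<forall>C. even_closed \<alpha> b (R - {e, \<alpha> e}) C \<longrightarrow> (\<exists>g\<in>C. b g = b (\<alpha> e))"
      using fleury_step[where b = b and w = w, OF fin p _ e0] I by blast
    obtain f f' where f: "exact_labelling \<alpha> R x s f"
       "\<And>z. pass_bound s (fdeg b (R - {e, \<alpha> e}) z + (if z = b (\<alpha> e) then 1 else 0)) (fsum b (R - {e, \<alpha> e}) f' z + (if z = b (\<alpha> e) then s - x else 0))"
       "\<And>z. fsum b R f z = fsum b (R - {e, \<alpha> e}) f' z + (if b e = z then x else 0) + (if b (\<alpha> e) = z then s - x else 0)"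
       "\<And>z. fdeg b R z = fdeg b (R - {e, \<alpha> e}) z + (if b e = z then 1 else 0) + (if b (\<alpha> e) = z then 1 else 0)"
      using step[OF e(1,3)] by blast
    have "pass_bound s (fdeg b R z + (if z = w then 1 else 0)) (fsum b R f z + (if z = w then s - x + 1 else 0))" for z
    proof (cases "z = w")
      case True
      \<comment> \<open>The waiting \<open>s - x + 1\<close> meets the new low label
        \<open>x\<close>, one more than required.\<close>
      have d: "fdeg b R z + (if z = w then 1 else 0) = Suc (Suc (fdeg b (R - {e, \<alpha> e}) z + (if z = b (\<alpha> e) then 1 else 0)))"
        "fsum b R f z + (if z = w then s - x + 1 else 0) = (fsum b (R - {e, \<alpha> e}) f' z + (if z = b (\<alpha> e) then s - x else 0)) + (s + 1)"
        using f(3,4)[of z] True e by auto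
      show ?thesis unfolding d by (rule pass_bound_pair[OF f(2)]) simp
    next
      case False
      have "fdeg b R z + (if z = w then 1 else 0) = fdeg b (R - {e, \<alpha> e}) z + (if z = b (\<alpha> e) then 1 else 0)"
        "fsum b R f z + (if z = w then s - x + 1 else 0) = fsum b (R - {e, \<alpha> e}) f' z + (if z = b (\<alpha> e) then s - x else 0)"
        using f(3,4)[of z] False e by auto
      then show ?thesis using f(2)[of z] by simp
    qed
    then show ?thesis using f(1) by blast
  qed
  show ?case using A0 A1 by blast
qed

theorem forward_labelling:
  assumes "finite R" "pairing \<alpha> R" "\<And>C. \<not> even_closed \<alpha> b R C"
  obtains f where "exact_labelling \<alpha> R 1 (int (card R) + 1) f"
    "\<And>z. pass_bound (int (card R) + 1) (fdeg b R z) (fsum b R f z)"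
  using forward_labelling_aux[of R \<alpha> 1 "int (card R) + 1" b] assms by auto

text \<open>Here the labels run outwards along the trails, so a passage may fall one short of the
  exact sum, but closed trails need no special treatment: at the start \<open>v\<close> the outstanding
  label \<open>Y\<close> of the first edge pairs up with the label of the last one.\<close>

lemma backward_labelling_aux:
  assumes "finite R" "pairing \<alpha> R" "1 \<le> x" "int (card R) = s - 2 * x + 1"
  shows "(\<exists>f. exact_labelling \<alpha> R x s f \<and> (\<forall>z. pass_bound (s - 1) (fdeg b R z) (fsum b R f z)))
       \<and> (\<forall>w v Y. 2 \<le> x \<longrightarrow> s - x + 1 \<le> Y \<longrightarrow>
            (even (fdeg b R v + (if v = w then 1 else 0)) \<or> (\<forall>z. z \<noteq> v \<longrightarrow> even (fdeg b R z + (if z = w then 1 else 0)))) \<longrightarrow>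
            (\<exists>f. exact_labelling \<alpha> R x s f \<and>
              (\<forall>z. pass_bound (s - 1) (fdeg b R z + (if z = w then 1 else 0) + (if z = v then 1 else 0))
                 (fsum b R f z + (if z = w then x - 1 else 0) + (if z = v then Y else 0)))))"
  using assms
proof (induction "card R" arbitrary: R x rule: less_induct)
  case less
  note fin = less.prems(1) and p = less.prems(2)
  have step: "\<exists>f' f. exact_labelling \<alpha> R x s f \<and>
       (\<forall>z. pass_bound (s - 1) (fdeg b (R - {e, \<alpha> e}) z + (if z = b (\<alpha> e) then 1 else 0) + (if z = v then 1 else 0))
              (fsum b (R - {e, \<alpha> e}) f' z + (if z = b (\<alpha> e) then x else 0) + (if z = v then Y else 0)))
       \<and> (\<forall>z. fsum b R f z = fsum b (R - {e, \<alpha> e}) f' z + (if b e = z then s - x else 0) + (if b (\<alpha> e) = z then x else 0))"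
    if e: "e \<in> R" and Y: "s - x \<le> Y" and
      par: "even (fdeg b (R - {e, \<alpha> e}) v + (if v = b (\<alpha> e) then 1 else 0)) \<or>
        (\<forall>z. z \<noteq> v \<longrightarrow> even (fdeg b (R - {e, \<alpha> e}) z + (if z = b (\<alpha> e) then 1 else 0)))" for e v Y
  proof -
    have c: "card R = card (R - {e, \<alpha> e}) + 2" using pairing_card_diff[OF fin p e] .
    then have xs: "2 * x < s" and c1: "card (R - {e, \<alpha> e}) < card R" using less.prems(4) by linarith+
    have eq: "s - (x + 1) + 1 = s - x" "x + 1 - 1 = x" by simp_all
    have x2: "2 \<le> x + 1" using less.prems by simp
    have "(\<forall>w v Y. 2 \<le> x + 1 \<longrightarrow> s - x \<le> Y \<longrightarrow>
            (even (fdeg b (R - {e, \<alpha> e}) v + (if v = w then 1 else 0)) \<or> (\<forall>z. z \<noteq> v \<longrightarrow> even (fdeg b (R - {e, \<alpha> e}) z + (if z = w then 1 else 0)))) \<longrightarrow>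
            (\<exists>f. exact_labelling \<alpha> (R - {e, \<alpha> e}) (x+1) s f \<and>
              (\<forall>z. pass_bound (s - 1) (fdeg b (R - {e, \<alpha> e}) z + (if z = w then 1 else 0) + (if z = v then 1 else 0))
                 (fsum b (R - {e, \<alpha> e}) f z + (if z = w then x else 0) + (if z = v then Y else 0)))))"
      by (rule less.hyps[OF c1 _ pairing_diff[OF p e], of "x + 1", unfolded eq, THEN conjunct2])
        (use c less.prems in auto)
    then obtain f' where f': "exact_labelling \<alpha> (R - {e, \<alpha> e}) (x+1) s f'"
      "\<forall>z. pass_bound (s - 1) (fdeg b (R - {e, \<alpha> e}) z + (if z = b (\<alpha> e) then 1 else 0) + (if z = v then 1 else 0))
              (fsum b (R - {e, \<alpha> e}) f' z + (if z = b (\<alpha> e) then x else 0) + (if z = v then Y else 0))"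
      using Y par x2 by blast
    have ss: "s - (s - x) = x" by simp
    note ext = exact_extend[OF fin p e f'(1) disjI2[OF refl] xs refl, unfolded ss]
    show ?thesis
      by (intro exI[of _ f'] exI[of _ "f'(e := s - x, \<alpha> e := x)"] conjI allI) (rule ext f'(2)[rule_format])+
  qed
  have dg: "fdeg b R z = fdeg b (R - {e, \<alpha> e}) z + (if b e = z then 1 else 0) + (if b (\<alpha> e) = z then 1 else 0)"
    if e: "e \<in> R" for e z
  proof -
    have a: "\<alpha> e \<in> R" "\<alpha> e \<noteq> e" using p e unfolding pairing_def by auto
    have R: "R = insert e (insert (\<alpha> e) (R - {e, \<alpha> e}))" using a e by auto
    show ?thesis by (subst R, subst fdeg_insert, use fin a in simp, use a in simp, subst fdeg_insert) (use fin in simp_all)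
  qed
  have A0: "\<exists>f. exact_labelling \<alpha> R x s f \<and> (\<forall>z. pass_bound (s - 1) (fdeg b R z) (fsum b R f z))"
  proof (cases "R = {}")
    case True
    then show ?thesis using less.prems by (auto simp: pass_bound_def intro!: exact_empty)
  next
    case False
    \<comment> \<open>The start is an odd vertex if there is one, so that the first label may stay
      unmatched. If all degrees are even, the trail can only end where it began.\<close>
    obtain e where e: "e \<in> R" "odd (fdeg b R (b e)) \<or> (\<forall>z. even (fdeg b R z))"
    proof (cases "\<forall>z. even (fdeg b R z)")
      case True
      then show ?thesis using that False by blast
    next
      case F: False
      then obtain w where w: "odd (fdeg b R w)" by blast
      then have "{e\<in>R. b e = w} \<noteq> {}" unfolding fdeg_def by (metis card.empty even_zero)
      then show ?thesis using that w by blast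
    qed
    have par: "even (fdeg b (R - {e, \<alpha> e}) (b e) + (if b e = b (\<alpha> e) then 1 else 0)) \<or>
        (\<forall>z. z \<noteq> b e \<longrightarrow> even (fdeg b (R - {e, \<alpha> e}) z + (if z = b (\<alpha> e) then 1 else 0)))"
      using e(2)
    proof
      assume "odd (fdeg b R (b e))"
      then show ?thesis using dg[OF e(1), of "b e"] by auto
    next
      assume ev: "\<forall>z. even (fdeg b R z)"
      have "even (fdeg b (R - {e, \<alpha> e}) z + (if z = b (\<alpha> e) then 1 else 0))" if "z \<noteq> b e" for z
        using dg[OF e(1), of z] ev[rule_format, of z] that by auto
      then show ?thesis by blast
    qed
    obtain f f' where f: "exact_labelling \<alpha> R x s f"
       "\<And>z. pass_bound (s - 1) (fdeg b (R - {e, \<alpha> e}) z + (if z = b (\<alpha> e) then 1 else 0) + (if z = b e then 1 else 0))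
              (fsum b (R - {e, \<alpha> e}) f' z + (if z = b (\<alpha> e) then x else 0) + (if z = b e then s - x else 0))"
       "\<And>z. fsum b R f z = fsum b (R - {e, \<alpha> e}) f' z + (if b e = z then s - x else 0) + (if b (\<alpha> e) = z then x else 0)"
      using step[OF e(1) order_refl par] by blast
    have "pass_bound (s - 1) (fdeg b R z) (fsum b R f z)" for z
    proof -
      have "fdeg b R z = fdeg b (R - {e, \<alpha> e}) z + (if z = b (\<alpha> e) then 1 else 0) + (if z = b e then 1 else 0)"
        "fsum b R f z = fsum b (R - {e, \<alpha> e}) f' z + (if z = b (\<alpha> e) then x else 0) + (if z = b e then s - x else 0)"
        using f(3)[of z] dg[OF e(1), of z] by auto
      with f(2)[of z] show ?thesis by simp
    qed
    then show ?thesis using f(1) by blast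
  qed
  have A1: "\<exists>f. exact_labelling \<alpha> R x s f \<and>
              (\<forall>z. pass_bound (s - 1) (fdeg b R z + (if z = w then 1 else 0) + (if z = v then 1 else 0))
                 (fsum b R f z + (if z = w then x - 1 else 0) + (if z = v then Y else 0)))"
    if x2: "2 \<le> x" and Y: "s - x + 1 \<le> Y" and
      par: "even (fdeg b R v + (if v = w then 1 else 0)) \<or> (\<forall>z. z \<noteq> v \<longrightarrow> even (fdeg b R z + (if z = w then 1 else 0)))" for w v Y
  proof (cases "\<exists>e\<in>R. b e = w")
    case False
    from A0 obtain f where f: "exact_labelling \<alpha> R x s f" "\<And>z. pass_bound (s - 1) (fdeg b R z) (fsum b R f z)" by blast
    have emp: "{e\<in>R. b e = w} = {}" using False by blast
    have 0: "fdeg b R w = 0" "fsum b R f w = 0" unfolding fdeg_def fsum_def emp by simp_all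
    have Y1: "1 \<le> Y" using less.prems Y by linarith
    \<comment> \<open>The trail is stuck at \<open>w\<close>. If \<open>w = v\<close>, the waiting
      \<open>x - 1\<close> and \<open>Y\<close> together reach \<open>s\<close>. Otherwise the count
      at \<open>w\<close> is odd, so \<open>par\<close> forces an even count at \<open>v\<close>
      before \<open>Y\<close> is added, and \<open>x - 1\<close> and \<open>Y\<close> are the
      unmatched labels of their vertices. The assumption \<open>2 \<le> x\<close> makes
      \<open>x - 1\<close> at least 1.\<close>
    have "pass_bound (s - 1) (fdeg b R z + (if z = w then 1 else 0) + (if z = v then 1 else 0))
                 (fsum b R f z + (if z = w then x - 1 else 0) + (if z = v then Y else 0))" for z
    proof (cases "z = w")
      case True
      then show ?thesis using 0 x2 Y by (auto simp: pass_bound_def)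
    next
      case zw: False
      show ?thesis
      proof (cases "z = v")
        case True
        then have "even (fdeg b R z)" using par zw 0 by auto
        then show ?thesis using pass_bound_single[OF f(2) _ Y1] zw True by simp
      qed (use f zw in simp)
    qed
    then show ?thesis using f(1) by blast
  next
    case True
    then obtain e where e: "e \<in> R" "b e = w" by blast
    have Y': "s - x \<le> Y" using Y by simp
    have par': "even (fdeg b (R - {e, \<alpha> e}) v + (if v = b (\<alpha> e) then 1 else 0)) \<or>
        (\<forall>z. z \<noteq> v \<longrightarrow> even (fdeg b (R - {e, \<alpha> e}) z + (if z = b (\<alpha> e) then 1 else 0)))"
    proof -
      \<comment> \<open>Advancing the trail by one pair changes every count by an even number:
        \<open>w\<close> loses the waiting label and \<open>e\<close>, and \<open>\<alpha> e\<close>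
        becomes the new waiting label at its vertex.\<close>
      have "even (fdeg b R z + (if z = w then 1 else 0)) \<longleftrightarrow> even (fdeg b (R - {e, \<alpha> e}) z + (if z = b (\<alpha> e) then 1 else 0))" for z
        using dg[OF e(1), of z] e(2) by auto
      then show ?thesis using par by blast
    qed
    obtain f f' where f: "exact_labelling \<alpha> R x s f"
       "\<And>z. pass_bound (s - 1) (fdeg b (R - {e, \<alpha> e}) z + (if z = b (\<alpha> e) then 1 else 0) + (if z = v then 1 else 0))
              (fsum b (R - {e, \<alpha> e}) f' z + (if z = b (\<alpha> e) then x else 0) + (if z = v then Y else 0))"
       "\<And>z. fsum b R f z = fsum b (R - {e, \<alpha> e}) f' z + (if b e = z then s - x else 0) + (if b (\<alpha> e) = z then x else 0)"
      using step[OF e(1) Y' par'] by blast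
    have "pass_bound (s - 1) (fdeg b R z + (if z = w then 1 else 0) + (if z = v then 1 else 0))
                 (fsum b R f z + (if z = w then x - 1 else 0) + (if z = v then Y else 0))" for z
    proof (cases "z = w")
      case True
      \<comment> \<open>Here the waiting \<open>x - 1\<close> meets \<open>s - x\<close>: the origin
        of \<open>s - 1\<close>.\<close>
      have d: "fdeg b R z + (if z = w then 1 else 0) + (if z = v then 1 else 0) = Suc (Suc (fdeg b (R - {e, \<alpha> e}) z + (if z = b (\<alpha> e) then 1 else 0) + (if z = v then 1 else 0)))"
        "fsum b R f z + (if z = w then x - 1 else 0) + (if z = v then Y else 0) = (fsum b (R - {e, \<alpha> e}) f' z + (if z = b (\<alpha> e) then x else 0) + (if z = v then Y else 0)) + (s - 1)"
        using f(3)[of z] dg[OF e(1), of z] True e by auto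
      show ?thesis unfolding d by (rule pass_bound_pair[OF f(2)]) simp
    next
      case False
      have "fdeg b R z + (if z = w then 1 else 0) + (if z = v then 1 else 0) = fdeg b (R - {e, \<alpha> e}) z + (if z = b (\<alpha> e) then 1 else 0) + (if z = v then 1 else 0)"
        "fsum b R f z + (if z = w then x - 1 else 0) + (if z = v then Y else 0) = fsum b (R - {e, \<alpha> e}) f' z + (if z = b (\<alpha> e) then x else 0) + (if z = v then Y else 0)"
        using f(3)[of z] dg[OF e(1), of z] False e by auto
      then show ?thesis using f(2)[of z] by simp
    qed
    then show ?thesis using f(1) by blast
  qed
  show ?case using A0 A1 by blast
qed

theorem backward_labelling:
  assumes "finite R" "pairing \<alpha> R"
  obtains f where "exact_labelling \<alpha> R 1 (int (card R) + 1) f"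
    "\<And>z. pass_bound (int (card R)) (fdeg b R z) (fsum b R f z)"
  using backward_labelling_aux[of R \<alpha> 1 "int (card R) + 1" b] assms by auto

subsection \<open>Transversals and pairings\<close>

definition few_crossings :: "('e \<Rightarrow> 'u) \<Rightarrow> ('e \<Rightarrow> 'e) \<Rightarrow> 'e set \<Rightarrow> bool" where
  "few_crossings a \<alpha> T \<longleftrightarrow> (\<forall>u. card {e\<in>T. a e = u \<and> a (\<alpha> e) \<noteq> u} \<le> 1)"

text \<open>Edges with a common value of \<open>a\<close> are paired first. Once \<open>a\<close> is
  injective on the rest, any pairing of it crosses at most once per value.\<close>

lemma pairing_exists:
  assumes "finite T" "even (card T)"
  shows "\<exists>\<alpha>. pairing \<alpha> T \<and> few_crossings a \<alpha> T"
  using assms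
proof (induction "card T" arbitrary: T rule: less_induct)
  case less
  have ext: "\<exists>\<alpha>. pairing \<alpha> T \<and> (\<exists>\<alpha>'. few_crossings a \<alpha>' (T - {e, e'}) \<and> \<alpha> = \<alpha>'(e := e', e' := e))"
    if e: "e \<in> T" "e' \<in> T" "e \<noteq> e'" for e e'
  proof -
    have c: "card (T - {e, e'}) = card T - 2" "card {e, e'} \<le> card T"
      using e less.prems card_mono[of T "{e, e'}"] by (auto simp: card_Diff_subset)
    then have c2: "card T \<ge> 2" using e by simp
    obtain \<alpha>' where \<alpha>': "pairing \<alpha>' (T - {e, e'})" "few_crossings a \<alpha>' (T - {e, e'})"
      using less.hyps[of "T - {e, e'}"] c c2 less.prems by auto
    have "pairing (\<alpha>'(e := e', e' := e)) T"
      using \<alpha>'(1) e unfolding pairing_def by auto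
    then show ?thesis using \<alpha>' by blast
  qed
  show ?case
  proof (cases "T = {}")
    case True
    then show ?thesis by (simp add: pairing_def few_crossings_def)
  next
    case ne: False
    show ?thesis
    proof (cases "inj_on a T")
      case True
      obtain e where e: "e \<in> T" using ne by blast
      have "T \<noteq> {e}" using less.prems by auto
      then obtain e' where "e' \<in> T" "e \<noteq> e'" using e by blast
      with ext e obtain \<alpha> where "pairing \<alpha> T" by blast
      moreover have "card {e\<in>T. a e = u \<and> a (\<alpha> e) \<noteq> u} \<le> 1" for u
        using True less.prems(1) by (auto simp: card_le_Suc0_iff_eq inj_on_def)
      ultimately show ?thesis unfolding few_crossings_def by blast
    next
      case False
      then obtain e e' where e: "e \<in> T" "e' \<in> T" "e \<noteq> e'" "a e = a e'" unfolding inj_on_def by blast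
      obtain \<alpha> \<alpha>' where \<alpha>: "pairing \<alpha> T" "few_crossings a \<alpha>' (T - {e, e'})" "\<alpha> = \<alpha>'(e := e', e' := e)"
        using ext[OF e(1-3)] by blast
      have "{g\<in>T. a g = u \<and> a (\<alpha> g) \<noteq> u} \<subseteq> {g\<in>T - {e, e'}. a g = u \<and> a (\<alpha>' g) \<noteq> u}" for u
        using \<alpha>(3) e(4) by auto
      then have "card {g\<in>T. a g = u \<and> a (\<alpha> g) \<noteq> u} \<le> card {g\<in>T - {e, e'}. a g = u \<and> a (\<alpha>' g) \<noteq> u}" for u
        by (rule card_mono[rotated]) (use less.prems in simp)
      then have "few_crossings a \<alpha> T" using \<alpha>(2) unfolding few_crossings_def by (meson order_trans)
      then show ?thesis using \<alpha>(1) by blast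
    qed
  qed
qed

lemma pairing_sum:
  fixes f :: "'e \<Rightarrow> int"
  assumes fin: "finite N" and p: "pairing \<alpha> N" and s: "\<And>e. e \<in> N \<Longrightarrow> f e + f (\<alpha> e) = s"
  shows "sum f N = int (card N div 2) * s"
proof -
  have "bij_betw \<alpha> N N"
    by (rule bij_betw_byWitness[of _ \<alpha>]) (use p in \<open>auto simp: pairing_def\<close>)
  then have "sum (\<lambda>e. f (\<alpha> e)) N = sum f N" by (rule sum.reindex_bij_betw)
  moreover have "sum f N + sum (\<lambda>e. f (\<alpha> e)) N = int (card N) * s"
    using s by (simp add: sum.distrib[symmetric])
  moreover have "card N = 2 * (card N div 2)" using pairing_even_card[OF fin p] by simp
  ultimately show ?thesis by (metis (no_types, lifting) int_ops(7) mult.assoc mult_2 mult_left_cancel of_nat_numeral zero_neq_numeral)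
qed

text \<open>The pairs inside the class of \<open>u\<close> contribute \<open>s\<close> each, and by
  parity a crossing edge is present exactly when the degree is odd. Hence the sums on this side are
  controlled however the pairs are numbered.\<close>

lemma class_sum:
  fixes f :: "'e \<Rightarrow> int"
  assumes fin: "finite T" and p: "pairing \<alpha> T" and cr: "few_crossings a \<alpha> T"
    and s: "\<And>e. e \<in> T \<Longrightarrow> f e + f (\<alpha> e) = s" and m: "\<And>e. e \<in> T \<Longrightarrow> f e \<le> m"
  shows "even (fdeg a T u) \<Longrightarrow> fsum a T f u = int (fdeg a T u div 2) * s"
    and "odd (fdeg a T u) \<Longrightarrow> fsum a T f u \<le> int (fdeg a T u div 2) * s + m"
proof -
  define N where "N = {e\<in>T. a e = u \<and> a (\<alpha> e) = u}"
  define X where "X = {e\<in>T. a e = u \<and> a (\<alpha> e) \<noteq> u}"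
  have NX: "{e\<in>T. a e = u} = N \<union> X" "N \<inter> X = {}" "finite N" "finite X" unfolding N_def X_def using fin by auto
  have pN: "pairing \<alpha> N" using p unfolding N_def pairing_def by auto
  have X1: "card X \<le> 1" using cr unfolding few_crossings_def X_def by blast
  have "sum f N = int (card N div 2) * s" by (rule pairing_sum[OF NX(3) pN]) (use s N_def in auto)
  moreover have "fsum a T f u = sum f N + sum f X" unfolding fsum_def NX(1) using NX by (simp add: sum.union_disjoint)
  moreover have d: "fdeg a T u = card N + card X" unfolding fdeg_def NX(1) using NX by (simp add: card_Un_disjoint)
  moreover note ev = pairing_even_card[OF NX(3) pN]
  ultimately have *: "fsum a T f u = int (card N div 2) * s + sum f X" by simp
  show "fsum a T f u = int (fdeg a T u div 2) * s" if "even (fdeg a T u)"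
  proof -
    have "X = {}" using that d ev X1 NX(4) by (metis One_nat_def card_0_eq even_add le_Suc_eq le_zero_eq odd_one)
    then show ?thesis using * d by simp
  qed
  show "fsum a T f u \<le> int (fdeg a T u div 2) * s + m" if "odd (fdeg a T u)"
  proof -
    have c: "card X = 1" using that d ev X1 by (metis add.right_neutral le_neq_implies_less less_one)
    then obtain e where "X = {e}" by (rule card_1_singletonE)
    then have "sum f X \<le> m" using m unfolding X_def by auto
    then show ?thesis using * d ev c by simp
  qed
qed

text \<open>Minimise the union of the closed sets. Exchanging an edge \<open>e\<close> of a closed set with the transversal
  edge at \<open>a e\<close> leaves \<open>b e\<close> with odd degree, and by parity creates no new closed set.\<close>

lemma transversal_without_even_closed:
  assumes fin: "finite E" and simple: "inj_on (\<lambda>e. (a e, b e)) E" and par: "even (card E - card (a ` E))"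
  obtains G \<alpha> where "G \<subseteq> E" "inj_on a G" "a ` G = a ` E" "pairing \<alpha> (E - G)" "few_crossings a \<alpha> (E - G)"
    "\<And>C. \<not> even_closed \<alpha> b (E - G) C"
proof -
  define valid where "valid = (\<lambda>(G, \<alpha>). G \<subseteq> E \<and> inj_on a G \<and> a ` G = a ` E \<and> pairing \<alpha> (E - G) \<and> few_crossings a \<alpha> (E - G))"
  define cov where "cov = (\<lambda>(G, \<alpha>). \<Union>{C. even_closed \<alpha> b (E - G) C})"
  have cov_sub: "cov (G, \<alpha>) \<subseteq> E" for G \<alpha> unfolding cov_def even_closed_def by auto
  obtain G0 where G0: "G0 \<subseteq> E" "inj_on a G0" "a ` G0 = a ` E"
    by (metis subset_image_inj order_refl)
  have "card (E - G0) = card E - card (a ` E)"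
    using G0 fin by (metis card_Diff_subset card_image finite_subset)
  then obtain \<alpha>0 where "pairing \<alpha>0 (E - G0)" "few_crossings a \<alpha>0 (E - G0)"
    using pairing_exists[of "E - G0" a] par fin by auto
  then have "valid (G0, \<alpha>0)" unfolding valid_def using G0 by simp
  then obtain c where c: "valid c" "\<And>c'. valid c' \<Longrightarrow> card (cov c) \<le> card (cov c')"
    using ex_has_least_nat[of valid "(G0, \<alpha>0)" "\<lambda>c. card (cov c)"] by blast
  obtain G \<alpha> where ceq: "c = (G, \<alpha>)" by fastforce
  define T where "T = E - G"
  have v: "G \<subseteq> E" "inj_on a G" "a ` G = a ` E" "pairing \<alpha> T" "few_crossings a \<alpha> T"
    using c(1) unfolding ceq valid_def T_def by auto
  have finT: "finite T" unfolding T_def using fin by simp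
  have "\<not> even_closed \<alpha> b T C" for C
  proof
    assume C: "even_closed \<alpha> b T C"
    then obtain e where e: "e \<in> C" unfolding even_closed_def by blast
    have eT: "e \<in> T" "\<alpha> e \<in> C" "\<alpha> e \<in> T" "\<alpha> e \<noteq> e" "\<alpha> (\<alpha> e) = e" "C \<subseteq> T"
      using e C v(4) unfolding even_closed_def pairing_def by auto
    have "a e \<in> a ` G" using v(3) eT(1) unfolding T_def by auto
    then obtain g where g: "g \<in> G" "a g = a e" by auto
    have gT: "g \<notin> T" "g \<noteq> e" "g \<in> E" using g eT v(1) unfolding T_def by auto
    \<comment> \<open>Two edges with the same \<open>a\<close> differ in \<open>b\<close>, so
      \<open>g\<close> cannot replace \<open>e\<close> in the degree of \<open>b e\<close>.\<close>
    have bg: "b g \<noteq> b e" using simple g gT eT(1) unfolding inj_on_def T_def by auto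
    define G' where "G' = insert e (G - {g})"
    define \<alpha>' where "\<alpha>' = (\<lambda>x. if x = g then \<alpha> e else if x = \<alpha> e then g else \<alpha> x)"
    define T' where "T' = E - G'"
    have T': "T' = insert g (T - {e})" unfolding T'_def T_def G'_def using gT eT g unfolding T_def by auto
    have p': "pairing \<alpha>' T'"
      unfolding pairing_def
    proof
      fix x assume x: "x \<in> T'"
      show "\<alpha>' x \<in> T' \<and> \<alpha>' x \<noteq> x \<and> \<alpha>' (\<alpha>' x) = x"
      proof (cases "x = g \<or> x = \<alpha> e")
        case True
        then show ?thesis using eT gT unfolding T' \<alpha>'_def by auto
      next
        case False
        then have xT: "x \<in> T" "x \<noteq> e" using x T' by auto
        then have ax: "\<alpha> x \<in> T" "\<alpha> x \<noteq> x" "\<alpha> (\<alpha> x) = x" using v(4) unfolding pairing_def by auto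
        then have "\<alpha> x \<noteq> g" "\<alpha> x \<noteq> e" "\<alpha> x \<noteq> \<alpha> e" using False gT xT eT by metis+
        then show ?thesis using False ax unfolding T' \<alpha>'_def by simp
      qed
    qed
    have cr': "few_crossings a \<alpha>' T'"
      unfolding few_crossings_def
    proof
      fix u
      \<comment> \<open>\<open>g\<close> takes over the place of \<open>e\<close> in its pair, and
        \<open>a g = a e\<close>, so no class gains a crossing.\<close>
      have "card {x\<in>T'. a x = u \<and> a (\<alpha>' x) \<noteq> u} \<le> card {x\<in>T. a x = u \<and> a (\<alpha> x) \<noteq> u}"
      proof (rule card_inj_on_le)
        show "inj_on (\<lambda>x. if x = g then e else x) {x\<in>T'. a x = u \<and> a (\<alpha>' x) \<noteq> u}"
          unfolding T' inj_on_def by auto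
        show "(\<lambda>x. if x = g then e else x) ` {x\<in>T'. a x = u \<and> a (\<alpha>' x) \<noteq> u} \<subseteq> {x\<in>T. a x = u \<and> a (\<alpha> x) \<noteq> u}"
          unfolding T' \<alpha>'_def using g eT gT by (auto split: if_splits)
        show "finite {x\<in>T. a x = u \<and> a (\<alpha> x) \<noteq> u}" unfolding T_def using fin by simp
      qed
      then show "card {x\<in>T'. a x = u \<and> a (\<alpha>' x) \<noteq> u} \<le> 1"
        using v(5) unfolding few_crossings_def by (meson order_trans)
    qed
    have "inj_on a G'" using v(2) g unfolding G'_def inj_on_def by auto
    moreover have "a ` G' = a ` E"
    proof -
      have "G = insert g (G - {g})" using g by blast
      then have "a ` G = insert (a g) (a ` (G - {g}))" by (metis image_insert)
      then show ?thesis using v(3) g unfolding G'_def by simp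
    qed
    ultimately have val': "valid (G', \<alpha>')"
      unfolding valid_def using v(1) p' cr' eT(1) unfolding T'_def G'_def T_def by auto
    have main: "even_closed \<alpha> b T C' \<and> e \<notin> C'" if C': "even_closed \<alpha>' b T' C'" for C'
    proof -
      have subC': "C' \<subseteq> T'" and eC': "e \<notin> C'" using C' gT(2) T' unfolding even_closed_def by auto
      have cl': "y \<in> C'" if "x \<in> C'" "y \<in> T'" "b y = b x" for x y
        using C' that unfolding even_closed_def by blast
      have cl: "y \<in> C" if "x \<in> C" "y \<in> T" "b y = b x" for x y
        using C that unfolding even_closed_def by blast
      have now: "b x \<noteq> b e" if x: "x \<in> C'" for x
      proof
        assume bx: "b x = b e"
        have "{y\<in>C'. b y = b e} = {y\<in>T'. b y = b e}" using cl' x bx subC' by auto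
        also have "\<dots> = {y\<in>T. b y = b e} - {e}" unfolding T' using bg gT by auto
        also have "{y\<in>T. b y = b e} = {y\<in>C. b y = b e}" using cl e eT(6) by auto
        finally have "card {y\<in>C. b y = b e} = Suc (card {y\<in>C'. b y = b e})"
          using card.remove[of "{y\<in>C. b y = b e}" e] e finite_subset[OF eT(6) finT] by simp
        moreover have "even (card {y\<in>C. b y = b e})" "even (card {y\<in>C'. b y = b e})"
          using C C' unfolding even_closed_def by simp_all
        ultimately show False by simp
      qed
      \<comment> \<open>If \<open>g\<close> were in \<open>C'\<close>, so would be
        \<open>\<alpha> e\<close>, while \<open>e\<close> is not. Then \<open>\<alpha> e\<close> is
        the only edge of \<open>C \<inter> C'\<close> without its partner, and the number of edges
        is odd; but all nonzero degrees of the intersection are those of \<open>C\<close>, hence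
        even.\<close>
      have gC': "g \<notin> C'"
      proof
        assume gC: "g \<in> C'"
        have "\<alpha>' g \<in> C'" using C' gC unfolding even_closed_def by auto
        then have ae: "\<alpha> e \<in> C'" unfolding \<alpha>'_def by simp
        define D where "D = C \<inter> C'"
        have finD: "finite D" unfolding D_def using finite_subset[OF eT(6) finT] by simp
        have "pairing \<alpha> (D - {\<alpha> e})"
        proof (rule pairing_subset[OF v(4)])
          show "D - {\<alpha> e} \<subseteq> T" using eT(6) unfolding D_def by auto
          show "\<alpha> ` (D - {\<alpha> e}) \<subseteq> D - {\<alpha> e}"
          proof
            fix y assume "y \<in> \<alpha> ` (D - {\<alpha> e})"
            then obtain x where x: "x \<in> D" "x \<noteq> \<alpha> e" and y: "y = \<alpha> x" by blast
            have xT: "x \<in> T" using x eT(6) unfolding D_def by auto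
            then have "\<alpha>' x = \<alpha> x" using x gT unfolding \<alpha>'_def by auto
            moreover have "\<alpha>' x \<in> C'" using x C' unfolding D_def even_closed_def by blast
            moreover have "\<alpha> x \<in> C" using x C unfolding D_def even_closed_def by blast
            ultimately have "y \<in> D" unfolding D_def y by simp
            moreover have "y \<noteq> \<alpha> e"
            proof
              assume "y = \<alpha> e"
              then have "\<alpha> (\<alpha> x) = e" using eT y by simp
              then have "x = e" using v(4) xT unfolding pairing_def by simp
              then show False using x eC' unfolding D_def by simp
            qed
            ultimately show "y \<in> D - {\<alpha> e}" by simp
          qed
        qed
        then have "even (card (D - {\<alpha> e}))" using pairing_even_card finD by blast
        moreover have "\<alpha> e \<in> D" using ae eT unfolding D_def by simp
        ultimately have "odd (card D)" using finD by (metis card.remove even_Suc)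
        moreover have "even (card {y\<in>D. b y = z})" for z
        proof (cases "{y\<in>D. b y = z} = {}")
          case False
          then obtain x where x: "x \<in> C" "x \<in> C'" "b x = z" unfolding D_def by blast
          have "y \<in> C'" if "y \<in> C" "b y = z" for y
          proof -
            have "y \<noteq> e" using that now[OF x(2)] x by auto
            then show ?thesis using cl'[OF x(2), of y] that x T' eT(6) by auto
          qed
          then have "{y\<in>D. b y = z} = {y\<in>C. b y = z}" unfolding D_def by blast
          then show ?thesis using C unfolding even_closed_def by simp
        qed (metis card.empty even_zero)
        then have "even (card D)" using sum_fibre_card[OF finD, of b] by (metis (no_types, lifting) dvd_sum)
        ultimately show False by simp
      qed
      have aC': "\<alpha> e \<notin> C'"
      proof
        assume "\<alpha> e \<in> C'"
        then have "\<alpha>' (\<alpha> e) \<in> C'" using C' unfolding even_closed_def by auto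
        moreover have "\<alpha>' (\<alpha> e) = g" unfolding \<alpha>'_def using gT eT by auto
        ultimately show False using gC' by simp
      qed
      have same: "\<alpha>' x = \<alpha> x" if "x \<in> C'" for x using that gC' aC' unfolding \<alpha>'_def by auto
      have "even_closed \<alpha> b T C'"
        unfolding even_closed_def
      proof (intro conjI ballI impI)
        show "C' \<noteq> {}" using C' unfolding even_closed_def by blast
        show "C' \<subseteq> T" using subC' gC' T' by auto
        show "\<alpha> ` C' \<subseteq> C'" using C' same unfolding even_closed_def by (auto simp: image_subset_iff)
        show "\<forall>w. even (card {e \<in> C'. b e = w})" using C' unfolding even_closed_def by blast
        fix x y assume xy: "x \<in> C'" "y \<in> T" "b y = b x"
        then have "y \<noteq> e" using now[OF xy(1)] by auto
        then show "y \<in> C'" using cl' xy T' by auto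
      qed
      then show ?thesis using eC' by blast
    qed
    have "cov (G', \<alpha>') \<subseteq> cov (G, \<alpha>) - {e}"
      unfolding cov_def using main unfolding T_def T'_def by auto
    moreover have "e \<in> cov (G, \<alpha>)" unfolding cov_def using C e unfolding T_def by auto
    moreover have "finite (cov (G, \<alpha>))" using cov_sub fin finite_subset by blast
    ultimately have "card (cov (G', \<alpha>')) < card (cov (G, \<alpha>))" by (metis Diff_subset card_Diff1_less card_mono finite_Diff le_less_trans)
    then show False using c(2)[OF val'] ceq by simp
  qed
  then show ?thesis using that v unfolding T_def by blast
qed

subsection \<open>Balanced covers\<close>

lemma card_fibres:
  assumes "finite B" "finite S"
  shows "card {e\<in>B. h e \<in> S} = (\<Sum>w\<in>S. fdeg h B w)"
proof -
  have "{e\<in>B. h e \<in> S} = (\<Union>w\<in>S. {e\<in>B. h e = w})" by auto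
  also have "card \<dots> = (\<Sum>w\<in>S. card {e\<in>B. h e = w})"
    by (rule card_UN_disjoint) (use assms in auto)
  finally show ?thesis unfolding fdeg_def .
qed

definition covers :: "('e \<Rightarrow> 'w) \<Rightarrow> 'e set \<Rightarrow> 'w set \<Rightarrow> ('w \<Rightarrow> 'e) \<Rightarrow> bool" where
  "covers b B W \<phi> \<longleftrightarrow> (\<forall>w\<in>W. \<phi> w \<in> B \<and> b (\<phi> w) = w)"

definition load :: "('e \<Rightarrow> 'u) \<Rightarrow> 'w set \<Rightarrow> ('w \<Rightarrow> 'e) \<Rightarrow> 'u \<Rightarrow> nat" where
  "load a W \<phi> u = card {w\<in>W. a (\<phi> w) = u}"

definition can_shift :: "('e \<Rightarrow> 'u) \<Rightarrow> ('e \<Rightarrow> 'w) \<Rightarrow> 'e set \<Rightarrow> 'w set \<Rightarrow> ('w \<Rightarrow> 'e) \<Rightarrow> 'u \<Rightarrow> 'u \<Rightarrow> bool" where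
  "can_shift a b B W \<phi> u v \<longleftrightarrow> (\<exists>w\<in>W. a (\<phi> w) = u \<and> (\<exists>e\<in>B. b e = w \<and> a e = v))"

lemma load_upd:
  assumes "finite W" "w \<in> W" "a (\<phi> w) = u" "a e = v" "u \<noteq> v"
  shows "Suc (load a W (\<phi>(w := e)) u) = load a W \<phi> u"
    "load a W (\<phi>(w := e)) v = Suc (load a W \<phi> v)"
    "z \<noteq> u \<Longrightarrow> z \<noteq> v \<Longrightarrow> load a W (\<phi>(w := e)) z = load a W \<phi> z"
proof -
  have "{x\<in>W. a ((\<phi>(w := e)) x) = u} = {x\<in>W. a (\<phi> x) = u} - {w}" using assms by auto
  then show "Suc (load a W (\<phi>(w := e)) u) = load a W \<phi> u"
    unfolding load_def using card.remove[of "{x\<in>W. a (\<phi> x) = u}" w] assms by simp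
  have "{x\<in>W. a ((\<phi>(w := e)) x) = v} = insert w {x\<in>W. a (\<phi> x) = v}" using assms by auto
  then show "load a W (\<phi>(w := e)) v = Suc (load a W \<phi> v)"
    unfolding load_def using assms by simp
  assume "z \<noteq> u" "z \<noteq> v"
  then have "{x\<in>W. a ((\<phi>(w := e)) x) = z} = {x\<in>W. a (\<phi> x) = z}" using assms by auto
  then show "load a W (\<phi>(w := e)) z = load a W \<phi> z" unfolding load_def by simp
qed

text \<open>Every arc of the path hands one element of \<open>W\<close> on to the next vertex, so
  only the two ends change their load. As the path repeats no vertex, the arcs further on use
  elements that are still assigned as in \<open>\<phi>\<close>.\<close>

lemma shift_along_path:
  assumes "finite W" "covers b B W \<phi>" "successively (can_shift a b B W \<phi>) p" "distinct p"
    "p \<noteq> []" "hd p \<noteq> last p"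
  shows "\<exists>\<phi>'. covers b B W \<phi>' \<and> Suc (load a W \<phi>' (hd p)) = load a W \<phi> (hd p)
    \<and> load a W \<phi>' (last p) = Suc (load a W \<phi> (last p))
    \<and> (\<forall>z. z \<noteq> hd p \<longrightarrow> z \<noteq> last p \<longrightarrow> load a W \<phi>' z = load a W \<phi> z)"
  using assms(2-)
proof (induction p arbitrary: \<phi>)
  case (Cons u p)
  then obtain v r where p: "p = v # r" by (cases p) auto
  from Cons.prems(2) p obtain w e where we: "w \<in> W" "a (\<phi> w) = u" "e \<in> B" "b e = w" "a e = v"
    unfolding can_shift_def by auto
  have uv: "u \<noteq> v" using Cons.prems p by auto
  define \<phi>1 where "\<phi>1 = \<phi>(w := e)"
  have c1: "covers b B W \<phi>1" using Cons.prems(1) we unfolding covers_def \<phi>1_def by auto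
  note l1 = load_upd[where a = a and \<phi> = \<phi>, OF assms(1) we(1,2,5) uv, folded \<phi>1_def]
  show ?case
  proof (cases "r = []")
    case True
    then show ?thesis using c1 l1 p by auto
  next
    case False
    have su: "successively (can_shift a b B W \<phi>) p" using Cons.prems(2) p by simp
    have "successively (can_shift a b B W \<phi>1) p"
    proof (rule successively_mono[OF su])
      fix x y assume *: "x \<in> set p" "can_shift a b B W \<phi> x y"
      then obtain w' e' where w': "w' \<in> W" "a (\<phi> w') = x" "e' \<in> B" "b e' = w'" "a e' = y"
        unfolding can_shift_def by auto
      have "x \<noteq> u" using * Cons.prems(3) by auto
      then have "w' \<noteq> w" using w' we by auto
      then show "can_shift a b B W \<phi>1 x y" using w' unfolding can_shift_def \<phi>1_def by auto
    qed
    moreover have "hd p \<noteq> last p" using p False Cons.prems(3) by auto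
    ultimately obtain \<phi>' where \<phi>': "covers b B W \<phi>'" "Suc (load a W \<phi>' v) = load a W \<phi>1 v"
      "load a W \<phi>' (last p) = Suc (load a W \<phi>1 (last p))"
      "\<And>z. z \<noteq> v \<Longrightarrow> z \<noteq> last p \<Longrightarrow> load a W \<phi>' z = load a W \<phi>1 z"
      using Cons.IH[OF c1] Cons.prems(3) p by auto
    have lp: "last p \<noteq> u" "last p \<noteq> v" using Cons.prems(3) p False by auto
    have "load a W \<phi>' u = load a W \<phi>1 u" using \<phi>'(4)[of u] uv lp by simp
    moreover have "load a W \<phi>' z = load a W \<phi> z" if "z \<noteq> u" "z \<noteq> last p" for z
      using \<phi>'(2) \<phi>'(4)[of z] l1(2) l1(3)[of z] that by (cases "z = v") auto
    moreover have "load a W \<phi>1 (last p) = load a W \<phi> (last p)" using l1(3) lp by simp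
    ultimately show ?thesis using \<phi>' l1 p by (intro exI[of _ \<phi>']) auto
  qed
qed simp

text \<open>In a cover of least cost no chain of shifts can relieve a vertex above its capacity or lead from a
  vertex of load 2 to one of load 0; counting the edges at the vertices reached by such chains gives both bounds.\<close>

lemma balanced_cover:
  fixes k :: nat and a :: "'e \<Rightarrow> 'u" and b :: "'e \<Rightarrow> 'w"
  assumes fin: "finite B" and k: "3 \<le> k" and du: "\<And>u. fdeg a B u \<le> k"
  defines "W \<equiv> {w :: 'w. fdeg b B w = k - 1}"
  obtains \<phi> where "covers b B W \<phi>"
    "\<And>u. load a W \<phi> u \<le> (if fdeg a B u = k then 2 else 1)"
    "(k - 1) * card {u. load a W \<phi> u = 2} \<le> card {u. fdeg a B u = k}"
proof -
  define A where "A = a ` B"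
  have finA: "finite A" unfolding A_def using fin by simp
  have "w \<in> b ` B" if "fdeg b B w = k - 1" for w
  proof -
    have "card {e\<in>B. b e = w} \<noteq> 0" using that k unfolding fdeg_def by simp
    then have "{e\<in>B. b e = w} \<noteq> {}" by (metis card.empty)
    then show ?thesis by blast
  qed
  then have WB: "W \<subseteq> b ` B" unfolding W_def by blast
  have finW: "finite W" using WB fin finite_surj by blast
  define cap where "cap u = (if fdeg a B u = k then 2 else 1::nat)" for u
  \<comment> \<open>With truncated subtraction the cost of successive units is 0, 1, 3, 3, ... at a
    vertex with \<open>k\<close> edges and 0, 2, 2, ... elsewhere. Moving a unit from above the
    capacity (saving at least 2) to below it (costing at most 1) pays, and so does moving the second
    unit of a full vertex (saving 1) to an empty vertex (costing 0).\<close>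
  define cost where "cost u c = (if fdeg a B u = k then (c - 1) + 2 * (c - 2) else 2 * (c - 1))" for u and c :: nat
  define tot where "tot \<phi> = (\<Sum>u\<in>A. cost u (load a W \<phi> u))" for \<phi>
  define \<phi>0 where "\<phi>0 w = (SOME e. e \<in> B \<and> b e = w)" for w
  have "covers b B W \<phi>0"
    unfolding covers_def \<phi>0_def
  proof
    fix w assume "w \<in> W"
    then have "\<exists>e. e \<in> B \<and> b e = w" using WB by blast
    from someI_ex[OF this] show "(SOME e. e \<in> B \<and> b e = w) \<in> B \<and> b (SOME e. e \<in> B \<and> b e = w) = w" .
  qed
  then obtain \<phi> where \<phi>: "covers b B W \<phi>" "\<And>\<phi>'. covers b B W \<phi>' \<Longrightarrow> tot \<phi> \<le> tot \<phi>'"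
    using ex_has_least_nat[of "covers b B W" \<phi>0 tot] by blast
  define c where "c = load a W \<phi>"
  define reach where "reach X = {v. \<exists>p. p \<noteq> [] \<and> distinct p \<and> successively (can_shift a b B W \<phi>) p \<and> hd p \<in> X \<and> last p = v}" for X
  have pos: "u \<in> A" if "c u \<noteq> 0" for u
  proof -
    have "{w\<in>W. a (\<phi> w) = u} \<noteq> {}" using that unfolding c_def load_def by (metis card.empty)
    then show ?thesis using \<phi>(1) unfolding covers_def A_def by blast
  qed
  have shA: "v \<in> A" if "can_shift a b B W \<phi> u v" for u v
    using that unfolding can_shift_def A_def by blast
  have src: "X \<subseteq> reach X" for X
  proof
    fix x assume "x \<in> X"
    then show "x \<in> reach X" unfolding reach_def by (intro CollectI exI[of _ "[x]"]) simp
  qed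
  have clos: "v' \<in> reach X" if v: "v \<in> reach X" and s: "can_shift a b B W \<phi> v v'" for v v' X
  proof -
    obtain p where p: "p \<noteq> []" "distinct p" "successively (can_shift a b B W \<phi>) p" "hd p \<in> X" "last p = v"
      using v unfolding reach_def by blast
    show ?thesis
    proof (cases "v' \<in> set p")
      case True
      then obtain p1 p2 where pp: "p = p1 @ v' # p2" by (meson split_list)
      have "successively (can_shift a b B W \<phi>) (p1 @ [v'])" using p(3) unfolding pp by (simp add: successively_append_iff)
      moreover have "hd (p1 @ [v']) = hd p" unfolding pp by (cases p1) auto
      ultimately show ?thesis unfolding reach_def using p pp by (intro CollectI exI[of _ "p1 @ [v']"]) auto
    next
      case False
      have "successively (can_shift a b B W \<phi>) (p @ [v'])" using p s by (simp add: successively_append_iff)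
      then show ?thesis unfolding reach_def using p False by (intro CollectI exI[of _ "p @ [v']"]) auto
    qed
  qed
  have opt: "\<exists>u\<in>X. v = u \<or> (cost u (c u) + cost v (c v) \<le> cost u (c u - 1) + cost v (c v + 1))"
    if v: "v \<in> reach X" for v X
  proof -
    obtain p where p: "p \<noteq> []" "distinct p" "successively (can_shift a b B W \<phi>) p" "hd p \<in> X" "last p = v"
      using v unfolding reach_def by blast
    show ?thesis
    proof (cases "hd p = v")
      case False
      then obtain \<phi>' where \<phi>': "covers b B W \<phi>'" "Suc (load a W \<phi>' (hd p)) = c (hd p)"
         "load a W \<phi>' v = Suc (c v)" "\<And>z. z \<noteq> hd p \<Longrightarrow> z \<noteq> v \<Longrightarrow> load a W \<phi>' z = c z"
        using shift_along_path[OF finW \<phi>(1) p(3,2,1)] p(5) unfolding c_def by auto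
      define u where "u = hd p"
      have uv: "u \<noteq> v" "u \<in> A" using False \<phi>'(2) pos[of u] unfolding u_def by auto
      obtain q x where "p = q @ [x, v]"
      proof -
        obtain q where q: "p = q @ [v]" using p(1,5) by (metis append_butlast_last_id)
        with False have "q \<noteq> []" by auto
        then obtain q' x where "q = q' @ [x]" by (metis append_butlast_last_id)
        then show ?thesis using that q by simp
      qed
      then have "v \<in> A" using p(3) shA by (auto simp: successively_append_iff)
      have split: "(\<Sum>z\<in>A. h z) = h u + h v + (\<Sum>z\<in>A - {u} - {v}. h z)" for h :: "_ \<Rightarrow> nat"
        using sum.remove[of A u h] sum.remove[of "A - {u}" v h] finA uv \<open>v \<in> A\<close> by auto
      have "(\<Sum>z\<in>A - {u} - {v}. cost z (load a W \<phi>' z)) = (\<Sum>z\<in>A - {u} - {v}. cost z (c z))"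
        using \<phi>'(4) unfolding u_def by (intro sum.cong) auto
      moreover have "load a W \<phi>' u = c u - 1" using \<phi>'(2) unfolding u_def by simp
      ultimately have "cost u (c u) + cost v (c v) \<le> cost u (c u - 1) + cost v (c v + 1)"
        using \<phi>(2)[OF \<phi>'(1)] \<phi>'(3) unfolding tot_def split c_def[symmetric] by simp
      then show ?thesis using p(4) unfolding u_def by blast
    qed (use p in auto)
  qed
  \<comment> \<open>If \<open>w\<close> is served from the reachable set, it could be shifted along
    each of its \<open>k - 1\<close> edges, so all of them end in that set.\<close>
  have count: "(k - 1) * (\<Sum>u\<in>reach X. c u) \<le> (\<Sum>u\<in>reach X. fdeg a B u)" "finite (reach X)" if X: "X \<subseteq> A" for X
  proof -
    have sub: "reach X \<subseteq> A"
    proof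
      fix v assume "v \<in> reach X"
      then obtain p where p: "p \<noteq> []" "successively (can_shift a b B W \<phi>) p" "hd p \<in> X" "last p = v"
        unfolding reach_def by blast
      show "v \<in> A"
      proof (cases "butlast p = []")
        case True
        then have "p = [v]" using p by (metis append_Nil append_butlast_last_id)
        then show ?thesis using p X by auto
      next
        case False
        then obtain q x where "butlast p = q @ [x]" by (metis append_butlast_last_id)
        then have "p = q @ [x, v]" using p by (metis append_Cons append_Nil append_assoc append_butlast_last_id)
        then show ?thesis using p(2) shA by (auto simp: successively_append_iff)
      qed
    qed
    show f: "finite (reach X)" using sub finA finite_subset by blast
    define S where "S = {w\<in>W. a (\<phi> w) \<in> reach X}"
    have finS: "finite S" unfolding S_def using finW by simp
    have "{e\<in>B. b e \<in> S} \<subseteq> {e\<in>B. a e \<in> reach X}"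
    proof clarify
      fix e assume e: "e \<in> B" "b e \<in> S"
      then have "can_shift a b B W \<phi> (a (\<phi> (b e))) (a e)" unfolding S_def can_shift_def by blast
      then show "a e \<in> reach X" using clos e unfolding S_def by blast
    qed
    then have "card {e\<in>B. b e \<in> S} \<le> card {e\<in>B. a e \<in> reach X}" by (rule card_mono[rotated]) (use fin in simp)
    moreover have "card {e\<in>B. b e \<in> S} = (k - 1) * card S"
      unfolding card_fibres[OF fin finS] by (simp add: S_def W_def)
    moreover have "card S = (\<Sum>u\<in>reach X. c u)"
    proof -
      have "S = (\<Union>u\<in>reach X. {w\<in>W. a (\<phi> w) = u})" unfolding S_def by auto
      also have "card \<dots> = (\<Sum>u\<in>reach X. card {w\<in>W. a (\<phi> w) = u})"
        by (rule card_UN_disjoint) (use f finW in auto)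
      finally show ?thesis unfolding c_def load_def .
    qed
    ultimately show "(k - 1) * (\<Sum>u\<in>reach X. c u) \<le> (\<Sum>u\<in>reach X. fdeg a B u)"
      using card_fibres[OF fin f, of a] by simp
  qed
  have capped: "c u \<le> cap u" for u
  proof (rule ccontr)
    assume "\<not> ?thesis"
    then have cu: "cap u < c u" by simp
    then have uA: "{u} \<subseteq> A" using pos[of u] by auto
    have ge: "cap v \<le> c v" if "v \<in> reach {u}" for v
    proof (cases "v = u")
      case False
      with opt[OF that] have "cost u (c u) + cost v (c v) \<le> cost u (c u - 1) + cost v (c v + 1)" by auto
      then show ?thesis using cu unfolding cost_def cap_def by (auto split: if_splits)
    qed (use cu in simp)
    have "(\<Sum>v\<in>reach {u}. cap v) < (\<Sum>v\<in>reach {u}. c v)"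
      by (rule sum_strict_mono_ex1) (use count(2)[OF uA] ge cu src[of "{u}"] in auto)
    then have "(k - 1) * (\<Sum>v\<in>reach {u}. cap v) < (k - 1) * (\<Sum>v\<in>reach {u}. c v)" using k by simp
    also have "\<dots> \<le> (\<Sum>v\<in>reach {u}. fdeg a B v)" by (rule count(1)[OF uA])
    \<comment> \<open>A vertex with \<open>k\<close> edges has capacity 2, and
      \<open>k \<le> 2 * (k - 1)\<close>.\<close>
    also have "\<dots> \<le> (\<Sum>v\<in>reach {u}. (k - 1) * cap v)"
    proof (rule sum_mono)
      fix v show "fdeg a B v \<le> (k - 1) * cap v" using du[of v] k unfolding cap_def by auto
    qed
    finally show False by (simp add: sum_distrib_left)
  qed
  define D where "D = {u. c u = 2}"
  have DA: "D \<subseteq> A" unfolding D_def using pos by auto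
  have ge1: "1 \<le> c v" if v: "v \<in> reach D" for v
  proof -
    obtain u where u: "u \<in> D" "v = u \<or> cost u (c u) + cost v (c v) \<le> cost u (c u - 1) + cost v (c v + 1)"
      using opt[OF v] by blast
    have "fdeg a B u = k" using u(1) capped[of u] unfolding D_def cap_def by (auto split: if_splits)
    then show ?thesis using u unfolding D_def cost_def by (cases "c v = 0") (auto split: if_splits)
  qed
  have fR: "finite (reach D)" by (rule count(2)[OF DA])
  \<comment> \<open>On the reachable set the loads exceed 1 exactly on \<open>D\<close>, while the
    degrees exceed \<open>k - 1\<close> only at full vertices and only by one. Multiplying the loads
    by \<open>k - 1\<close> and comparing gives the ratio between the two kinds of vertices.\<close>
  have "(\<Sum>u\<in>reach D. c u) = (\<Sum>u\<in>reach D. 1 + (if u \<in> D then 1 else 0))"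
  proof (rule sum.cong[OF refl])
    fix u assume "u \<in> reach D"
    then show "c u = 1 + (if u \<in> D then 1 else 0)"
      using ge1[of u] capped[of u] unfolding cap_def D_def by (auto split: if_splits)
  qed
  also have "\<dots> = card (reach D) + card D"
    using fR src[of D] by (simp only: sum.distrib) (simp add: sum.If_cases Int_absorb1 Int_absorb2)
  finally have "(k - 1) * (card (reach D) + card D) \<le> (\<Sum>u\<in>reach D. fdeg a B u)"
    using count(1)[OF DA] by simp
  also have "\<dots> \<le> (\<Sum>u\<in>reach D. (k - 1) + (if fdeg a B u = k then 1 else 0))"
  proof (rule sum_mono)
    fix u show "fdeg a B u \<le> (k - 1) + (if fdeg a B u = k then 1 else 0)" using du[of u] by auto
  qed
  also have "\<dots> = (k - 1) * card (reach D) + card {u\<in>reach D. fdeg a B u = k}"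
    using fR by (simp only: sum.distrib) (simp add: sum.If_cases Int_def)
  also have "\<dots> \<le> (k - 1) * card (reach D) + card {u. fdeg a B u = k}"
  proof -
    have "{u. fdeg a B u = k} \<subseteq> A"
    proof
      fix u assume "u \<in> {u. fdeg a B u = k}"
      then have "card {e\<in>B. a e = u} \<noteq> 0" using k unfolding fdeg_def by simp
      then have "{e\<in>B. a e = u} \<noteq> {}" by (metis card.empty)
      then show "u \<in> A" unfolding A_def by blast
    qed
    then have "finite {u. fdeg a B u = k}" using finA finite_subset by blast
    then have "card {u\<in>reach D. fdeg a B u = k} \<le> card {u. fdeg a B u = k}" by (rule card_mono) auto
    then show ?thesis by simp
  qed
  finally have "(k - 1) * card D \<le> card {u. fdeg a B u = k}" by (simp add: distrib_left)
  then show ?thesis using that[OF \<phi>(1)] capped unfolding D_def c_def cap_def by blast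
qed

subsection \<open>Base labellings\<close>

text \<open>Increasing labels added in increasing order of \<open>r\<close> make the sums strictly
  increasing, however ties are broken; the induction removes a maximum of \<open>r\<close>. With
  constant \<open>r\<close> this just numbers a set.\<close>

lemma sorted_labelling:
  fixes r :: "'x \<Rightarrow> int"
  assumes "finite X"
  shows "\<exists>g. bij_betw g X {c + 1..c + int (card X)} \<and> inj_on (\<lambda>x. r x + g x) X"
  using assms
proof (induction "card X" arbitrary: X)
  case 0
  then show ?case by (auto simp: bij_betw_def)
next
  case (Suc n)
  then have "X \<noteq> {}" by auto
  then obtain x where x: "x \<in> X" "\<And>y. y \<in> X \<Longrightarrow> r y \<le> r x"
    using obtains_MAX[OF Suc.prems, of r] by (metis Max_ge Suc.prems finite_imageI imageI)
  define X' where "X' = X - {x}"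
  have X: "X = insert x X'" "x \<notin> X'" "finite X'" "card X' = n" "card X = Suc n"
    using x Suc unfolding X'_def by auto
  obtain g where g: "bij_betw g X' {c + 1..c + int n}" "inj_on (\<lambda>x. r x + g x) X'"
    using Suc.hyps(1)[of X'] X by auto
  define g' where "g' = g(x := c + int (Suc n))"
  have gX: "g' y = g y" if "y \<in> X'" for y using that X unfolding g'_def by auto
  have gr: "g y \<le> c + int n" if "y \<in> X'" for y using g(1) that unfolding bij_betw_def by auto
  have "bij_betw g' X' {c + 1..c + int n}" using g(1) bij_betw_cong[of X' g' g] gX by blast
  moreover have "bij_betw g' {x} {c + int (Suc n)}" unfolding g'_def by (simp add: bij_betw_def)
  ultimately have "bij_betw g' (X' \<union> {x}) ({c + 1..c + int n} \<union> {c + int (Suc n)})"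
    by (rule bij_betw_combine) auto
  moreover have "{c + 1..c + int n} \<union> {c + int (Suc n)} = {c + 1..c + int (card X)}" unfolding X(5) by auto
  ultimately have "bij_betw g' X {c + 1..c + int (card X)}" using X(1) by simp
  moreover have "inj_on (\<lambda>x. r x + g' x) X"
  proof (rule inj_onI)
    fix y z assume yz: "y \<in> X" "z \<in> X" "r y + g' y = r z + g' z"
    have lt: "r y + g' y < r x + g' x" if "y \<in> X'" for y
      using gX[OF that] gr[OF that] x(2)[of y] that X unfolding g'_def by auto
    show "y = z"
    proof (cases "y = x \<or> z = x")
      case True
      then show ?thesis using lt[of y] lt[of z] yz X(1) by auto
    next
      case False
      then show ?thesis using g(2) gX yz X(1) by (auto simp: inj_on_def)
    qed
  qed
  ultimately show ?case by blast
qed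

text \<open>Pairs \<open>(j, \<pi> j)\<close> with distinct sums that stay within half the length of the mean;
  listing both numbers in increasing order would double the spread.\<close>

lemma odd_window:
  fixes p :: nat
  defines "\<pi> j \<equiv> if j \<le> Suc p then j + p else j - Suc p"
  shows "bij_betw \<pi> {1..2*p+1} {1..2*p+1}" "inj_on (\<lambda>j. j + \<pi> j) {1..2*p+1}"
    "\<And>j. j \<in> {1..2*p+1} \<Longrightarrow> j + \<pi> j \<le> 3 * p + 2"
proof -
  have s: "z \<le> Suc p \<and> \<pi> z = z + p \<or> Suc p < z \<and> z = \<pi> z + p + 1" for z
    unfolding \<pi>_def by (cases "z \<le> Suc p") simp_all
  have inj: "inj_on \<pi> {1..2*p+1}"
  proof (rule inj_onI)
    fix x y assume "x \<in> {1..2*p+1}" "y \<in> {1..2*p+1}" "\<pi> x = \<pi> y"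
    then show "x = y" using s[of x] s[of y] unfolding atLeastAtMost_iff by linarith
  qed
  moreover have "\<pi> j \<in> {1..2*p+1}" if "j \<in> {1..2*p+1}" for j
    using that s[of j] unfolding atLeastAtMost_iff by linarith
  then have "\<pi> ` {1..2*p+1} \<subseteq> {1..2*p+1}" by blast
  ultimately show "bij_betw \<pi> {1..2*p+1} {1..2*p+1}"
    unfolding bij_betw_def using endo_inj_surj[of "{1..2*p+1}" \<pi>] by (metis finite_atLeastAtMost)
  show "inj_on (\<lambda>j. j + \<pi> j) {1..2*p+1}"
  proof (rule inj_onI)
    fix x y assume eq: "x + \<pi> x = y + \<pi> y"
    \<comment> \<open>The two branches have sums \<open>2 * j + p\<close> and
      \<open>2 * j - p - 1\<close>, which differ in parity.\<close>
    have "2 * x + p + p + 1 \<noteq> 2 * y" "2 * y + p + p + 1 \<noteq> 2 * x" by presburger+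
    then show "x = y" using s[of x] s[of y] eq by linarith
  qed
  show "j + \<pi> j \<le> 3 * p + 2" if "j \<in> {1..2*p+1}" for j
    using that s[of j] unfolding atLeastAtMost_iff by linarith
qed

text \<open>For even \<open>n\<close> the sums cannot be consecutive: their mean is the integer
  \<open>n + 1\<close>, whereas \<open>n\<close> consecutive integers have a half-integral mean. So
  the pair \<open>(1, 1)\<close> is split off with the smallest sum 2, and the odd case is shifted
  by one; the upper end of the range stays where it should.\<close>

lemma window_permutation:
  fixes n :: nat
  obtains \<pi> where "bij_betw \<pi> {1..n} {1..n}" "inj_on (\<lambda>j. j + \<pi> j) {1..n}"
    "\<And>j. j \<in> {1..n} \<Longrightarrow> j + \<pi> j \<le> n + 1 + n div 2"
proof (cases "odd n")
  case True
  then obtain p where p: "n = 2 * p + 1" by (rule oddE)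
  define \<pi> where "\<pi> j = (if j \<le> Suc p then j + p else j - Suc p)" for j
  show ?thesis
    by (rule that[of \<pi>]) (use odd_window[where p = p, folded \<pi>_def] p in \<open>auto simp: algebra_simps\<close>)
next
  case ev: False
  show ?thesis
  proof (cases "n = 0")
    case True
    then show ?thesis using that[of id] by (simp add: bij_betw_def)
  next
    case False
    from ev obtain q where q: "n = 2 * q" by (auto elim: evenE)
    with False obtain p where "q = Suc p" by (cases q) auto
    with q have p: "n = Suc (2 * p + 1)" by simp
    define \<rho> where "\<rho> j = (if j \<le> Suc p then j + p else j - Suc p)" for j
    note o = odd_window[where p = p, folded \<rho>_def]
    define \<pi> where "\<pi> j = (if j = 1 then 1 else Suc (\<rho> (j - 1)))" for j
    have \<rho>: "\<rho> j \<in> {1..2*p+1}" if "j \<in> {1..2*p+1}" for j using o(1) that unfolding bij_betw_def by blast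
    have one: "\<pi> 1 = 1" unfolding \<pi>_def by simp
    have step: "\<exists>i\<in>{1..2*p+1}. j = Suc i \<and> \<pi> j = Suc (\<rho> i)" if j: "j \<in> {1..n}" "j \<noteq> 1" for j
    proof (cases j)
      case (Suc i)
      then have "i \<in> {1..2*p+1}" "\<pi> j = Suc (\<rho> i)" using j p unfolding \<pi>_def by simp_all
      then show ?thesis using Suc by blast
    qed (use j in simp)
    have ge: "2 \<le> \<pi> j \<and> 2 \<le> j" if j: "j \<in> {1..n}" "j \<noteq> 1" for j
      using step[OF j] \<rho> by fastforce
    have inj: "inj_on \<pi> {1..n}"
    proof (rule inj_onI)
      fix x y assume xy: "x \<in> {1..n}" "y \<in> {1..n}" "\<pi> x = \<pi> y"
      consider "x = 1" "y = 1" | "x = 1" "y \<noteq> 1" | "x \<noteq> 1" "y = 1" | "x \<noteq> 1" "y \<noteq> 1" by blast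
      then show "x = y"
      proof cases
        case 4
        obtain i i' where i: "i \<in> {1..2*p+1}" "x = Suc i" "\<pi> x = Suc (\<rho> i)"
          "i' \<in> {1..2*p+1}" "y = Suc i'" "\<pi> y = Suc (\<rho> i')"
          using step[OF xy(1) 4(1)] step[OF xy(2) 4(2)] by blast
        then have "\<rho> i = \<rho> i'" using xy(3) by simp
        then show ?thesis using o(1) i unfolding bij_betw_def inj_on_def by blast
      qed (use ge[OF xy(1)] ge[OF xy(2)] one xy(3) in simp_all)
    qed
    moreover have "\<pi> ` {1..n} \<subseteq> {1..n}"
    proof
      fix y assume "y \<in> \<pi> ` {1..n}"
      then obtain x where x: "x \<in> {1..n}" "y = \<pi> x" by blast
      show "y \<in> {1..n}"
      proof (cases "x = 1")
        case True
        then show ?thesis using one x(2) p by simp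
      next
        case False
        then obtain i where "i \<in> {1..2*p+1}" "y = Suc (\<rho> i)" using step[OF x(1)] x(2) by blast
        then show ?thesis using \<rho>[of i] p by simp
      qed
    qed
    ultimately have "bij_betw \<pi> {1..n} {1..n}" unfolding bij_betw_def by (simp add: endo_inj_surj)
    moreover have "inj_on (\<lambda>j. j + \<pi> j) {1..n}"
    proof (rule inj_onI)
      fix x y assume xy: "x \<in> {1..n}" "y \<in> {1..n}" "x + \<pi> x = y + \<pi> y"
      consider "x = 1" "y = 1" | "x = 1" "y \<noteq> 1" | "x \<noteq> 1" "y = 1" | "x \<noteq> 1" "y \<noteq> 1" by blast
      then show "x = y"
      proof cases
        case 4
        obtain i i' where i: "i \<in> {1..2*p+1}" "x = Suc i" "\<pi> x = Suc (\<rho> i)"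
          "i' \<in> {1..2*p+1}" "y = Suc i'" "\<pi> y = Suc (\<rho> i')"
          using step[OF xy(1) 4(1)] step[OF xy(2) 4(2)] by blast
        then have "i + \<rho> i = i' + \<rho> i'" using xy(3) by simp
        then show ?thesis using o(2) i unfolding inj_on_def by blast
      qed (use ge[OF xy(1)] ge[OF xy(2)] one xy(3) in simp_all)
    qed
    ultimately have *: "bij_betw \<pi> {1..n} {1..n}" "inj_on (\<lambda>j. j + \<pi> j) {1..n}" by blast+
    have "j + \<pi> j \<le> n + 1 + n div 2" if j: "j \<in> {1..n}" for j
    proof (cases "j = 1")
      case True
      then show ?thesis using one p by simp
    next
      case False
      then obtain i where "i \<in> {1..2*p+1}" "j = Suc i" "\<pi> j = Suc (\<rho> i)" using step[OF j] by blast
      then show ?thesis using o(3)[of i] p by simp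
    qed
    then show ?thesis by (rule that[OF *])
  qed
qed

section \<open>Labelling an edge set by pairs when its size may be odd\<close>

lemma fdeg_Un: "finite X \<Longrightarrow> finite Y \<Longrightarrow> X \<inter> Y = {} \<Longrightarrow> fdeg a (X \<union> Y) u = fdeg a X u + fdeg a Y u"
proof -
  assume *: "finite X" "finite Y" "X \<inter> Y = {}"
  have "{e\<in>X \<union> Y. a e = u} = {e\<in>X. a e = u} \<union> {e\<in>Y. a e = u}" by auto
  then show ?thesis unfolding fdeg_def using * by (subst card_Un_disjoint[symmetric]) auto
qed

lemma fsum_Un: "finite X \<Longrightarrow> finite Y \<Longrightarrow> X \<inter> Y = {} \<Longrightarrow> fsum a (X \<union> Y) f u = fsum a X f u + fsum a Y f u"
proof -
  assume *: "finite X" "finite Y" "X \<inter> Y = {}"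
  have "{e\<in>X \<union> Y. a e = u} = {e\<in>X. a e = u} \<union> {e\<in>Y. a e = u}" by auto
  then show ?thesis unfolding fsum_def using * by (subst sum.union_disjoint[symmetric]) auto
qed

lemma transversal_fibre:
  assumes "inj_on a G" "g \<in> G"
  shows "fdeg a G (a g) = 1" "fsum a G f (a g) = f g"
proof -
  have "{e\<in>G. a e = a g} = {g}" using assms by (auto simp: inj_on_def)
  then show "fdeg a G (a g) = 1" "fsum a G f (a g) = f g" unfolding fdeg_def fsum_def by simp_all
qed

lemma fibre_empty:
  assumes "u \<notin> a ` G"
  shows "fdeg a G u = 0" "fsum a G f u = 0"
proof -
  have "{e\<in>G. a e = u} = {}" using assms by blast
  then show "fdeg a G u = 0" "fsum a G f u = 0" unfolding fdeg_def fsum_def by (simp_all only: card.empty sum.empty)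
qed

lemma fsum_ge:
  assumes "finite Y" "\<And>e. e \<in> Y \<Longrightarrow> s \<le> f e"
  shows "int (fdeg b Y w) * s \<le> fsum b Y f w"
  unfolding fdeg_def fsum_def using assms by (intro sum_bounded_below) auto

text \<open>An odd number of edges forces an odd class. The left-out edge is taken there because the
  estimate for an odd class has room for one label up to \<open>s\<close> besides the pairs, and
  that for an even class has none.\<close>

lemma odd_leftover:
  assumes fin: "finite T"
  obtains L where "L \<subseteq> T" "card L \<le> 1" "even (card (T - L))" "\<And>l. l \<in> L \<Longrightarrow> odd (fdeg a T (a l))"
proof (cases "even (card T)")
  case True
  then show ?thesis using that[of "{}"] by simp
next
  case False
  have "card T = (\<Sum>u\<in>a ` T. fdeg a T u)" using sum_fibre_card[OF fin, of a] unfolding fdeg_def by simp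
  then obtain u where u: "u \<in> a ` T" "odd (fdeg a T u)" using False by (metis (no_types, lifting) dvd_sum)
  then obtain l where l: "l \<in> T" "a l = u" by blast
  have "card T = Suc (card (T - {l}))" using fin l(1) by (rule card.remove)
  then show ?thesis using that[of "{l}"] l u False by auto
qed

text \<open>An unpaired edge \<open>l\<close> receives the label \<open>s\<close> itself, so that \<open>T\<close> is labelled by an initial interval.\<close>

lemma base_labelling_aux:
  assumes fin: "finite T" and L: "L \<subseteq> T" "card L \<le> 1" "\<And>l. l \<in> L \<Longrightarrow> odd (fdeg a T (a l))"
    and p: "pairing \<alpha> (T - L)" and cr: "few_crossings a \<alpha> (T - L)"
    and ex: "exact_labelling \<alpha> (T - L) 1 s f0" and s: "s = int (card (T - L)) + 1"
    and pb: "\<And>w. pass_bound c (fdeg b (T - L) w) (fsum b (T - L) f0 w)" and c: "c \<le> s"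
  obtains f where "bij_betw f T {1..int (card T)}"
    "\<And>u. fsum a T f u \<le> int (Suc (fdeg a T u) div 2) * s"
    "\<And>u. even (fdeg a T u) \<Longrightarrow> fsum a T f u = int (fdeg a T u div 2) * s"
    "\<And>w. pass_bound c (fdeg b T w) (fsum b T f w)"
    "int (card T) \<le> s" "s \<le> int (card T) + 1"
proof (cases "L = {}")
  case True
  have bij: "bij_betw f0 T {1..int (card T)}" using ex s True unfolding exact_labelling_def by simp
  then have le: "f0 e \<le> int (card T)" if "e \<in> T" for e using that unfolding bij_betw_def by auto
  have T: "T - L = T" using True by simp
  note p = p[unfolded T] and cr = cr[unfolded T] and ex = ex[unfolded T] and pb = pb[unfolded T]
  have es: "\<And>e. e \<in> T \<Longrightarrow> f0 e + f0 (\<alpha> e) = s" using ex unfolding exact_labelling_def by blast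
  have cs1: "fsum a T f0 u = int (fdeg a T u div 2) * s" if "even (fdeg a T u)" for u
    using class_sum(1)[OF fin p cr _ _ that] es le by blast
  have cs2: "fsum a T f0 u \<le> int (fdeg a T u div 2) * s + int (card T)" if "odd (fdeg a T u)" for u
    using class_sum(2)[OF fin p cr _ _ that] es le by blast
  have "fsum a T f0 u \<le> int (Suc (fdeg a T u) div 2) * s" for u
  proof (cases "even (fdeg a T u)")
    case False
    then obtain q where q: "fdeg a T u = 2 * q + 1" by (rule oddE)
    have "fsum a T f0 u \<le> int q * s + int (card T)" using cs2[OF False] q by simp
    then show ?thesis using q s T by (simp add: algebra_simps)
  qed (use cs1 in simp)
  then show ?thesis using that[of f0] bij cs1 pb s T by simp
next
  case False
  then obtain l where l: "L = {l}" using L(2) by (metis One_nat_def card_1_singletonE card_gt_0_iff finite_subset[OF L(1) fin] le_antisym Suc_le_eq)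
  define R where "R = T - {l}"
  have T: "T = insert l R" "l \<notin> R" "finite R" "T - L = R" using L(1) l fin unfolding R_def by auto
  have cT: "card T = Suc (card R)" unfolding T(1) using T(2,3) by simp
  note p = p[unfolded T(4)] and cr = cr[unfolded T(4)] and ex = ex[unfolded T(4)] and pb = pb[unfolded T(4)] and s = s[unfolded T(4)]
  define f where "f = f0(l := s)"
  have fR: "f e = f0 e" if "e \<in> R" for e using that T unfolding f_def by auto
  have fl: "f l = s" unfolding f_def by simp
  have bij0: "bij_betw f0 R {1..int (card R)}" using ex s unfolding exact_labelling_def by simp
  then have le: "f0 e \<le> int (card R)" if "e \<in> R" for e using that unfolding bij_betw_def by auto
  have es: "\<And>e. e \<in> R \<Longrightarrow> f0 e + f0 (\<alpha> e) = s" using ex unfolding exact_labelling_def by blast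
  have cs1: "fsum a R f0 u = int (fdeg a R u div 2) * s" if "even (fdeg a R u)" for u
    using class_sum(1)[OF T(3) p cr _ _ that] es le by blast
  have cs2: "fsum a R f0 u \<le> int (fdeg a R u div 2) * s + int (card R)" if "odd (fdeg a R u)" for u
    using class_sum(2)[OF T(3) p cr _ _ that] es le by blast
  have "bij_betw f R {1..int (card R)}" using bij0 bij_betw_cong[of R f f0] fR by blast
  moreover have "bij_betw f {l} {s}" using fl by (simp add: bij_betw_def)
  ultimately have "bij_betw f (R \<union> {l}) ({1..int (card R)} \<union> {s})" by (rule bij_betw_combine) (use s in auto)
  moreover have "{1..int (card R)} \<union> {s} = {1..int (card T)}" using s cT by auto
  ultimately have bij: "bij_betw f T {1..int (card T)}" using T(1) by simp
  have dT: "fdeg h T u = fdeg h R u + (if h l = u then 1 else 0)" for h :: "'a \<Rightarrow> 'z" and u unfolding T(1) using T by (simp add: fdeg_insert)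
  have sT: "fsum h T f u = fsum h R f0 u + (if h l = u then s else 0)" for h :: "'a \<Rightarrow> 'z" and u
    unfolding T(1) using T fl fsum_cong[of R f f0] fR by (simp add: fsum_insert)
  have ev: "fsum a T f u = int (fdeg a T u div 2) * s" if "even (fdeg a T u)" for u
  proof -
    have "a l \<noteq> u" using that L(3) l by auto
    then show ?thesis using cs1[of u] that dT[of a] sT[of a] by simp
  qed
  have "fsum a T f u \<le> int (Suc (fdeg a T u) div 2) * s" for u
  proof (cases "even (fdeg a T u)")
    case False
    then obtain q where q: "fdeg a T u = 2 * q + 1" by (rule oddE)
    show ?thesis
    proof (cases "a l = u")
      \<comment> \<open>Without \<open>l\<close> the class of \<open>u\<close> is even, hence
        without crossing; \<open>l\<close> takes the place of the crossing edge.\<close>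
      case True
      then have "fdeg a R u = 2 * q" using dT[of a] q by simp
      then show ?thesis using cs1[of u] sT[of a] True q by (simp add: algebra_simps)
    next
      case n: False
      then have "fdeg a R u = 2 * q + 1" using dT[of a] q by simp
      then have "fsum a T f u \<le> int q * s + int (card R)" using cs2[of u] sT[of a] n by simp
      then show ?thesis using q s by (simp add: algebra_simps)
    qed
  qed (use ev in simp)
  moreover have "pass_bound c (fdeg b T w) (fsum b T f w)" for w
  proof (cases "b l = w")
    case True
    have "fdeg b T w = Suc (fdeg b R w)" "fsum b T f w = fsum b R f0 w + s" using dT[of b] sT[of b] True by simp_all
    \<comment> \<open>For odd \<open>D\<close> the label \<open>s\<close>, being at least
      \<open>c\<close>, completes a passage by itself.\<close>
    moreover have "pass_bound c (Suc D) (t + s)" if "pass_bound c D t" for D t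
    proof (cases "even D")
      case True
      then show ?thesis using pass_bound_single[OF that] s by simp
    next
      case False
      then obtain q where "D = 2 * q + 1" by (rule oddE)
      then show ?thesis using that c unfolding pass_bound_def by (simp add: algebra_simps)
    qed
    ultimately show ?thesis using pb[of w] by simp
  qed (use pb dT[of b] sT[of b] in simp)
  ultimately show ?thesis using that[of f] bij ev s cT by simp
qed

text \<open>This version serves edge sets that are prescribed from outside: nothing is known about
  closed trails, at the price of \<open>s - 1\<close> in place of \<open>s\<close>. The exact sums
  on even classes survive and are used.\<close>

lemma base_backward:
  assumes fin: "finite T"
  obtains f s where "bij_betw f T {1..int (card T)}"
    "\<And>u. fsum a T f u \<le> int (Suc (fdeg a T u) div 2) * s"
    "\<And>u. even (fdeg a T u) \<Longrightarrow> fsum a T f u = int (fdeg a T u div 2) * s"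
    "\<And>w. pass_bound (s - 1) (fdeg b T w) (fsum b T f w)"
    "int (card T) \<le> s" "s \<le> int (card T) + 1"
proof -
  obtain L where L: "L \<subseteq> T" "card L \<le> 1" "even (card (T - L))" "\<And>l. l \<in> L \<Longrightarrow> odd (fdeg a T (a l))"
    using odd_leftover[OF fin] by metis
  obtain \<alpha> where \<alpha>: "pairing \<alpha> (T - L)" "few_crossings a \<alpha> (T - L)"
    using pairing_exists[of "T - L" a] fin L by blast
  obtain f0 where f0: "exact_labelling \<alpha> (T - L) 1 (int (card (T - L)) + 1) f0"
    "\<And>z. pass_bound (int (card (T - L))) (fdeg b (T - L) z) (fsum b (T - L) f0 z)"
    using backward_labelling[of "T - L" \<alpha> b] fin \<alpha>(1) by (metis finite_Diff)
  define s where "s = int (card (T - L)) + 1"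
  have pb: "\<And>z. pass_bound (s - 1) (fdeg b (T - L) z) (fsum b (T - L) f0 z)" using f0(2) unfolding s_def by simp
  show ?thesis
    by (rule base_labelling_aux[where T = T and L = L and a = a and b = b and \<alpha> = \<alpha> and s = s and c = "s - 1" and ?f0.0 = f0],
        fact fin, fact L(1), fact L(2), erule L(4), fact \<alpha>(1), fact \<alpha>(2), fact f0(1)[folded s_def], fact s_def,
        fact pb, simp, rule that) assumption+
qed

text \<open>The full \<open>s\<close> is reached because the transversal belongs to the conclusion
  and may be exchanged to suit the trails. The edge left out for parity has to be fixed before that
  exchange.\<close>

lemma base_forward:
  assumes fin: "finite E" and simple: "inj_on (\<lambda>e. (a e, b e)) E"
  obtains G T f s where "G \<subseteq> E" "inj_on a G" "a ` G = a ` E" "T = E - G" "bij_betw f T {1..int (card T)}"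
    "\<And>u. fsum a T f u \<le> int (Suc (fdeg a T u) div 2) * s"
    "\<And>w. pass_bound s (fdeg b T w) (fsum b T f w)"
    "int (card T) \<le> s" "s \<le> int (card T) + 1"
proof -
  obtain G0 where G0: "G0 \<subseteq> E" "inj_on a G0" "a ` G0 = a ` E" by (metis subset_image_inj order_refl)
  obtain L where L: "L \<subseteq> E - G0" "card L \<le> 1" "even (card (E - G0 - L))" "\<And>l. l \<in> L \<Longrightarrow> odd (fdeg a (E - G0) (a l))"
    using odd_leftover[of "E - G0" a] fin by (metis finite_Diff)
  have aE: "a ` (E - L) = a ` E"
  proof
    have "G0 \<subseteq> E - L" using L(1) G0(1) by auto
    then show "a ` E \<subseteq> a ` (E - L)" using G0(3) by (metis image_mono)
  qed auto
  have finG: "finite G0" using G0 fin finite_subset by blast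
  have "card (E - L) - card (a ` (E - L)) = card (E - G0 - L)"
  proof -
    have "card (a ` E) = card G0" using G0 by (metis card_image)
    moreover have "E - G0 - L = (E - L) - G0" by auto
    moreover have "G0 \<subseteq> E - L" using G0 L(1) by auto
    ultimately show ?thesis unfolding aE using finG by (simp add: card_Diff_subset)
  qed
  then have ev: "even (card (E - L) - card (a ` (E - L)))" using L(3) by simp
  obtain G \<alpha> where G: "G \<subseteq> E - L" "inj_on a G" "a ` G = a ` (E - L)" "pairing \<alpha> (E - L - G)"
     "few_crossings a \<alpha> (E - L - G)" "\<And>C. \<not> even_closed \<alpha> b (E - L - G) C"
    using transversal_without_even_closed[of "E - L" a b] fin ev inj_on_subset[OF simple, of "E - L"] by (metis finite_Diff Diff_subset)
  define T where "T = E - G"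
  have TL: "E - L - G = T - L" unfolding T_def by auto
  have finT: "finite T" unfolding T_def using fin by simp
  have LT: "L \<subseteq> T" using L(1) G(1) unfolding T_def by auto
  \<comment> \<open>Every transversal removes exactly one edge per class, so the class of the
    left-out edge stays odd when \<open>G0\<close> is replaced by \<open>G\<close>.\<close>
  have same: "fdeg a (E - G') u = fdeg a E u - 1" if G': "G' \<subseteq> E" "inj_on a G'" "a ` G' = a ` E" "u \<in> a ` E" for G' u
  proof -
    obtain g where g: "g \<in> G'" "a g = u" using G' by (metis imageE)
    have "fdeg a E u = fdeg a G' u + fdeg a (E - G') u"
      using fdeg_Un[of G' "E - G'" a u] G'(1) fin finite_subset[OF G'(1) fin] by (simp add: Un_absorb1)
    then show ?thesis using transversal_fibre(1)[OF G'(2) g(1)] g(2) by simp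
  qed
  have GE: "G \<subseteq> E" "a ` G = a ` E" using G(1,3) aE by auto
  have oddL: "odd (fdeg a T (a l))" if "l \<in> L" for l
  proof -
    have u: "a l \<in> a ` E" using that L(1) by auto
    show ?thesis using L(4)[OF that] same[OF G0 u] same[OF GE(1) G(2) GE(2) u] unfolding T_def by simp
  qed
  obtain f0 where f0: "exact_labelling \<alpha> (T - L) 1 (int (card (T - L)) + 1) f0"
    "\<And>z. pass_bound (int (card (T - L)) + 1) (fdeg b (T - L) z) (fsum b (T - L) f0 z)"
    using forward_labelling[of "T - L" \<alpha> b] finT G(4,6)[unfolded TL] by (metis finite_Diff)
  define s where "s = int (card (T - L)) + 1"
  show ?thesis
    by (rule base_labelling_aux[where T = T and L = L and a = a and b = b and \<alpha> = \<alpha> and s = s and c = s and ?f0.0 = f0],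
        fact finT, fact LT, fact L(2), erule oddL, fact G(4)[unfolded TL], fact G(5)[unfolded TL], fact f0(1)[folded s_def], fact s_def,
        fact f0(2)[folded s_def], simp, rule that[OF GE(1) G(2) GE(2) T_def]) assumption+
qed

subsection \<open>Bipartite blocks\<close>

text \<open>Two matched edges are worth \<open>c\<close> together, whereas a reserved edge or a
  later label is worth \<open>c\<close> alone, so having some of these in place of matched edges
  does no harm. One later label is set aside at its full value \<open>M\<close>.\<close>

lemma pass_bound_total:
  fixes c M :: int
  assumes "pass_bound c D t" "int y * c \<le> z" "0 \<le> c" "c \<le> M" "D + y \<le> 2 * h"
  shows "int h * c + M \<le> t + z + int (2 * h + 1 - (D + y)) * M"
proof -
  define v where "v = 2 * h - (D + y)"
  have v: "2 * h + 1 - (D + y) = v + 1" "2 * h = D + y + v" using assms(5) unfolding v_def by auto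
  have "h \<le> D div 2 + y + v" using v(2) by linarith
  then have "int h * c \<le> int (D div 2 + y + v) * c" using assms(3) by (intro mult_right_mono) auto
  also have "\<dots> = int (D div 2) * c + int y * c + int v * c" by (simp add: algebra_simps)
  also have "\<dots> \<le> t + z + int v * M"
    using assms(1,2) mult_left_mono[OF assms(4), of "int v"] unfolding pass_bound_def by simp
  finally show ?thesis unfolding v(1) by (simp add: algebra_simps)
qed

lemma fibre_split:
  assumes "finite B" "B = T \<union> Y" "T \<inter> Y = {}"
  shows "fdeg b B w = fdeg b T w + fdeg b Y w" "fsum b B f w = fsum b T f w + fsum b Y f w"
  using assms by (simp_all add: fdeg_Un fsum_Un)

lemma vertex_bound_odd:
  assumes B: "finite B" "B = T \<union> Y" "T \<inter> Y = {}" and pb: "pass_bound c (fdeg b T w) (fsum b T f w)"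
    and Y: "\<And>e. e \<in> Y \<Longrightarrow> c \<le> f e" and c: "0 \<le> c" "c \<le> M" and d: "fdeg b B w \<le> 2 * h"
  shows "int h * c + M \<le> fsum b B f w + int (2 * h + 1 - fdeg b B w) * M"
proof -
  have "finite Y" using B by simp
  then have "int (fdeg b Y w) * c \<le> fsum b Y f w" by (rule fsum_ge) (rule Y)
  then show ?thesis using pass_bound_total[OF pb _ c, of "fdeg b Y w"] d unfolding fibre_split[OF B] by simp
qed

text \<open>With \<open>2 * h + 1\<close> block edges at \<open>w\<close> one of them has no
  partner; a reserved edge worth \<open>x\<close> is set aside for this role and
  \<open>2 * h\<close> edges remain. With fewer block edges another later label, worth at least
  \<open>x\<close>, takes over.\<close>

lemma vertex_bound_even:
  assumes B: "finite B" "B = T \<union> Y" "T \<inter> Y = {}" and pb: "pass_bound c (fdeg b T w) (fsum b T f w)"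
    and Y: "\<And>e. e \<in> Y \<Longrightarrow> c \<le> f e" and c: "0 \<le> c" "c \<le> M" and d: "fdeg b B w \<le> 2 * h + 1"
    and cov: "fdeg b B w = 2 * h + 1 \<Longrightarrow> \<exists>e\<in>Y. b e = w \<and> x \<le> f e" and x: "x \<le> M"
  shows "int h * c + x + M \<le> fsum b B f w + int (2 * h + 2 - fdeg b B w) * M"
proof (cases "fdeg b B w = 2 * h + 1")
  case True
  then obtain e where e: "e \<in> Y" "b e = w" "x \<le> f e" using cov by blast
  define Y' where "Y' = Y - {e}"
  have Y': "Y = insert e Y'" "e \<notin> Y'" "finite Y'" "finite Y" using e B unfolding Y'_def by auto
  have "int (fdeg b Y' w) * c \<le> fsum b Y' f w" using Y'(3) by (rule fsum_ge) (use Y Y' in auto)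
  moreover have s: "fdeg b Y w = Suc (fdeg b Y' w)" "fsum b Y f w = fsum b Y' f w + f e"
    using Y' e(2) by (simp_all add: fdeg_insert fsum_insert)
  moreover have "fdeg b T w + fdeg b Y' w = 2 * h" using True s unfolding fibre_split[OF B] by simp
  ultimately show ?thesis using pass_bound_total[OF pb _ c, of "fdeg b Y' w" "fsum b Y' f w" h] e(3) True
    unfolding fibre_split[OF B] by simp
next
  case False
  then have le: "fdeg b B w \<le> 2 * h" using d by simp
  have "2 * h + 2 - fdeg b B w = Suc (2 * h + 1 - fdeg b B w)" using le by simp
  then show ?thesis using vertex_bound_odd[OF B pb Y c le] x by (simp add: algebra_simps)
qed

text \<open>\<open>p u\<close> is the sum collected outside the block minus its greatest possible value, and \<open>k - fdeg b B w\<close>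
  edges at \<open>w\<close> get labels above \<open>card B\<close> later.\<close>

definition block_labelling ::
  "nat \<Rightarrow> ('e \<Rightarrow> 'u) \<Rightarrow> ('e \<Rightarrow> 'w) \<Rightarrow> 'e set \<Rightarrow> ('u \<Rightarrow> int) \<Rightarrow> ('e \<Rightarrow> int) \<Rightarrow> bool" where
  "block_labelling k a b B p f \<longleftrightarrow> bij_betw f B {1..int (card B)} \<and>
     inj_on (\<lambda>u. p u + fsum a B f u) (a ` B) \<and>
     (\<forall>u\<in>a ` B. \<forall>w. p u + fsum a B f u < fsum b B f w + int (k - fdeg b B w) * (int (card B) + 1))"

lemma bij_betw_glue:
  fixes x y z :: int
  assumes "bij_betw f X {x + 1..y}" "bij_betw g Y {y + 1..z}" "X \<inter> Y = {}" "x \<le> y" "y \<le> z"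
  shows "bij_betw (\<lambda>e. if e \<in> X then f e else g e) (X \<union> Y) {x + 1..z}"
proof -
  let ?h = "\<lambda>e. if e \<in> X then f e else g e"
  have "bij_betw ?h X {x + 1..y}" using assms(1) by (subst bij_betw_cong[of X ?h f]) auto
  moreover have "bij_betw ?h Y {y + 1..z}" using assms(2,3) by (subst bij_betw_cong[of Y ?h g]) auto
  ultimately have "bij_betw ?h (X \<union> Y) ({x + 1..y} \<union> {y + 1..z})" by (rule bij_betw_combine) auto
  moreover have "{x + 1..y} \<union> {y + 1..z} = {x + 1..z}" using assms(4,5) by auto
  ultimately show ?thesis by simp
qed

text \<open>The transversal \<open>G\<close> gets the largest labels in the order of the sums collected so far;
  the sums at the \<open>u\<close>-side are then distinct.\<close>

lemma sorted_transversal: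
  assumes fin: "finite G" "finite R" "R \<inter> G = {}" and G: "inj_on a G"
    and f: "bij_betw f R {1..int (card R)}"
  obtains g where "\<And>e. e \<in> R \<Longrightarrow> g e = f e" "bij_betw g (R \<union> G) {1..int (card (R \<union> G))}"
    "inj_on (\<lambda>u. p u + fsum a (R \<union> G) g u) (a ` G)"
    "\<And>e. e \<in> G \<Longrightarrow> int (card R) < g e"
    "\<And>u. u \<in> a ` G \<Longrightarrow> fsum a (R \<union> G) g u \<le> fsum a R f u + int (card (R \<union> G))"
proof -
  obtain h where h: "bij_betw h G {int (card R) + 1..int (card R) + int (card G)}"
      "inj_on (\<lambda>e. (p (a e) + fsum a R f (a e)) + h e) G"
    using sorted_labelling[OF fin(1), of "int (card R)" "\<lambda>e. p (a e) + fsum a R f (a e)"] by blast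
  define g where "g = (\<lambda>e. if e \<in> R then f e else h e)"
  have c: "int (card (R \<union> G)) = int (card R) + int (card G)" using fin by (simp add: card_Un_disjoint)
  have gR: "g e = f e" if "e \<in> R" for e using that unfolding g_def by simp
  have gG: "g e = h e" if "e \<in> G" for e using that fin(3) unfolding g_def by auto
  have bij: "bij_betw g (R \<union> G) {1..int (card (R \<union> G))}"
    using bij_betw_glue[of f R 0 "int (card R)" h G "int (card R) + int (card G)"] f h(1) fin(3) c unfolding g_def by simp
  have s: "fsum a (R \<union> G) g (a e) = fsum a R f (a e) + h e" if "e \<in> G" for e
    using fsum_Un[of R G a g "a e"] fin fsum_cong[of R g f a "a e"] gR transversal_fibre(2)[OF G that, of g] gG[OF that] by simp
  have "inj_on (\<lambda>u. p u + fsum a (R \<union> G) g u) (a ` G)"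
  proof (rule inj_onI)
    fix u v assume uv: "u \<in> a ` G" "v \<in> a ` G" "p u + fsum a (R \<union> G) g u = p v + fsum a (R \<union> G) g v"
    then obtain e e' where e: "e \<in> G" "u = a e" "e' \<in> G" "v = a e'" by blast
    have "e = e'" using h(2) e uv(3) s[OF e(1)] s[OF e(3)] unfolding inj_on_def by simp
    then show "u = v" using e by simp
  qed
  moreover have r: "h e \<in> {int (card R) + 1..int (card R) + int (card G)}" if "e \<in> G" for e
    using h(1) that unfolding bij_betw_def by blast
  then have "int (card R) < g e" if "e \<in> G" for e using that gG[OF that] by force
  moreover have "fsum a (R \<union> G) g u \<le> fsum a R f u + int (card (R \<union> G))" if u: "u \<in> a ` G" for u
  proof -
    obtain e where e: "e \<in> G" "u = a e" using u by blast
    show ?thesis using s[OF e(1)] r[OF e(1)] e(2) c by simp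
  qed
  ultimately show ?thesis using that[of g] gR bij by blast
qed

text \<open>Besides its reserved edge, worth at most \<open>card B\<close>, a vertex
  \<open>u\<close> has at most \<open>2 * h\<close> edges, worth at most \<open>h * s\<close>. A
  vertex \<open>w\<close> lacks at least one edge, whose later label exceeds \<open>card B\<close>,
  and the rest is worth at least \<open>h * s\<close>.\<close>

lemma block_odd:
  assumes fin: "finite B" and simple: "inj_on (\<lambda>e. (a e, b e)) B"
    and da: "\<And>u. fdeg a B u \<le> 2 * h + 1" and db: "\<And>w. fdeg b B w \<le> 2 * h"
    and p: "\<And>u. p u \<le> 0"
  shows "\<exists>f. block_labelling (2 * h + 1) a b B p f"
proof -
  obtain G T f0 s where G: "G \<subseteq> B" "inj_on a G" "a ` G = a ` B" "T = B - G" "bij_betw f0 T {1..int (card T)}"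
    and fa: "\<And>u. fsum a T f0 u \<le> int (Suc (fdeg a T u) div 2) * s"
    and fb: "\<And>w. pass_bound s (fdeg b T w) (fsum b T f0 w)"
    and s: "int (card T) \<le> s" "s \<le> int (card T) + 1"
    by (rule base_forward[OF fin simple], rule that) assumption+
  have B: "finite B" "B = T \<union> G" "T \<inter> G = {}" using G(1,4) fin by auto
  have finGT: "finite G" "finite T" using B by auto
  obtain f where f: "\<And>e. e \<in> T \<Longrightarrow> f e = f0 e" "bij_betw f B {1..int (card B)}"
    "inj_on (\<lambda>u. p u + fsum a B f u) (a ` G)" "\<And>e. e \<in> G \<Longrightarrow> int (card T) < f e"
    "\<And>u. u \<in> a ` G \<Longrightarrow> fsum a B f u \<le> fsum a T f0 u + int (card B)"
    using sorted_transversal[OF finGT B(3) G(2,5), of p thesis, folded B(2)] by blast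
  have "p u + fsum a B f u < fsum b B f w + int (2 * h + 1 - fdeg b B w) * (int (card B) + 1)"
    if u: "u \<in> a ` B" for u w
  proof -
    obtain g where g: "g \<in> G" "u = a g" using u G(3) by (metis imageE)
    have "fdeg a T u \<le> 2 * h" using da[of u] fibre_split(1)[OF B, of a u] transversal_fibre(1)[OF G(2) g(1)] g(2) by simp
    then have "int (Suc (fdeg a T u) div 2) * s \<le> int h * s" using s by (intro mult_right_mono) auto
    then have "p u + fsum a B f u \<le> int h * s + int (card B)" using f(5)[of u] u G(3) fa[of u] p[of u] by simp
    moreover have "int h * s + (int (card B) + 1) \<le> fsum b B f w + int (2 * h + 1 - fdeg b B w) * (int (card B) + 1)"
    proof (rule vertex_bound_odd[OF B])
      have "fsum b T f w = fsum b T f0 w" by (rule fsum_cong) (rule f(1))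
      then show "pass_bound s (fdeg b T w) (fsum b T f w)" using fb[of w] by simp
      show "s \<le> f e" if "e \<in> G" for e using f(4)[OF that] s by simp
      have "card T \<le> card B" using G(4) fin by (simp add: card_mono)
      then show "s \<le> int (card B) + 1" using s by simp
    qed (use s db in auto)
    ultimately show ?thesis by simp
  qed
  then show ?thesis unfolding block_labelling_def using f(2,3) G(3) by auto
qed

section \<open>Blocks for even \<open>k\<close>\<close>

lemma extend_transversal:
  assumes "C \<subseteq> B" "inj_on a C"
  obtains G where "C \<subseteq> G" "G \<subseteq> B" "inj_on a G" "a ` G = a ` B"
proof -
  obtain P where P: "P \<subseteq> B" "inj_on a P" "a ` B - a ` C = a ` P"
    using subset_image_inj[of "a ` B - a ` C" a B] by blast
  have "inj_on a (C \<union> P)" unfolding inj_on_Un using assms(2) P(2,3) by blast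
  moreover have "a ` (C \<union> P) = a ` B" using P(3) assms(1) by blast
  ultimately show ?thesis using that[of "C \<union> P"] assms P by blast
qed

text \<open>The covering edges \<open>C\<close> have distinct values of \<open>a\<close>, so all of
  them fit into the top class \<open>G\<close>. The second transversal \<open>X\<close> is still
  free, hence the full \<open>s\<close> is available. A vertex \<open>u\<close> has at most
  \<open>h * s + card R + card B\<close>; at \<open>w\<close> the last two terms are exceeded by a
  covering edge or a later label, and by a later label.\<close>

lemma block_even_single:
  assumes fin: "finite B" and simple: "inj_on (\<lambda>e. (a e, b e)) B"
    and da: "\<And>u. fdeg a B u \<le> 2 * h + 2" and db: "\<And>w. fdeg b B w \<le> 2 * h + 1"
    and p: "\<And>u. p u \<le> 0"
    and C: "C \<subseteq> B" "inj_on a C" "\<And>w. fdeg b B w = 2 * h + 1 \<Longrightarrow> w \<in> b ` C"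
  shows "\<exists>f. block_labelling (2 * h + 2) a b B p f"
proof -
  obtain G where G: "C \<subseteq> G" "G \<subseteq> B" "inj_on a G" "a ` G = a ` B" by (rule extend_transversal[OF C(1,2)])
  obtain X T f0 s where X: "X \<subseteq> B - G" "inj_on a X" "a ` X = a ` (B - G)" "T = (B - G) - X" "bij_betw f0 T {1..int (card T)}"
    and fa: "\<And>u. fsum a T f0 u \<le> int (Suc (fdeg a T u) div 2) * s"
    and fb: "\<And>w. pass_bound s (fdeg b T w) (fsum b T f0 w)"
    and s: "int (card T) \<le> s" "s \<le> int (card T) + 1"
    by (rule base_forward[OF finite_Diff[OF fin] inj_on_subset[OF simple Diff_subset], of G], rule that) assumption+
  define R where "R = T \<union> X"
  have B: "B = R \<union> G" "R \<inter> G = {}" "T \<inter> X = {}" "B = T \<union> (X \<union> G)" "T \<inter> (X \<union> G) = {}"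
    using X(1,4) G(2) unfolding R_def by auto
  have fins: "finite G" "finite T" "finite X" "finite R" using B(1) fin unfolding R_def by auto
  obtain f1 where f1: "bij_betw f1 X {int (card T) + 1..int (card T) + int (card X)}"
    using sorted_labelling[OF fins(3), of "int (card T)" "\<lambda>_. 0"] by blast
  define f2 where "f2 = (\<lambda>e. if e \<in> T then f0 e else f1 e)"
  have cR: "card R = card T + card X" unfolding R_def using fins B(3) by (simp add: card_Un_disjoint)
  have f2: "bij_betw f2 R {1..int (card R)}"
    using bij_betw_glue[of f0 T 0 "int (card T)" f1 X "int (card T) + int (card X)"] X(5) f1 B(3) cR
    unfolding f2_def R_def by simp
  obtain f where f: "\<And>e. e \<in> R \<Longrightarrow> f e = f2 e" "bij_betw f B {1..int (card B)}"
    "inj_on (\<lambda>u. p u + fsum a B f u) (a ` G)" "\<And>e. e \<in> G \<Longrightarrow> int (card R) < f e"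
    "\<And>u. u \<in> a ` G \<Longrightarrow> fsum a B f u \<le> fsum a R f2 u + int (card B)"
    using sorted_transversal[OF fins(1,4) B(2) G(3) f2, of p thesis, folded B(1)] by blast
  have fX: "int (card T) + 1 \<le> f2 e \<and> f2 e \<le> int (card R)" if "e \<in> X" for e
  proof -
    have "f1 e \<in> {int (card T) + 1..int (card T) + int (card X)}" using f1 that unfolding bij_betw_def by blast
    moreover have "f2 e = f1 e" using that B(3) unfolding f2_def by auto
    ultimately show ?thesis using cR by simp
  qed
  have fT: "f e = f0 e" if "e \<in> T" for e using f(1)[of e] that unfolding f2_def R_def by simp
  have rest: "fsum a R f2 u \<le> int h * s + int (card R)" if u: "u \<in> a ` B" for u
  proof -
    obtain g where g: "g \<in> G" "u = a g" using u G(4) by (metis imageE)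
    have sp: "fsum a R f2 u = fsum a T f2 u + fsum a X f2 u" "fdeg a B u = fdeg a T u + fdeg a X u + 1"
      using fsum_Un[OF fins(2,3) B(3), of a f2 u] fdeg_Un[OF fins(2,3) B(3), of a u] fdeg_Un[OF fins(4,1) B(2), of a u]
        transversal_fibre(1)[OF G(3) g(1)] g(2) B(1) unfolding R_def by simp_all
    have "fsum a T f2 u = fsum a T f0 u" by (rule fsum_cong) (simp add: f2_def)
    then have T: "fsum a T f2 u \<le> int (Suc (fdeg a T u) div 2) * s" using fa by simp
    show ?thesis
    proof (cases "u \<in> a ` X")
      case True
      then obtain x where x: "x \<in> X" "u = a x" by blast
      have "fdeg a T u \<le> 2 * h" using sp(2) da[of u] transversal_fibre(1)[OF X(2) x(1)] x(2) by simp
      then have "int (Suc (fdeg a T u) div 2) * s \<le> int h * s" using s by (intro mult_right_mono) auto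
      moreover have "fsum a X f2 u \<le> int (card R)" using transversal_fibre(2)[OF X(2) x(1), of f2] x fX[OF x(1)] by simp
      ultimately show ?thesis using T sp(1) by simp
    next
      case False
      then have "u \<notin> a ` T" using X(3,4) by auto
      then have "fsum a R f2 u = 0" using sp(1) fibre_empty(2)[OF False, of f2] fibre_empty(2)[of u a T f2] by simp
      then show ?thesis using s by simp
    qed
  qed
  have "p u + fsum a B f u < fsum b B f w + int (2 * h + 2 - fdeg b B w) * (int (card B) + 1)"
    if u: "u \<in> a ` B" for u w
  proof -
    have "p u + fsum a B f u \<le> int h * s + int (card R) + int (card B)" using f(5)[of u] u G(4) rest[OF u] p[of u] by simp
    moreover have "int h * s + (int (card R) + 1) + (int (card B) + 1)
      \<le> fsum b B f w + int (2 * h + 2 - fdeg b B w) * (int (card B) + 1)"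
    proof (rule vertex_bound_even[OF fin B(4,5)])
      have "fsum b T f w = fsum b T f0 w" by (rule fsum_cong) (rule fT)
      then show "pass_bound s (fdeg b T w) (fsum b T f w)" using fb[of w] by simp
      have "card R \<le> card B" using B(1) fin by (simp add: card_mono)
      then show "int (card R) + 1 \<le> int (card B) + 1" "s \<le> int (card B) + 1" using s cR by simp_all
      show "s \<le> f e" if "e \<in> X \<union> G" for e
        using that f(1)[of e] f(4)[of e] fX[of e] s cR unfolding R_def by auto
      show "\<exists>e\<in>X \<union> G. b e = w \<and> int (card R) + 1 \<le> f e" if w: "fdeg b B w = 2 * h + 1"
      proof -
        obtain e where "e \<in> C" "b e = w" using C(3)[OF w] by blast
        then show ?thesis using f(4)[of e] G(1) by force
      qed
    qed (use s db in auto)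
    ultimately show ?thesis by simp
  qed
  then show ?thesis unfolding block_labelling_def using f(2,3) G(4) by auto
qed

text \<open>Among the second reserved edges those at \<open>D\<close> may have to serve as the
  unmatched edge of some \<open>w\<close>, so they need labels near the top of their
  interval.\<close>

lemma numbering_with_top:
  assumes "finite X" "D \<subseteq> X"
  obtains j :: "'x \<Rightarrow> nat" where "bij_betw j X {1..card X}" "\<And>x. x \<in> D \<Longrightarrow> card X < j x + card D"
proof -
  define n d where "n = int (card X)" and "d = int (card D)"
  have fin: "finite D" "finite (X - D)" using assms finite_subset by auto
  have d: "0 \<le> d" "d \<le> n" "int (card (X - D)) = n - d" using assms fin card_mono[of X D]
    unfolding n_def d_def by (auto simp: card_Diff_subset)
  obtain g1 where g1: "bij_betw g1 (X - D) {0 + 1..0 + (n - d)}"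
    using sorted_labelling[OF fin(2), of 0 "\<lambda>_. 0"] d(3) by auto
  obtain g2 where g2: "bij_betw g2 D {(n - d) + 1..(n - d) + d}"
    using sorted_labelling[OF fin(1), of "n - d" "\<lambda>_. 0"] unfolding d_def by auto
  define g where "g = (\<lambda>e. if e \<in> X - D then g1 e else g2 e)"
  have "bij_betw g X {1..n}"
    using bij_betw_glue[of g1 "X - D" 0 "n - d" g2 D n] g1 g2 d assms(2)
    unfolding g_def by (simp add: Un_absorb2 Diff_disjoint Int_commute[of "X - D"])
  moreover have "bij_betw nat {1..n} {1..card X}"
    by (rule bij_betw_byWitness[where f' = int]) (auto simp: n_def)
  ultimately have "bij_betw (nat \<circ> g) X {1..card X}" by (rule bij_betw_trans)
  moreover have "card X < (nat \<circ> g) x + card D" if "x \<in> D" for x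
  proof -
    have "g2 x \<in> {(n - d) + 1..(n - d) + d}" using g2 that unfolding bij_betw_def by blast
    then show ?thesis using that unfolding g_def n_def d_def by auto
  qed
  ultimately show ?thesis by (rule that)
qed

text \<open>The left side collects the spread of the window, the unit lost at each of
  \<open>h\<close> passages, and the \<open>d\<close> top places among which the covering edges are
  distributed.\<close>

lemma doubled_slack:
  fixes d h n :: nat
  assumes "(2 * h + 1) * d \<le> n" "1 \<le> h" "1 \<le> d"
  shows "n div 2 + h + d \<le> n"
proof -
  obtain h' d' where "h = Suc h'" "d = Suc d'" using assms(2,3) by (metis Suc_le_D One_nat_def)
  moreover from this have "(2 * h + 1) * d = 2 * (h' * d') + 3 * d' + 2 * h' + 3" by (simp add: algebra_simps)
  ultimately show ?thesis using assms(1) by linarith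
qed

lemma bij_betw_shift: "bij_betw (\<lambda>i. c + int i) {1..n} {c + 1..c + int n}"
  by (rule bij_betw_byWitness[where f' = "\<lambda>x. nat (x - c)"]) auto

text \<open>The two largest edges at a vertex \<open>u\<close> of full degree carry the labels numbered \<open>j u\<close> and \<open>\<pi> (j u)\<close>
  in their intervals.\<close>

lemma block_even_double:
  assumes fin: "finite B"
    and da: "\<And>u. fdeg a B u \<le> 2 * h + 2" and db: "\<And>w. fdeg b B w \<le> 2 * h + 1" and h: "1 \<le> h"
    and p: "\<And>u. p u \<le> 0" "\<And>u. fdeg a B u = 2 * h + 2 \<Longrightarrow> p u = 0"
    and G: "G \<subseteq> B" "inj_on a G" "a ` G = a ` B"
    and M: "M \<subseteq> B - G" "inj_on a M" "a ` M = {u. fdeg a B u = 2 * h + 2}"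
    and D: "D \<subseteq> a ` M" "D \<noteq> {}" "(2 * h + 1) * card D \<le> card M"
    and cov: "\<And>w. fdeg b B w = 2 * h + 1 \<Longrightarrow> \<exists>e\<in>G \<union> {e\<in>M. a e \<in> D}. b e = w"
  shows "\<exists>f. block_labelling (2 * h + 2) a b B p f"
proof -
  \<comment> \<open>The labels increase in the order \<open>T\<close>, \<open>M\<close>,
    \<open>GN\<close>, \<open>GT\<close>. The edges of \<open>GT\<close> belong to the full
    vertices, so all sums at the other vertices of the block stay below theirs.\<close>
  define T GT GN where "T = B - G - M" and "GT = {e\<in>G. a e \<in> a ` M}" and "GN = {e\<in>G. a e \<notin> a ` M}"
  define R where "R = T \<union> M"
  define A where "A = R \<union> GN"
  have B: "B = T \<union> (M \<union> G)" "T \<inter> (M \<union> G) = {}" "T \<inter> M = {}" "R \<inter> GN = {}" "B = A \<union> GT" "A \<inter> GT = {}"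
    using M(1) G(1) unfolding T_def GT_def GN_def R_def A_def by auto
  have "finite T" "finite M" "finite G" using B(1) fin by auto
  then have fins: "finite T" "finite M" "finite R" "finite GN" "finite GT" "finite A" "finite G"
    unfolding A_def R_def GN_def GT_def by simp_all
  have GNT: "inj_on a GN" "inj_on a GT" "GN \<subseteq> G" "GT \<subseteq> G" "a ` GT = a ` M"
  proof -
    show *: "GN \<subseteq> G" "GT \<subseteq> G" unfolding GN_def GT_def by (rule Collect_restrict)+
    show "inj_on a GN" "inj_on a GT" by (rule inj_on_subset[OF G(2) *(1)], rule inj_on_subset[OF G(2) *(2)])
    have "a ` M \<subseteq> a ` G" unfolding G(3) by (rule image_mono) (use M(1) in blast)
    moreover have "a ` {e\<in>G. a e \<in> S} = S" if "S \<subseteq> a ` G" for S using that by auto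
    ultimately show "a ` GT = a ` M" unfolding GT_def by simp
  qed
  define n d where "n = card (a ` M)" and "d = card D"
  have n: "n = card M" "n = card GT" using card_image[OF M(2)] card_image[OF GNT(2)] GNT(5) unfolding n_def by simp_all
  have "finite D" using D(1) fins(2) finite_subset by blast
  then have "1 \<le> d" using D(2) unfolding d_def by (simp add: Suc_le_eq card_gt_0_iff)
  then have slack: "n div 2 + h + d \<le> n" using doubled_slack[of h d n] D(3) h n unfolding d_def by simp
  \<comment> \<open>\<open>G\<close> and \<open>M\<close> are both prescribed here, so closed trails
    in \<open>T\<close> cannot be excluded.\<close>
  obtain f0 s where f0: "bij_betw f0 T {1..int (card T)}"
    and fa: "\<And>u. fsum a T f0 u \<le> int (Suc (fdeg a T u) div 2) * s"
    and fa_even: "\<And>u. even (fdeg a T u) \<Longrightarrow> fsum a T f0 u = int (fdeg a T u div 2) * s"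
    and fb: "\<And>w. pass_bound (s - 1) (fdeg b T w) (fsum b T f0 w)"
    and s: "int (card T) \<le> s" "s \<le> int (card T) + 1"
    by (rule base_backward[OF fins(1), of a b], rule that) assumption+
  obtain j where j: "bij_betw j (a ` M) {1..n}" "\<And>u. u \<in> D \<Longrightarrow> n < j u + d"
    using numbering_with_top[of "a ` M" D] fins(2) D(1) unfolding n_def d_def by blast
  obtain \<pi> where \<pi>: "bij_betw \<pi> {1..n} {1..n}" "inj_on (\<lambda>j. j + \<pi> j) {1..n}"
    "\<And>j. j \<in> {1..n} \<Longrightarrow> j + \<pi> j \<le> n + 1 + n div 2"
    by (rule window_permutation[of n], rule that) assumption+
  have jr: "j u \<in> {1..n}" "\<pi> (j u) \<in> {1..n}" if "u \<in> a ` M" for u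
    using j(1) \<pi>(1) that unfolding bij_betw_def by blast+
  define fM where "fM e = int (card T) + int (j (a e))" for e
  define f2 where "f2 = (\<lambda>e. if e \<in> T then f0 e else fM e)"
  have "bij_betw a M (a ` M)" using M(2) by (simp add: bij_betw_def)
  from bij_betw_trans[OF bij_betw_trans[OF this j(1)] bij_betw_shift]
  have "bij_betw fM M {int (card T) + 1..int (card T) + int n}" unfolding fM_def comp_def .
  moreover have cR: "card R = card T + n" unfolding R_def n(1) using fins B(3) by (simp add: card_Un_disjoint)
  ultimately have f2: "bij_betw f2 R {1..int (card R)}"
    using bij_betw_glue[of f0 T 0 "int (card T)" fM M "int (card T) + int n"] f0 B(3) unfolding f2_def R_def by simp
  obtain g where g: "\<And>e. e \<in> R \<Longrightarrow> g e = f2 e" "bij_betw g A {1..int (card A)}"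
    "inj_on (\<lambda>u. p u + fsum a A g u) (a ` GN)" "\<And>e. e \<in> GN \<Longrightarrow> int (card R) < g e"
    "\<And>u. u \<in> a ` GN \<Longrightarrow> fsum a A g u \<le> fsum a R f2 u + int (card A)"
    by (rule sorted_transversal[OF fins(4,3) B(4) GNT(1) f2, of p, folded A_def], rule that) assumption+
  define fT where "fT e = int (card A) + int (\<pi> (j (a e)))" for e
  define f where "f = (\<lambda>e. if e \<in> A then g e else fT e)"
  have "bij_betw a GT (a ` M)" using GNT(2,5) by (simp add: bij_betw_def)
  from bij_betw_trans[OF bij_betw_trans[OF bij_betw_trans[OF this j(1)] \<pi>(1)] bij_betw_shift]
  have "bij_betw fT GT {int (card A) + 1..int (card A) + int n}" unfolding fT_def comp_def .
  moreover have cB: "card B = card A + n" using fins B(5,6) n(2) by (simp add: card_Un_disjoint)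
  ultimately have f: "bij_betw f B {1..int (card B)}"
    using bij_betw_glue[of g A 0 "int (card A)" fT GT "int (card A) + int n"] g(2) B(5,6) unfolding f_def by simp
  have ff: "f e = f0 e" if "e \<in> T" for e using that g(1)[of e] unfolding f_def f2_def A_def R_def by simp
  have fMe: "f e = fM e" if "e \<in> M" for e
    using that g(1)[of e] B(3) unfolding f_def f2_def A_def R_def by auto
  have fGN: "f e = g e" if "e \<in> GN" for e using that unfolding f_def A_def by simp
  have fGT: "f e = fT e" if "e \<in> GT" for e using that B(6) unfolding f_def by auto
  have cRA: "card R \<le> card A" unfolding A_def using fins by (simp add: card_mono)
  have nontight: "fsum a B f u = fsum a A g u" "fsum a A g u \<le> int h * s + int (card A)"
    if u: "u \<in> a ` GN" for u
  proof -
    obtain e where e: "e \<in> GN" "u = a e" using u by blast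
    have no: "u \<notin> a ` GT" "u \<notin> a ` M" using e unfolding GN_def GT_def by auto
    have "fsum a A f u = fsum a A g u" by (rule fsum_cong) (simp add: f_def)
    then show "fsum a B f u = fsum a A g u"
      using fsum_Un[OF fins(6,5) B(6), of a f u] fibre_empty(2)[OF no(1), of f] B(5) by simp
    have "fsum a T f2 u = fsum a T f0 u" by (rule fsum_cong) (simp add: f2_def)
    then have "fsum a R f2 u = fsum a T f0 u"
      using fsum_Un[OF fins(1,2) B(3), of a f2 u] fibre_empty(2)[OF no(2), of f2] unfolding R_def by simp
    moreover have "fdeg a T u \<le> 2 * h"
    proof -
      have "fdeg a B u = fdeg a T u + fdeg a (M \<union> G) u" using fibre_split(1)[OF fin B(1,2), of a u] .
      moreover have "fdeg a (M \<union> G) u = fdeg a M u + fdeg a G u" using fdeg_Un[of M G a u] fins M(1) by auto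
      moreover have "fdeg a G u = 1" using transversal_fibre(1)[OF G(2), of e] e GNT(3) by auto
      moreover have "fdeg a B u \<noteq> 2 * h + 2" using no(2) M(3) by blast
      ultimately show ?thesis using da[of u] by simp
    qed
    then have "int (Suc (fdeg a T u) div 2) * s \<le> int h * s" using s by (intro mult_right_mono) auto
    ultimately show "fsum a A g u \<le> int h * s + int (card A)" using g(5)[OF u] fa[of u] by simp
  qed
  have tight: "fsum a B f u = int h * s + int (card T) + int (card A) + int (j u + \<pi> (j u))" "p u = 0" "fdeg a T u = 2 * h"
    if u: "u \<in> a ` M" for u
  proof -
    have k: "fdeg a B u = 2 * h + 2" using u M(3) by blast
    then show "p u = 0" by (rule p(2))
    obtain e where e: "e \<in> M" "u = a e" using u by blast
    obtain e' where e': "e' \<in> GT" "u = a e'" using u GNT(5) by blast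
    have GM: "fdeg a (M \<union> G) u = fdeg a M u + fdeg a G u" "fsum a (M \<union> G) f u = fsum a M f u + fsum a G f u"
      using fdeg_Un[of M G a u] fsum_Un[of M G a f u] fins M(1) by auto
    have e'G: "e' \<in> G" using e'(1) GNT(4) by blast
    have "fdeg a M u = 1" "fsum a M f u = f e" "fdeg a G u = 1" "fsum a G f u = f e'"
      using transversal_fibre[OF M(2) e(1)] transversal_fibre[OF G(2) e'G] e(2) e'(2) by simp_all
    note GM = GM[unfolded this]
    show dT: "fdeg a T u = 2 * h" using fibre_split(1)[OF fin B(1,2), of a u] GM k by simp
    have "fsum a T f u = fsum a T f0 u" by (rule fsum_cong) (rule ff)
    also have "\<dots> = int h * s" using fa_even[of u] dT by simp
    finally have "fsum a T f u = int h * s" .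
    moreover have "f e = int (card T) + int (j u)" "f e' = int (card A) + int (\<pi> (j u))"
      unfolding fMe[OF e(1)] fGT[OF e'(1)] fM_def fT_def e(2)[symmetric] e'(2)[symmetric] by (rule refl)+
    ultimately show "fsum a B f u = int h * s + int (card T) + int (card A) + int (j u + \<pi> (j u))"
      unfolding fibre_split(2)[OF fin B(1,2), of a f u] GM(2) by linarith
  qed
  have split: "u \<in> a ` GN \<or> u \<in> a ` M" if "u \<in> a ` B" for u
  proof -
    obtain e where "e \<in> G" "u = a e" using \<open>u \<in> a ` B\<close> unfolding G(3)[symmetric] by blast
    then show ?thesis unfolding GN_def by blast
  qed
  have above: "p u + fsum a B f u < p v + fsum a B f v" if "u \<in> a ` GN" "v \<in> a ` M" for u v
    using nontight[OF that(1)] tight[OF that(2)] p(1)[of u] jr[OF that(2)] by simp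
  have inj: "inj_on (\<lambda>u. p u + fsum a B f u) (a ` B)"
  proof (rule inj_onI)
    fix u v assume uv: "u \<in> a ` B" "v \<in> a ` B" "p u + fsum a B f u = p v + fsum a B f v"
    consider "u \<in> a ` GN" "v \<in> a ` GN" | "u \<in> a ` M" "v \<in> a ` M" | "u \<in> a ` GN" "v \<in> a ` M" | "u \<in> a ` M" "v \<in> a ` GN"
      using split uv by blast
    then show "u = v"
    proof cases
      case 1
      have "p u + fsum a A g u = p v + fsum a A g v" using uv(3) unfolding nontight(1)[OF 1(1)] nontight(1)[OF 1(2)] .
      from inj_onD[OF g(3) this 1] show ?thesis .
    next
      case 2
      then have "j u + \<pi> (j u) = j v + \<pi> (j v)" using tight(1,2)[OF 2(1)] tight(1,2)[OF 2(2)] uv(3) by simp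
      then have "j u = j v" by (rule inj_onD[OF \<pi>(2) _ jr(1)[OF 2(1)] jr(1)[OF 2(2)]])
      then show ?thesis by (rule inj_onD[OF bij_betw_imp_inj_on[OF j(1)] _ 2])
    next
      case 3
      then show ?thesis using above[OF 3] uv(3) by simp
    next
      case 4
      then show ?thesis using above[OF 4(2,1)] uv(3) by simp
    qed
  qed
  have upper: "p u + fsum a B f u \<le> int h * s + int (card T) + int (card B) + 1 + int (n div 2)" if u: "u \<in> a ` B" for u
  proof (cases "u \<in> a ` M")
    case True
    have "j u + \<pi> (j u) \<le> n + 1 + n div 2" by (rule \<pi>(3)[OF jr(1)[OF True]])
    then show ?thesis using tight(1,2)[OF True] cB by simp
  next
    case False
    then have "u \<in> a ` GN" using split u by blast
    then show ?thesis using nontight p(1)[of u] cB by fastforce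
  qed
  obtain u0 where "u0 \<in> a ` M" using D by blast
  then have "T \<noteq> {}" using tight(3)[of u0] h by auto
  then have s1: "1 \<le> s" using s(1) fins(1) by (metis card_gt_0_iff int_one_le_iff_zero_less of_nat_0_less_iff order_trans)
  have dn: "d \<le> n" using slack by simp
  \<comment> \<open>The edges of \<open>M\<close> at \<open>D\<close> occupy the last
    \<open>d\<close> places of their interval, and those of \<open>G\<close> lie above this
    interval.\<close>
  define x where "x = int (card T) + int n - int d + 1"
  have GR: "int (card R) < f e" if "e \<in> G" for e
  proof (cases "e \<in> GN")
    case True
    then show ?thesis using g(4) fGN by simp
  next
    case False
    then have "e \<in> GT" using that unfolding GN_def GT_def by blast
    moreover from this have "a e \<in> a ` M" using GNT(5) by blast
    ultimately show ?thesis using fGT[of e] jr(2)[of "a e"] cRA unfolding fT_def by simp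
  qed
  have lower: "int h * (s - 1) + x + (int (card B) + 1)
      \<le> fsum b B f w + int (2 * h + 2 - fdeg b B w) * (int (card B) + 1)" for w
  proof (rule vertex_bound_even[OF fin B(1,2)])
    have "fsum b T f w = fsum b T f0 w" by (rule fsum_cong) (rule ff)
    then show "pass_bound (s - 1) (fdeg b T w) (fsum b T f w)" using fb[of w] by simp
    show "s - 1 \<le> f e" if "e \<in> M \<union> G" for e
      using that GR[of e] fMe[of e] s cR unfolding fM_def by auto
    show "\<exists>e\<in>M \<union> G. b e = w \<and> x \<le> f e" if w: "fdeg b B w = 2 * h + 1"
    proof -
      obtain e where "e \<in> G \<or> (e \<in> M \<and> a e \<in> D)" "b e = w" using cov[OF w] by blast
      moreover have "x \<le> f e" if "e \<in> G" using GR[OF that] cR unfolding x_def by simp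
      moreover have "x \<le> f e" if "e \<in> M" "a e \<in> D" using fMe[OF that(1)] j(2)[OF that(2)] unfolding fM_def x_def by simp
      ultimately show ?thesis by blast
    qed
    show "x \<le> int (card B) + 1" "s - 1 \<le> int (card B) + 1" using cB cRA cR s unfolding x_def by simp_all
  qed (use s1 db in auto)
  have "p u + fsum a B f u < fsum b B f w + int (2 * h + 2 - fdeg b B w) * (int (card B) + 1)" if u: "u \<in> a ` B" for u w
  proof -
    have "int (n div 2) + int h + int d \<le> int n" using slack by linarith
    then show ?thesis using upper[OF u] lower[of w] unfolding x_def by (simp add: algebra_simps)
  qed
  then show ?thesis unfolding block_labelling_def using f inj by auto
qed

text \<open>The cover splits into two partial transversals: one of its edges at each vertex goes to
  \<open>G\<close>, and a second one goes to \<open>M\<close>. The latter occurs only at load 2,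
  hence only at full vertices, where a second reserved edge is allowed.\<close>

lemma block_even:
  assumes fin: "finite B" and simple: "inj_on (\<lambda>e. (a e, b e)) B" and h: "1 \<le> h"
    and da: "\<And>u. fdeg a B u \<le> 2 * h + 2" and db: "\<And>w. fdeg b B w \<le> 2 * h + 1"
    and p: "\<And>u. p u \<le> 0" "\<And>u. fdeg a B u = 2 * h + 2 \<Longrightarrow> p u = 0"
  shows "\<exists>f. block_labelling (2 * h + 2) a b B p f"
proof -
  define W where "W = {w. fdeg b B w = 2 * h + 2 - 1}"
  have W: "W = {w. fdeg b B w = 2 * h + 1}" unfolding W_def by simp
  have k: "3 \<le> 2 * h + 2" using h by simp
  obtain \<phi> where \<phi>: "covers b B W \<phi>" "\<And>u. load a W \<phi> u \<le> (if fdeg a B u = 2 * h + 2 then 2 else 1)"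
    "(2 * h + 2 - 1) * card {u. load a W \<phi> u = 2} \<le> card {u. fdeg a B u = 2 * h + 2}"
    by (rule balanced_cover[where a = a and b = b, OF fin k da, folded W_def], rule that) assumption+
  have \<phi>B: "\<phi> w \<in> B" "b (\<phi> w) = w" if "w \<in> W" for w using \<phi>(1) that unfolding covers_def by blast+
  have "W \<subseteq> b ` B"
  proof
    fix w assume "w \<in> W"
    then show "w \<in> b ` B" using \<phi>B[of w] by force
  qed
  then have finW: "finite W" using fin finite_surj by blast
  define C where "C = \<phi> ` W"
  have CB: "C \<subseteq> B" unfolding C_def using \<phi>B(1) by blast
  have bC: "b e \<in> W" "\<phi> (b e) = e" if "e \<in> C" for e using that \<phi>B unfolding C_def by auto
  \<comment> \<open>Different edges of \<open>C\<close> serve different elements of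
    \<open>W\<close>, since \<open>b\<close> recovers the element from its edge.\<close>
  have count: "card S \<le> load a W \<phi> u" if S: "S \<subseteq> C" "\<And>e. e \<in> S \<Longrightarrow> a e = u" for S u
  proof -
    have "inj_on b S" using bC(2) S(1) by (metis inj_onI subsetD)
    then have "card S = card (b ` S)" by (simp add: card_image)
    also have "\<dots> \<le> load a W \<phi> u" unfolding load_def
      by (rule card_mono) (use finW bC S in auto)
    finally show ?thesis .
  qed
  have pair: "load a W \<phi> (a e) = 2" if e: "e \<in> C" "e' \<in> C" "a e = a e'" "e \<noteq> e'" for e e'
  proof -
    have "card {e, e'} \<le> load a W \<phi> (a e)" by (rule count) (use e in auto)
    then show ?thesis using e(4) \<phi>(2)[of "a e"] by (auto split: if_splits)
  qed
  define D where "D = {u. load a W \<phi> u = 2}"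
  show ?thesis
  proof (cases "D = {}")
    case True
    have "inj_on a C" using pair True unfolding inj_on_def D_def by blast
    moreover have "w \<in> b ` C" if "fdeg b B w = 2 * h + 1" for w
      using that \<phi>B(2)[of w] unfolding C_def W by force
    ultimately show ?thesis using block_even_single[where p = p, OF fin simple da db p(1) CB] by blast
  next
    case False
    obtain C1 where C1: "C1 \<subseteq> C" "inj_on a C1" "a ` C1 = a ` C" by (metis subset_image_inj order_refl)
    obtain G where G: "C1 \<subseteq> G" "G \<subseteq> B" "inj_on a G" "a ` G = a ` B"
      by (rule extend_transversal[of C1 B a]) (use C1 CB in blast)+
    define C2 where "C2 = C - C1"
    have partner: "\<exists>e1\<in>C1. a e1 = a e \<and> e1 \<noteq> e" if "e \<in> C2" for e
    proof -
      have "a e \<in> a ` C1" using that C1(3) unfolding C2_def by auto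
      then show ?thesis using that unfolding C2_def by force
    qed
    have inj2: "inj_on a C2"
    proof (rule inj_onI, rule ccontr)
      fix e e' assume e: "e \<in> C2" "e' \<in> C2" "a e = a e'" "e \<noteq> e'"
      obtain e1 where e1: "e1 \<in> C1" "a e1 = a e" using partner[OF e(1)] by blast
      have ne: "e1 \<noteq> e" "e1 \<noteq> e'" using e(1,2) e1(1) unfolding C2_def by auto
      have "card {e1, e, e'} \<le> load a W \<phi> (a e)" by (rule count) (use e e1 C1(1) in \<open>auto simp: C2_def\<close>)
      moreover have "card {e1, e, e'} = 3" using ne e(4) by simp
      ultimately show False using \<phi>(2)[of "a e"] by (simp split: if_splits)
    qed
    have aC2: "a e \<in> D" if eC: "e \<in> C2" for e
    proof -
      obtain e1 where "e1 \<in> C1" "a e1 = a e" "e1 \<noteq> e" using partner[OF eC] by blast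
      then have "load a W \<phi> (a e) = 2" using pair[of e e1] eC C1(1) unfolding C2_def by auto
      then show ?thesis unfolding D_def by simp
    qed
    have Dk: "fdeg a B u = 2 * h + 2" if "u \<in> D" for u
      using that \<phi>(2)[of u] unfolding D_def by (simp split: if_splits)
    define B' where "B' = {e \<in> B - G. fdeg a B (a e) = 2 * h + 2}"
    have C2G: "e \<notin> G" if eC: "e \<in> C2" for e
    proof
      assume "e \<in> G"
      moreover obtain e1 where "e1 \<in> C1" "a e1 = a e" "e1 \<noteq> e" using partner[OF eC] by blast
      ultimately show False using G(1) inj_onD[OF G(3), of e1 e] by blast
    qed
    have "C2 \<subseteq> B'" unfolding B'_def using C2G aC2 Dk CB unfolding C2_def by blast
    from extend_transversal[OF this inj2]
    obtain M where M: "C2 \<subseteq> M" "M \<subseteq> B'" "inj_on a M" "a ` M = a ` B'" by metis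
    have aB': "a ` B' = {u. fdeg a B u = 2 * h + 2}"
    proof
      show "a ` B' \<subseteq> {u. fdeg a B u = 2 * h + 2}" unfolding B'_def by auto
      show "{u. fdeg a B u = 2 * h + 2} \<subseteq> a ` B'"
      proof
        fix u assume "u \<in> {u. fdeg a B u = 2 * h + 2}"
        then have u: "fdeg a B u = 2 * h + 2" by simp
        \<comment> \<open>A full vertex has at least two edges, so one is left for \<open>M\<close>
          besides its edge in \<open>G\<close>.\<close>
        have "fdeg a G u \<le> 1"
        proof (cases "u \<in> a ` G")
          case True
          then obtain g where "g \<in> G" "u = a g" by blast
          then show ?thesis using transversal_fibre(1)[OF G(3), of g] by simp
        next
          case False
          show ?thesis unfolding fibre_empty(1)[OF False] by simp
        qed
        moreover have "B = G \<union> (B - G)" using G(2) by blast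
        from fibre_split(1)[OF fin this, of a u]
        have "fdeg a B u = fdeg a G u + fdeg a (B - G) u" by blast
        ultimately have "fdeg a (B - G) u \<noteq> 0" using u by simp
        then have "u \<in> a ` (B - G)" using fibre_empty(1)[of u a "B - G"] by (rule contrapos_np)
        then obtain e where "e \<in> B - G" "a e = u" by (elim imageE) simp
        then show "u \<in> a ` B'" using u unfolding B'_def by blast
      qed
    qed
    note aM = M(4)[unfolded aB']
    show ?thesis
    proof (rule block_even_double[OF fin da db h p G(2-4) _ M(3) aM _ False])
      show "M \<subseteq> B - G" using M(2) unfolding B'_def by blast
      show "D \<subseteq> a ` M" using Dk unfolding aM by blast
      show "(2 * h + 1) * card D \<le> card M"
        using \<phi>(3) card_image[OF M(3)] unfolding aM D_def by simp
      show "\<exists>e\<in>G \<union> {e \<in> M. a e \<in> D}. b e = w" if w: "fdeg b B w = 2 * h + 1" for w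
      proof (cases "\<phi> w \<in> C1")
        case True
        then show ?thesis using \<phi>B(2)[of w] w G(1) unfolding W by blast
      next
        case False
        then have "\<phi> w \<in> C2" using w unfolding C2_def C_def W by blast
        then show ?thesis using \<phi>B(2)[of w] w aC2 M(1) unfolding W by blast
      qed
    qed
  qed
qed

text \<open>With at most two edges the labels of the whole block sum to at most
  \<open>card B + 1\<close>, the least value of a single later label. Since \<open>w\<close> has one
  block edge and one later label, or two later labels, it is strictly above.\<close>

lemma block_two:
  assumes fin: "finite B" and db: "\<And>w. fdeg b B w \<le> 1" and B: "card B \<le> 2" and p: "\<And>u. p u \<le> 0"
  shows "\<exists>f. block_labelling 2 a b B p f"
proof -
  obtain f where f: "bij_betw f B {0 + 1..0 + int (card B)}" "inj_on (\<lambda>e. p (a e) + f e) B"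
    using sorted_labelling[OF fin, of 0 "\<lambda>e. p (a e)"] by blast
  have f1: "1 \<le> f e" "f e \<le> int (card B)" if "e \<in> B" for e
    using f(1) that unfolding bij_betw_def by auto
  have "inj_on (\<lambda>u. p u + fsum a B f u) (a ` B)"
  proof (cases "inj_on a B")
    case True
    have s: "fsum a B f (a e) = f e" if "e \<in> B" for e by (rule transversal_fibre(2)[OF True that])
    show ?thesis
    proof (rule inj_onI)
      fix u v assume uv: "u \<in> a ` B" "v \<in> a ` B" "p u + fsum a B f u = p v + fsum a B f v"
      then obtain e e' where e: "e \<in> B" "u = a e" "e' \<in> B" "v = a e'" by blast
      have "e = e'" using uv(3) s[OF e(1)] s[OF e(3)] e inj_onD[OF f(2) _ e(1,3)] by simp
      then show "u = v" using e by simp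
    qed
  next
    case False
    then have "card (a ` B) \<noteq> card B" using eq_card_imp_inj_on[OF fin, of a] by blast
    then have "card (a ` B) \<le> 1" using card_image_le[OF fin, of a] B by simp
    then have "\<forall>x\<in>a ` B. \<forall>y\<in>a ` B. x = y"
      unfolding One_nat_def card_le_Suc0_iff_eq[OF finite_imageI[OF fin]] .
    then show ?thesis by (intro inj_onI) blast
  qed
  moreover have "p u + fsum a B f u < fsum b B f w + int (2 - fdeg b B w) * (int (card B) + 1)" for u w
  proof -
    have "fsum a B f u \<le> sum f B" unfolding fsum_def
      by (rule sum_mono2) (use fin f1 in force)+
    also have "\<dots> = \<Sum>{1..int (card B)}" using sum.reindex_bij_betw[OF f(1), of "\<lambda>x. x"] by simp
    also have "\<dots> \<le> int (card B) + 1"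
    proof -
      have "card B = 0 \<or> card B = 1 \<or> card B = 2" using B by linarith
      moreover have "{1..2::int} = {1, 2}" by auto
      ultimately show ?thesis by auto
    qed
    finally have 1: "p u + fsum a B f u \<le> int (card B) + 1" using p[of u] by simp
    have 2: "int (fdeg b B w) * 1 \<le> fsum b B f w" by (rule fsum_ge[OF fin f1(1)])
    have "fdeg b B w = 0 \<or> fdeg b B w = 1" using db[of w] by linarith
    then show ?thesis using 1 2 by auto
  qed
  ultimately show ?thesis unfolding block_labelling_def using f(1) by auto
qed

text \<open>The second condition on \<open>p\<close> serves even \<open>k\<close>: a vertex with all
  its edges in the block has collected nothing before, which keeps its sum exact.\<close>

lemma block_labelling_exists:
  assumes fin: "finite B" and simple: "inj_on (\<lambda>e. (a e, b e)) B" and k: "2 \<le> k" "k = 2 \<Longrightarrow> card B \<le> 2"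
    and da: "\<And>u. fdeg a B u \<le> k" and db: "\<And>w. fdeg b B w < k"
    and p: "\<And>u. p u \<le> 0" "\<And>u. fdeg a B u = k \<Longrightarrow> p u = 0"
  shows "\<exists>f. block_labelling k a b B p f"
proof (cases "odd k")
  case True
  then obtain h where h: "k = 2 * h + 1" by (rule oddE)
  show ?thesis unfolding h
    by (rule block_odd[OF fin simple _ _ p(1)]) (use da db in \<open>simp_all add: h less_Suc_eq_le\<close>)
next
  case False
  then obtain h' where "k = 2 * h'" by (auto elim: evenE)
  then obtain h where h: "k = 2 * h + 2" using k(1) by (cases h') auto
  show ?thesis
  proof (cases "h = 0")
    case True
    then have "k = 2" using h by simp
    then show ?thesis using block_two[OF fin, of b p a] db k(2) p(1) by (metis One_nat_def Suc_1 less_Suc_eq_le)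
  next
    case False
    have db': "fdeg b B w \<le> 2 * h + 1" for w using db[of w] h by simp
    show ?thesis unfolding h
      by (rule block_even[OF fin simple _ da[unfolded h] db' p[unfolded h]]) (use False in simp)
  qed
qed

subsection \<open>Stages of the labelling\<close>

definition vsum :: "'a set set \<Rightarrow> ('a set \<Rightarrow> int) \<Rightarrow> 'a \<Rightarrow> int" where
  "vsum L f v = sum f (incident_edges L v)"

definition touching :: "'a set set \<Rightarrow> 'a set \<Rightarrow> 'a set set" where
  "touching E P = {e\<in>E. e \<inter> P \<noteq> {}}"

text \<open>The least sum that \<open>v\<close> can still reach if its unlabelled edges receive labels above \<open>card L\<close>.\<close>

definition potential :: "nat \<Rightarrow> 'a set set \<Rightarrow> ('a set \<Rightarrow> int) \<Rightarrow> 'a \<Rightarrow> int" where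
  "potential k L f v = vsum L f v + int (k - card (incident_edges L v)) * (int (card L) + 1)"

text \<open>The invariant passed from layer to layer. The set of labelled edges is not a separate
  parameter: it consists of the edges touching \<open>P\<close>, so finished vertices are fully
  labelled.\<close>

definition stage :: "nat \<Rightarrow> 'a set \<Rightarrow> 'a set set \<Rightarrow> 'a set \<Rightarrow> ('a set \<Rightarrow> int) \<Rightarrow> bool" where
  "stage k V E P f \<longleftrightarrow> P \<subseteq> V \<and> bij_betw f (touching E P) {1..int (card (touching E P))} \<and>
     inj_on (vsum (touching E P) f) P \<and>
     (\<forall>p\<in>P. \<forall>w\<in>V - P. vsum (touching E P) f p < potential k (touching E P) f w)"

lemma vsum_cong: "(\<And>e. e \<in> L \<Longrightarrow> f e = g e) \<Longrightarrow> vsum L f v = vsum L g v"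
  unfolding vsum_def incident_edges_def by (rule sum.cong) auto

lemma incident_Un: "incident_edges (X \<union> Y) v = incident_edges X v \<union> incident_edges Y v"
  unfolding incident_edges_def by auto

lemma finite_incident: "finite X \<Longrightarrow> finite (incident_edges X v)"
  unfolding incident_edges_def by simp

lemma incident_disjoint: "X \<inter> Y = {} \<Longrightarrow> incident_edges X v \<inter> incident_edges Y v = {}"
  unfolding incident_edges_def by auto

lemma vsum_Un: "finite X \<Longrightarrow> finite Y \<Longrightarrow> X \<inter> Y = {} \<Longrightarrow> vsum (X \<union> Y) f v = vsum X f v + vsum Y f v"
  unfolding vsum_def incident_Un by (intro sum.union_disjoint finite_incident incident_disjoint)

lemma card_incident_Un: "finite X \<Longrightarrow> finite Y \<Longrightarrow> X \<inter> Y = {} \<Longrightarrow>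
    card (incident_edges (X \<union> Y) v) = card (incident_edges X v) + card (incident_edges Y v)"
  unfolding incident_Un by (intro card_Un_disjoint finite_incident incident_disjoint)

text \<open>A new label is at least the value that was assumed for it, and the value assumed for the
  labels still missing only grows.\<close>

lemma potential_mono:
  assumes fin: "finite L" "finite N" and disj: "L \<inter> N = {}" and f: "\<And>e. e \<in> L \<Longrightarrow> g e = f e"
    and g: "\<And>e. e \<in> N \<Longrightarrow> int (card L) + 1 \<le> g e" and k: "card (incident_edges (L \<union> N) v) \<le> k"
  shows "potential k L f v \<le> potential k (L \<union> N) g v"
proof -
  let ?c = "int (card L) + 1" and ?c' = "int (card (L \<union> N)) + 1"
  let ?d = "card (incident_edges L v)" and ?n = "card (incident_edges N v)"
  have c: "?c \<le> ?c'" using fin by (simp add: card_mono)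
  have dn: "card (incident_edges (L \<union> N) v) = ?d + ?n" by (rule card_incident_Un[OF fin disj])
  have "vsum L g v = vsum L f v" by (rule vsum_cong) (rule f)
  then have "vsum (L \<union> N) g v = vsum L f v + vsum N g v" using vsum_Un[OF fin disj] by simp
  moreover have "int ?n * ?c \<le> vsum N g v" unfolding vsum_def
    by (rule sum_bounded_below) (auto simp: incident_edges_def intro: g)
  moreover have "int (k - ?d) = int ?n + int (k - (?d + ?n))" using k dn by simp
  then have "int (k - ?d) * ?c = int ?n * ?c + int (k - (?d + ?n)) * ?c" by (simp add: distrib_right)
  moreover have "int (k - (?d + ?n)) * ?c \<le> int (k - (?d + ?n)) * ?c'" using c by (intro mult_left_mono) auto
  ultimately show ?thesis unfolding potential_def dn by linarith
qed

lemma touching_full: "p \<in> P \<Longrightarrow> incident_edges (touching E P) p = incident_edges E p"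
  unfolding incident_edges_def touching_def by auto

text \<open>Sums on \<open>P\<close> no longer change, potentials never fall, and at a fully
  labelled vertex the potential is the sum. So the new vertices lie above the old ones automatically
  and need comparison only among themselves and with the outside.\<close>

lemma stage_extend:
  assumes st: "stage k V E P f" and fin: "finite E" and reg: "regular_graph k V E"
    and U: "U \<subseteq> V" "U \<inter> P = {}"
    and eq: "touching E (P \<union> U) = touching E P \<union> N" "touching E P \<inter> N = {}"
    and f: "\<And>e. e \<in> touching E P \<Longrightarrow> g e = f e"
    and g: "bij_betw g N {int (card (touching E P)) + 1..int (card (touching E (P \<union> U)))}"
    and inj: "inj_on (vsum (touching E (P \<union> U)) g) U"
    and lt: "\<And>u w. u \<in> U \<Longrightarrow> w \<in> V - (P \<union> U) \<Longrightarrow>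
      vsum (touching E (P \<union> U)) g u < potential k (touching E (P \<union> U)) g w"
  shows "stage k V E (P \<union> U) g"
proof -
  define L L' where "L = touching E P" and "L' = touching E (P \<union> U)"
  note defs = L_def[symmetric] L'_def[symmetric]
  note st = st[unfolded stage_def defs] and eq = eq[unfolded defs] and f = f[unfolded defs]
    and g = g[unfolded defs] and inj = inj[unfolded defs] and lt = lt[unfolded defs]
  have fL: "finite L" "finite L'" "L' \<subseteq> E" using fin unfolding L_def L'_def touching_def by auto
  then have fN: "finite N" using eq(1) by simp
  have PV: "P \<subseteq> V" using st by blast
  have mono: "potential k L f v \<le> potential k L' g v" if "v \<in> V" for v
  proof (unfold eq(1), rule potential_mono[OF fL(1) fN eq(2) f])
    show "int (card L) + 1 \<le> g e" if "e \<in> N" for e using g that unfolding bij_betw_def by auto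
    have "card (incident_edges L' v) \<le> card (incident_edges E v)"
      using fL(3) fin by (intro card_mono) (auto simp: incident_edges_def)
    then show "card (incident_edges (L \<union> N) v) \<le> k" using reg that unfolding eq(1) regular_graph_def by simp
  qed
  have full: "potential k L' g u = vsum L' g u" if "u \<in> U" for u
    using touching_full[of u "P \<union> U" E] that reg U(1)
    unfolding potential_def L'_def regular_graph_def by auto
  have old: "vsum L' g p = vsum L f p" if "p \<in> P" for p
  proof -
    have "incident_edges L' p = incident_edges L p"
      using touching_full[of p P E] touching_full[of p "P \<union> U" E] that unfolding L_def L'_def by simp
    moreover have "vsum L g p = vsum L f p" by (rule vsum_cong) (rule f)
    ultimately show ?thesis unfolding vsum_def by simp
  qed
  have below: "vsum L' g p < vsum L' g u" if "p \<in> P" "u \<in> U" for p u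
  proof -
    have u: "u \<in> V - P" using that U by blast
    then have "vsum L f p < potential k L f u" using st that(1) by blast
    also have "\<dots> \<le> potential k L' g u" using mono u by blast
    finally show ?thesis using full old that by simp
  qed
  have injP: "inj_on (vsum L' g) P" using st old unfolding inj_on_def by simp
  have injPU: "inj_on (vsum L' g) (P \<union> U)"
  proof (rule inj_onI)
    fix x y assume x: "x \<in> P \<union> U" and y: "y \<in> P \<union> U" and s: "vsum L' g x = vsum L' g y"
    consider "x \<in> P" "y \<in> P" | "x \<in> U" "y \<in> U" | "x \<in> P" "y \<in> U" | "y \<in> P" "x \<in> U" using x y by blast
    then show "x = y"
    proof cases
      case 1
      then show ?thesis using inj_onD[OF injP s] by blast
    next
      case 2
      then show ?thesis using inj_onD[OF inj s] by blast
    qed (use below s in force)+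
  qed
  have "bij_betw g L {1..int (card L)}" using st bij_betw_cong[of L g f] f by simp
  moreover have "card L \<le> card L'" using fL eq(1) by (intro card_mono) auto
  ultimately have "bij_betw g (L \<union> N) ({1..int (card L)} \<union> {int (card L) + 1..int (card L')})"
    by (intro bij_betw_combine g) auto
  moreover have "{1..int (card L)} \<union> {int (card L) + 1..int (card L')} = {1..int (card L')}"
    using \<open>card L \<le> card L'\<close> by auto
  ultimately have "bij_betw g L' {1..int (card L')}" using eq(1) by simp
  moreover have "vsum L' g p < potential k L' g w" if "p \<in> P \<union> U" "w \<in> V - (P \<union> U)" for p w
  proof (cases "p \<in> U")
    case False
    then have p: "p \<in> P" using that by blast
    have "vsum L f p < potential k L f w" using st that p by blast
    also have "\<dots> \<le> potential k L' g w" using mono that by blast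
    finally show ?thesis using old p by simp
  qed (use lt that in blast)
  ultimately show ?thesis unfolding stage_def defs using PV U(1) injPU by blast
qed

section \<open>Finishing one layer, or the root with its neighbours\<close>

lemma extend_labelling:
  assumes "finite L" "finite I" "L \<inter> I = {}" "bij_betw f L {1..int (card L)}"
  obtains g where "\<And>e. e \<in> L \<Longrightarrow> g e = f e" "bij_betw g (L \<union> I) {1..int (card (L \<union> I))}"
    "bij_betw g I {int (card L) + 1..int (card (L \<union> I))}"
proof -
  obtain h where h: "bij_betw h I {int (card L) + 1..int (card L) + int (card I)}"
    using sorted_labelling[OF assms(2), of "int (card L)" "\<lambda>_. 0"] by blast
  have c: "int (card (L \<union> I)) = int (card L) + int (card I)" using assms by (simp add: card_Un_disjoint)
  define g where "g = (\<lambda>e. if e \<in> L then f e else h e)"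
  have "bij_betw g (L \<union> I) {1..int (card (L \<union> I))}"
    using bij_betw_glue[of f L 0 "int (card L)" h I "int (card (L \<union> I))"] assms h c unfolding g_def by simp
  moreover have "g e = h e" if "e \<in> I" for e using that assms(3) unfolding g_def by auto
  then have "bij_betw g I {int (card L) + 1..int (card (L \<union> I))}" using h c bij_betw_cong[of I g h] by simp
  moreover have "g e = f e" if "e \<in> L" for e using that unfolding g_def by simp
  ultimately show ?thesis using that by blast
qed

lemma vsum_le:
  assumes "bij_betw f R {1..int c}"
  shows "vsum R f u \<le> int (card (incident_edges R u)) * int c"
  unfolding vsum_def
proof (rule sum_bounded_above)
  fix e assume "e \<in> incident_edges R u"
  then have "e \<in> R" unfolding incident_edges_def by simp
  then show "f e \<le> int c" using assms unfolding bij_betw_def by auto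
qed

lemma finite_edges: "simple_graph V E \<Longrightarrow> finite E"
  unfolding simple_graph_def by (meson PowI finite_Pow_iff finite_subset subsetI)

lemma edge_endpoints:
  assumes "simple_graph V E" "e \<in> E" "x \<in> e"
  obtains y where "e = {x, y}" "x \<noteq> y" "x \<in> V" "y \<in> V"
proof -
  obtain y z where "e = {y, z}" "y \<noteq> z" using assms unfolding simple_graph_def by (meson card_2_iff)
  moreover have "e \<subseteq> V" using assms unfolding simple_graph_def by blast
  ultimately show ?thesis using assms(3) that[of z] that[of y] by auto
qed

text \<open>\<open>onward\<close> keeps every vertex facing \<open>U\<close> below \<open>k\<close>
  block edges, \<open>up\<close> makes all of \<open>U\<close> take part in the block, and by
  \<open>sep\<close> the vertices beyond \<open>U\<close> have no labelled edge outside the block,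
  so that their potentials depend on the block alone.\<close>

lemma block_step:
  assumes gr: "simple_graph V E" and reg: "regular_graph k V E" and k: "2 \<le> k"
    and st: "stage k V E P f" and U: "U \<subseteq> V" "U \<inter> P = {}"
    and sep: "\<And>x y. {x, y} \<in> E \<Longrightarrow> x \<in> P \<Longrightarrow> y \<in> P \<union> U"
    and up: "\<And>u. u \<in> U \<Longrightarrow> \<exists>w. w \<notin> P \<union> U \<and> {u, w} \<in> E"
    and onward: "\<And>u w. u \<in> U \<Longrightarrow> w \<notin> P \<union> U \<Longrightarrow> {u, w} \<in> E \<Longrightarrow> \<exists>x. x \<notin> U \<and> {w, x} \<in> E"
    and cut: "k = 2 \<Longrightarrow> card {e \<in> E. e \<inter> U \<noteq> {} \<and> \<not> e \<subseteq> P \<union> U} \<le> 2"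
  shows "\<exists>g. stage k V E (P \<union> U) g"
proof -
  define L L' B where "L = touching E P" and "L' = touching E (P \<union> U)"
    and "B = {e \<in> E. e \<inter> U \<noteq> {} \<and> \<not> e \<subseteq> P \<union> U}"
  \<comment> \<open>These are the edges inside \<open>U\<close>. They may be labelled in any order,
    since the block is then labelled according to the resulting sums.\<close>
  define I where "I = L' - L - B"
  define R where "R = L \<union> I"
  define a b where "a e = the_elem (e \<inter> U)" and "b e = the_elem (e - U)" for e
  have finE: "finite E" by (rule finite_edges[OF gr])
  have ab: "a e \<in> U \<and> b e \<in> V \<and> b e \<notin> P \<union> U \<and> e = {a e, b e}" if e: "e \<in> B" for e
  proof -
    obtain u where u: "u \<in> e" "u \<in> U" "e \<in> E" using e unfolding B_def by blast
    obtain w where w: "e = {u, w}" "u \<noteq> w" "w \<in> V" by (rule edge_endpoints[OF gr u(3,1)])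
    then have "w \<notin> P \<union> U" using e u unfolding B_def by auto
    moreover from this have "e \<inter> U = {u}" "e - U = {w}" using w u by auto
    ultimately show ?thesis unfolding a_def b_def using w u by simp
  qed
  have BE: "B \<subseteq> E" "finite B" unfolding B_def using finE by auto
  have LE: "L \<subseteq> L'" "L' \<subseteq> E" "B \<subseteq> L'" "L \<inter> B = {}"
  proof -
    show "L \<subseteq> L'" "L' \<subseteq> E" "B \<subseteq> L'" unfolding L_def L'_def touching_def B_def by auto
    show "L \<inter> B = {}"
    proof (rule equals0I)
      fix e assume e: "e \<in> L \<inter> B"
      then have "e = {a e, b e}" "a e \<notin> P" "b e \<notin> P" using ab[of e] U(2) by auto
      then have "e \<inter> P = {}" by (metis Int_insert_left_if0 inf_bot_left)
      then show False using e unfolding L_def touching_def by blast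
    qed
  qed
  have "finite L'" using LE(2) finE by (rule finite_subset)
  moreover from LE(1) this have "finite L" by (rule finite_subset)
  ultimately have fins: "finite L" "finite I" "finite R" "finite L'" unfolding R_def I_def by simp_all
  have parts: "L \<inter> I = {}" "R \<inter> B = {}" "L' = R \<union> B" "I \<inter> B = {}" "L \<inter> (I \<union> B) = {}" "L' = L \<union> (I \<union> B)"
    using LE unfolding I_def R_def by auto
  have fa: "{e \<in> B. a e = u} = incident_edges B u" if "u \<in> U" for u
    unfolding incident_edges_def using ab that by (metis (lifting) Un_iff insert_iff singletonD)
  have fb: "{e \<in> B. b e = w} = incident_edges B w" if "w \<notin> U" for w
    unfolding incident_edges_def using ab that by (metis (lifting) Un_iff insert_iff singletonD)
  have deg: "card (incident_edges E v) = k" if "v \<in> V" for v using reg that unfolding regular_graph_def by blast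
  have incB: "incident_edges B v \<subseteq> incident_edges E v" for v using BE unfolding incident_edges_def by auto
  have finv: "finite (incident_edges E v)" for v using finE by (rule finite_incident)
  have da: "fdeg a B u \<le> k" for u
  proof (cases "u \<in> U")
    case True
    then show ?thesis using card_mono[OF finv incB, of u] deg[of u] U(1) fa[of u] unfolding fdeg_def by auto
  next
    case False
    then have "u \<notin> a ` B" using ab by blast
    then show ?thesis using fibre_empty(1)[of u a B] by simp
  qed
  have db: "fdeg b B w < k" for w
  proof (cases "w \<in> b ` B")
    case True
    then obtain e where e: "e \<in> B" "w = b e" by blast
    then have w: "a e \<in> U" "w \<in> V" "w \<notin> P \<union> U" "{a e, w} \<in> E" using ab[of e] BE by auto
    then obtain x where x: "x \<notin> U" "{w, x} \<in> E" using onward by blast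
    then have "{w, x} \<notin> B" "{w, x} \<in> incident_edges E w" using w(3) unfolding B_def incident_edges_def by auto
    then have "incident_edges B w \<subset> incident_edges E w" using incB[of w] unfolding incident_edges_def by blast
    then have "card (incident_edges B w) < k" using psubset_card_mono[OF finv] deg[OF w(2)] by metis
    then show ?thesis using fb[of w] w(3) unfolding fdeg_def by simp
  next
    case False
    then show ?thesis using fibre_empty(1)[OF False] k by simp
  qed
  obtain g0 where g0: "\<And>e. e \<in> L \<Longrightarrow> g0 e = f e" "bij_betw g0 R {1..int (card R)}"
    "bij_betw g0 I {int (card L) + 1..int (card R)}"
    by (rule extend_labelling[OF fins(1,2) parts(1), of f, folded R_def])
      (use st in \<open>auto simp: stage_def L_def\<close>)
  have degU: "card (incident_edges R u) + fdeg a B u = k" if "u \<in> U" for u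
  proof -
    have "incident_edges L' u = incident_edges E u" unfolding L'_def using that by (intro touching_full) simp
    then show ?thesis using card_incident_Un[OF fins(3) BE(2) parts(2), of u] deg[of u] U(1) that fa[OF that]
      unfolding parts(3) fdeg_def by auto
  qed
  \<comment> \<open>\<open>c\<close> is also the largest label used so far; the block is labelled
    from 1 and then shifted by \<open>c\<close>. Each of the \<open>k - fdeg a B u\<close> edges at
    \<open>u\<close> outside the block carries at most \<open>c\<close>, so \<open>p u\<close> is
    never positive.\<close>
  define c where "c = int (card R)"
  define p where "p u = (if u \<in> U then vsum R g0 u - int (k - fdeg a B u) * c else 0)" for u
  have kd: "k - fdeg a B u = card (incident_edges R u)" if "u \<in> U" for u using degU[OF that] by simp
  have p0: "p u \<le> 0" for u using vsum_le[OF g0(2), of u] kd unfolding p_def c_def by simp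
  have p1: "p u = 0" if "fdeg a B u = k" for u
  proof (cases "u \<in> U")
    case True
    then have "card (incident_edges R u) = 0" using kd[OF True] that by simp
    then have "incident_edges R u = {}" using finite_incident[OF fins(3), of u] by simp
    then show ?thesis using that unfolding p_def vsum_def by simp
  qed (simp add: p_def)
  have simple: "inj_on (\<lambda>e. (a e, b e)) B"
    by (rule inj_onI) (metis ab prod.inject)
  obtain F where F: "block_labelling k a b B p F"
    using block_labelling_exists[where p = p, OF BE(2) simple k cut[folded B_def] da db p0 p1] by blast
  have aB: "a ` B = U"
  proof
    show "a ` B \<subseteq> U" using ab by blast
    show "U \<subseteq> a ` B"
    proof
      fix u assume u: "u \<in> U"
      then obtain w where "w \<notin> P \<union> U" "{u, w} \<in> E" using up by blast
      then have "{u, w} \<in> incident_edges B u" using u unfolding B_def incident_edges_def by blast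
      then have "{u, w} \<in> {e \<in> B. a e = u}" unfolding fa[OF u] .
      then show "u \<in> a ` B" by (intro image_eqI[of u a "{u, w}"]) simp_all
    qed
  qed
  define g where "g = (\<lambda>e. if e \<in> R then g0 e else c + F e)"
  have gR: "g e = g0 e" if "e \<in> R" for e using that unfolding g_def by simp
  have gB: "g e = c + F e" if "e \<in> B" for e using that parts(2) unfolding g_def by auto
  have cL': "int (card L') = c + int (card B)" unfolding parts(3) c_def using fins BE parts(2) by (simp add: card_Un_disjoint)
  have vR: "vsum R g v = vsum R g0 v" for v by (rule vsum_cong) (rule gR)
  have split: "vsum L' g v = vsum R g0 v + vsum B g v" for v
    unfolding parts(3) using vsum_Un[OF fins(3) BE(2) parts(2)] vR by simp
  have vB: "vsum B g v = int (card (incident_edges B v)) * c + sum F (incident_edges B v)" for v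
  proof -
    have "vsum B g v = (\<Sum>e\<in>incident_edges B v. c + F e)" unfolding vsum_def
      by (rule sum.cong) (auto simp: incident_edges_def intro: gB)
    then show ?thesis by (simp add: sum.distrib)
  qed
  \<comment> \<open>Sums and potentials are both measured from the level \<open>k * c\<close>; this
    cancels, and exactly the inequality of the block labelling remains.\<close>
  have sU: "vsum L' g u = int k * c + (p u + fsum a B F u)" if "u \<in> U" for u
  proof -
    have "int k = int (k - fdeg a B u) + int (fdeg a B u)" using da[of u] by simp
    then have "int k * c = int (k - fdeg a B u) * c + int (fdeg a B u) * c" by (simp only: distrib_right)
    moreover have "vsum B g u = int (fdeg a B u) * c + fsum a B F u"
      unfolding vB fsum_def fdeg_def fa[OF that] by (rule refl)
    ultimately show ?thesis unfolding split p_def if_P[OF that] by linarith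
  qed
  have pW: "potential k L' g w = int k * c + (fsum b B F w + int (k - fdeg b B w) * (int (card B) + 1))"
    if w: "w \<in> V - (P \<union> U)" for w
  proof -
    have "incident_edges R w = {}"
    proof (rule equals0I)
      fix e assume "e \<in> incident_edges R w"
      then have e: "e \<in> R" "w \<in> e" "e \<in> E" "e \<in> L'" using parts(3) LE(2) unfolding incident_edges_def by auto
      obtain x where x: "e = {w, x}" by (rule edge_endpoints[OF gr e(3,2)])
      have xw: "{x, w} \<in> E" using e(3) unfolding x by (simp add: insert_commute)
      have "x \<in> P \<union> U" using e(4) w unfolding x L'_def touching_def by auto
      moreover have "x \<notin> P" using sep[OF xw] w by blast
      ultimately have "e \<in> B" using e(3) w unfolding x B_def by auto
      then show False using e(1) parts(2) by blast
    qed
    then have d: "card (incident_edges L' w) = fdeg b B w" "vsum R g0 w = 0"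
      using card_incident_Un[OF fins(3) BE(2) parts(2), of w] fb[of w] w unfolding parts(3) fdeg_def vsum_def by simp_all
    have "int k = int (fdeg b B w) + int (k - fdeg b B w)" using db[of w] by simp
    then have "int k * c = int (fdeg b B w) * c + int (k - fdeg b B w) * c" by (simp only: distrib_right)
    moreover have "vsum B g w = int (fdeg b B w) * c + fsum b B F w"
      using w unfolding vB fsum_def fdeg_def by (simp add: fb)
    ultimately show ?thesis unfolding potential_def d split cL' by (simp add: distrib_left)
  qed
  have "stage k V E (P \<union> U) g"
  proof (rule stage_extend[OF st finE reg U, of "I \<union> B"])
    show "touching E (P \<union> U) = touching E P \<union> (I \<union> B)" "touching E P \<inter> (I \<union> B) = {}"
      using parts(5,6) unfolding L_def L'_def by simp_all
    show "g e = f e" if "e \<in> touching E P" for e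
      using that gR[of e] g0(1)[of e] unfolding R_def L_def by simp
    show "bij_betw g (I \<union> B) {int (card (touching E P)) + 1..int (card (touching E (P \<union> U)))}"
    proof -
      have le: "int (card L) \<le> c" using card_mono[OF fins(3), of L] unfolding c_def R_def by simp
      have FB: "bij_betw F B {1..int (card B)}" using F unfolding block_labelling_def by blast
      have "bij_betw (\<lambda>x. c + x) {1..int (card B)} {c + 1..c + int (card B)}"
        by (rule bij_betw_byWitness[where f' = "\<lambda>x. x - c"]) auto
      from bij_betw_trans[OF FB this] have "bij_betw (\<lambda>e. c + F e) B {c + 1..c + int (card B)}"
        unfolding comp_def .
      then have "bij_betw (\<lambda>e. if e \<in> I then g0 e else c + F e) (I \<union> B) {int (card L) + 1..c + int (card B)}"
        by (intro bij_betw_glue[OF g0(3)[folded c_def] _ parts(4) le]) simp_all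
      moreover have "g e = (if e \<in> I then g0 e else c + F e)" if "e \<in> I \<union> B" for e
        using that gR[of e] gB[of e] unfolding R_def by auto
      then have "bij_betw g (I \<union> B) X = bij_betw (\<lambda>e. if e \<in> I then g0 e else c + F e) (I \<union> B) X" for X
        by (rule bij_betw_cong)
      ultimately show ?thesis unfolding L_def[symmetric] L'_def[symmetric] cL' by blast
    qed
    show "inj_on (vsum (touching E (P \<union> U)) g) U"
    proof (rule inj_onI)
      fix u v assume uv: "u \<in> U" "v \<in> U" "vsum (touching E (P \<union> U)) g u = vsum (touching E (P \<union> U)) g v"
      have inj: "inj_on (\<lambda>u. p u + fsum a B F u) U" using F unfolding block_labelling_def aB by blast
      have "p u + fsum a B F u = p v + fsum a B F v" using uv(3) sU[OF uv(1)] sU[OF uv(2)] unfolding L'_def by simp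
      from inj_onD[OF inj this uv(1,2)] show "u = v" .
    qed
    show "vsum (touching E (P \<union> U)) g u < potential k (touching E (P \<union> U)) g w"
      if "u \<in> U" "w \<in> V - (P \<union> U)" for u w
    proof -
      have "p u + fsum a B F u < fsum b B F w + int (k - fdeg b B w) * (int (card B) + 1)"
        using F that(1) unfolding block_labelling_def aB by blast
      then show ?thesis unfolding L'_def[symmetric] sU[OF that(1)] pW[OF that(2)] by simp
    qed
  qed
  then show ?thesis by blast
qed

text \<open>The root of a component comes last: its edges carry the \<open>k\<close> largest labels.\<close>

lemma star_step:
  assumes gr: "simple_graph V E" and reg: "regular_graph k V E" and k: "2 \<le> k"
    and st: "stage k V E P f" and r: "r \<in> V" and N: "N = {x. {r, x} \<in> E}" and disj: "insert r N \<inter> P = {}"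
    and sep: "\<And>x y. {x, y} \<in> E \<Longrightarrow> x \<in> P \<Longrightarrow> y \<in> P \<union> N"
    and closed: "\<And>x y. {x, y} \<in> E \<Longrightarrow> x \<in> N \<Longrightarrow> y \<in> P \<union> insert r N"
  shows "\<exists>g. stage k V E (P \<union> insert r N) g"
proof -
  define L L' B where "L = touching E P" and "L' = touching E (P \<union> insert r N)" and "B = incident_edges E r"
  define I where "I = L' - L - B"
  define R where "R = L \<union> I"
  have finE: "finite E" by (rule finite_edges[OF gr])
  have deg: "card (incident_edges E v) = k" if "v \<in> V" for v using reg that unfolding regular_graph_def by blast
  have star: "\<exists>x\<in>N. e = {r, x} \<and> x \<noteq> r" if "e \<in> B" for e
  proof -
    have e: "e \<in> E" "r \<in> e" using that unfolding B_def incident_edges_def by auto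
    obtain y where "e = {r, y}" "r \<noteq> y" by (rule edge_endpoints[OF gr e])
    then show ?thesis using e unfolding N by auto
  qed
  have N1: "x \<in> V \<and> x \<noteq> r \<and> {r, x} \<in> B" if "x \<in> N" for x
  proof -
    have e: "{r, x} \<in> E" "x \<in> {r, x}" "r \<in> {r, x}" using that unfolding N by auto
    moreover obtain y where "{r, x} = {x, y}" "x \<noteq> y" "x \<in> V" by (rule edge_endpoints[OF gr e(1,2)])
    ultimately have "x \<in> V" "x \<noteq> r" by auto
    then show ?thesis using e unfolding B_def incident_edges_def by simp
  qed
  have LE: "L \<subseteq> L'" "L' \<subseteq> E" "B \<subseteq> L'" "L \<inter> B = {}"
  proof -
    show "L \<subseteq> L'" "L' \<subseteq> E" "B \<subseteq> L'" unfolding L_def L'_def touching_def B_def incident_edges_def by auto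
    show "L \<inter> B = {}"
    proof (rule equals0I)
      fix e assume e: "e \<in> L \<inter> B"
      then obtain x where "x \<in> N" "e = {r, x}" using star by blast
      then have "e \<inter> P = {}" using disj by auto
      then show False using e unfolding L_def touching_def by blast
    qed
  qed
  have "finite L'" using LE(2) finE by (rule finite_subset)
  moreover from LE(1) this have "finite L" by (rule finite_subset)
  moreover have "finite B" using LE(3) \<open>finite L'\<close> by (rule finite_subset)
  ultimately have fins: "finite L" "finite I" "finite R" "finite L'" "finite B" unfolding R_def I_def by simp_all
  have parts: "L \<inter> I = {}" "R \<inter> B = {}" "L' = R \<union> B" "I \<inter> B = {}" "L \<inter> (I \<union> B) = {}" "L' = L \<union> (I \<union> B)"
    using LE unfolding I_def R_def by auto
  obtain g0 where g0: "\<And>e. e \<in> L \<Longrightarrow> g0 e = f e" "bij_betw g0 R {1..int (card R)}"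
    "bij_betw g0 I {int (card L) + 1..int (card R)}"
    by (rule extend_labelling[OF fins(1,2) parts(1), of f, folded R_def])
      (use st in \<open>auto simp: stage_def L_def\<close>)
  define c where "c = int (card R)"
  define other where "other e = the_elem (e - {r})" for e
  have other: "other {r, x} = x" if "x \<noteq> r" for x using that unfolding other_def by (simp add: insert_Diff_if)
  have cB: "card B = k" unfolding B_def by (rule deg[OF r])
  \<comment> \<open>Each neighbour of the root has exactly one edge in the star, so ordering the
    star by the sums collected at the neighbours separates them.\<close>
  obtain h where h: "bij_betw h B {c + 1..c + int k}" "inj_on (\<lambda>e. vsum R g0 (other e) + h e) B"
    using sorted_labelling[OF fins(5), of c "\<lambda>e. vsum R g0 (other e)"] unfolding cB by blast
  have hr: "c + 1 \<le> h e" "h e \<le> c + int k" if "e \<in> B" for e using h(1) that unfolding bij_betw_def by auto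
  define g where "g = (\<lambda>e. if e \<in> R then g0 e else h e)"
  have gR: "g e = g0 e" if "e \<in> R" for e using that unfolding g_def by simp
  have gB: "g e = h e" if "e \<in> B" for e using that parts(2) unfolding g_def by auto
  have cL': "int (card L') = c + int k" unfolding parts(3) c_def using fins parts(2) cB by (simp add: card_Un_disjoint)
  have vR: "vsum R g v = vsum R g0 v" for v by (rule vsum_cong) (rule gR)
  have vB: "vsum B g v = vsum B h v" for v by (rule vsum_cong) (rule gB)
  have split: "vsum L' g v = vsum R g0 v + vsum B h v" for v
    unfolding parts(3) using vsum_Un[OF fins(3,5) parts(2)] vR vB by simp
  have sN: "vsum L' g x = vsum R g0 x + h {r, x}" if x: "x \<in> N" for x
  proof -
    have "incident_edges B x = {{r, x}}"
    proof
      show "{{r, x}} \<subseteq> incident_edges B x" using N1[OF x] unfolding incident_edges_def by simp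
      show "incident_edges B x \<subseteq> {{r, x}}"
      proof
        fix e assume "e \<in> incident_edges B x"
        then have "e \<in> B" "x \<in> e" unfolding incident_edges_def by auto
        moreover obtain y where "e = {r, y}" using star[OF \<open>e \<in> B\<close>] by blast
        ultimately show "e \<in> {{r, x}}" using N1[OF x] by auto
      qed
    qed
    then have "vsum B h x = h {r, x}" unfolding vsum_def by simp
    then show ?thesis unfolding split by simp
  qed
  have leN: "vsum L' g x \<le> int k * c + int k" if x: "x \<in> N" for x
  proof -
    have "incident_edges L' x = incident_edges E x" unfolding L'_def using x by (intro touching_full) simp
    then have "card (incident_edges R x) + card (incident_edges B x) = k"
      using card_incident_Un[OF fins(3,5) parts(2), of x] deg N1[OF x] unfolding parts(3) by simp
    moreover have "{r, x} \<in> incident_edges B x" using N1[OF x] unfolding incident_edges_def by simp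
    then have "card (incident_edges B x) \<noteq> 0" using finite_incident[OF fins(5)] by auto
    ultimately have "int (card (incident_edges R x)) + 1 \<le> int k" by linarith
    then have "(int (card (incident_edges R x)) + 1) * c \<le> int k * c" by (rule mult_right_mono) (simp add: c_def)
    then show ?thesis using vsum_le[OF g0(2), of x] hr[of "{r, x}"] N1[OF x] sN[OF x]
      unfolding c_def by (simp add: distrib_right)
  qed
  have vr: "vsum L' g r = sum h B"
  proof -
    have "incident_edges R r = {}" using parts(2,3) LE(2) unfolding incident_edges_def B_def by blast
    moreover have "incident_edges B r = B" unfolding incident_edges_def B_def by auto
    ultimately have "vsum R g0 r = 0" "vsum B h r = sum h B" unfolding vsum_def by simp_all
    then show ?thesis unfolding split by simp
  qed
  \<comment> \<open>One label is \<open>c + k\<close> and the other \<open>k - 1\<close> are at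
    least \<open>c + 1\<close>, in total at least \<open>k * c + 2 * k - 1\<close>. This exceeds the
    bound for the neighbours because \<open>k \<ge> 2\<close>.\<close>
  have big: "int k * c + int k < vsum L' g r"
  proof -
    have "c + int k \<in> h ` B" using h(1) k unfolding bij_betw_def by simp
    then obtain e where e: "e \<in> B" "h e = c + int k" by (metis imageE)
    have "int (card (B - {e})) * (c + 1) \<le> sum h (B - {e})" by (rule sum_bounded_below) (use hr in auto)
    moreover have "int (card (B - {e})) = int k - 1" using e fins(5) cB k by simp
    moreover have "sum h B = h e + sum h (B - {e})" by (rule sum.remove[OF fins(5) e(1)])
    ultimately show ?thesis unfolding vr using e(2) k by (simp add: algebra_simps)
  qed
  have "stage k V E (P \<union> insert r N) g"
  proof (rule stage_extend[OF st finE reg _ disj, of "I \<union> B"])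
    show "insert r N \<subseteq> V" using r N1 by blast
    show "touching E (P \<union> insert r N) = touching E P \<union> (I \<union> B)" "touching E P \<inter> (I \<union> B) = {}"
      using parts(5,6) unfolding L_def L'_def by simp_all
    show "g e = f e" if "e \<in> touching E P" for e
      using that gR[of e] g0(1)[of e] unfolding R_def L_def by simp
    show "bij_betw g (I \<union> B) {int (card (touching E P)) + 1..int (card (touching E (P \<union> insert r N)))}"
    proof -
      have le: "int (card L) \<le> c" using card_mono[OF fins(3), of L] unfolding c_def R_def by simp
      have "bij_betw (\<lambda>e. if e \<in> I then g0 e else h e) (I \<union> B) {int (card L) + 1..c + int k}"
        by (rule bij_betw_glue[OF g0(3)[folded c_def] h(1) parts(4) le]) simp
      moreover have "g e = (if e \<in> I then g0 e else h e)" if "e \<in> I \<union> B" for e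
        using that gR[of e] gB[of e] unfolding R_def by auto
      then have "bij_betw g (I \<union> B) X = bij_betw (\<lambda>e. if e \<in> I then g0 e else h e) (I \<union> B) X" for X
        by (rule bij_betw_cong)
      ultimately show ?thesis unfolding L_def[symmetric] L'_def[symmetric] cL' by blast
    qed
    show "inj_on (vsum (touching E (P \<union> insert r N)) g) (insert r N)"
    proof (rule inj_onI)
      fix u v assume uv: "u \<in> insert r N" "v \<in> insert r N"
        "vsum (touching E (P \<union> insert r N)) g u = vsum (touching E (P \<union> insert r N)) g v"
      note eq = uv(3)[folded L'_def]
      consider "u = v" | "u = r" "v \<in> N" | "u \<in> N" "v = r" | "u \<in> N" "v \<in> N" using uv(1,2) by blast
      then show "u = v"
      proof cases
        case 2
        then show ?thesis using eq big leN[of v] by simp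
      next
        case 3
        then show ?thesis using eq big leN[of u] by simp
      next
        case 4
        have o: "other {r, u} = u" "other {r, v} = v" using other N1 4 by blast+
        have "vsum R g0 (other {r, u}) + h {r, u} = vsum R g0 (other {r, v}) + h {r, v}"
          using eq sN[OF 4(1)] sN[OF 4(2)] o by simp
        then have "{r, u} = {r, v}" using inj_onD[OF h(2)] N1 4 by blast
        then show ?thesis by (auto simp: doubleton_eq_iff)
      qed
    qed
    show "vsum (touching E (P \<union> insert r N)) g u < potential k (touching E (P \<union> insert r N)) g w"
      if uw: "u \<in> insert r N" "w \<in> V - (P \<union> insert r N)" for u w
    proof -
      have "incident_edges L' w = {}"
      proof (rule equals0I)
        fix e assume "e \<in> incident_edges L' w"
        then have e: "e \<in> L'" "w \<in> e" "e \<in> E" using LE(2) unfolding incident_edges_def by auto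
        obtain x where x: "e = {w, x}" by (rule edge_endpoints[OF gr e(3,2)])
        have xw: "{x, w} \<in> E" using e(3) unfolding x by (simp add: insert_commute)
        have "x \<in> P \<union> insert r N" using e(1) uw(2) unfolding x L'_def touching_def by auto
        then show False using sep[OF xw] closed[OF xw] xw uw(2) N by blast
      qed
      then have pot: "potential k L' g w = int k * (c + int k + 1)" unfolding potential_def vsum_def cL' by simp
      have u: "u \<in> V" using uw(1) r N1 by blast
      have "incident_edges L' u = incident_edges E u" unfolding L'_def using uw(1) by (intro touching_full) blast
      then have ku: "card (incident_edges L' u) = k" using deg[OF u] by simp
      have "vsum L' g u \<le> int (card (incident_edges L' u)) * (c + int k)" unfolding vsum_def
      proof (rule sum_bounded_above)
        fix e assume "e \<in> incident_edges L' u"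
        then have "e \<in> R \<or> e \<in> B" unfolding parts(3) incident_edges_def by auto
        then show "g e \<le> c + int k"
        proof
          assume "e \<in> R"
          then have "g0 e \<in> {1..c}" using g0(2) unfolding bij_betw_def c_def by blast
          then show ?thesis using gR[OF \<open>e \<in> R\<close>] by simp
        qed (use gB hr in auto)
      qed
      also have "\<dots> < int k * (c + int k + 1)" unfolding ku using k by simp
      finally show ?thesis unfolding L'_def[symmetric] pot .
    qed
  qed
  then show ?thesis by blast
qed

subsection \<open>Layers around a root\<close>

text \<open>The ball of radius \<open>i\<close> around \<open>r\<close>; the layers are the
  differences of consecutive balls.\<close>

definition reach :: "'a set set \<Rightarrow> 'a \<Rightarrow> nat \<Rightarrow> 'a set" where
  "reach E r i = ((\<lambda>X. X \<union> {y. \<exists>x\<in>X. {x, y} \<in> E}) ^^ i) {r}"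

lemma reach_0: "reach E r 0 = {r}"
  unfolding reach_def by simp

lemma reach_Suc: "reach E r (Suc i) = reach E r i \<union> {y. \<exists>x\<in>reach E r i. {x, y} \<in> E}"
  unfolding reach_def by simp

lemma reach_mono: "i \<le> j \<Longrightarrow> reach E r i \<subseteq> reach E r j"
  by (rule lift_Suc_mono_le) (auto simp: reach_Suc)

lemma reach_step: "x \<in> reach E r i \<Longrightarrow> {x, y} \<in> E \<Longrightarrow> y \<in> reach E r (Suc i)"
  unfolding reach_Suc by blast

lemma reach_pred: "y \<in> reach E r (Suc i) \<Longrightarrow> y \<notin> reach E r i \<Longrightarrow> \<exists>x\<in>reach E r i. {x, y} \<in> E"
  unfolding reach_Suc by blast

lemma reach_subset:
  assumes "simple_graph V E" "r \<in> V"
  shows "reach E r i \<subseteq> V"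
proof (induction i)
  case (Suc i)
  have "y \<in> V" if "{x, y} \<in> E" for x y using assms(1) that unfolding simple_graph_def by blast
  then show ?case using Suc unfolding reach_Suc by blast
qed (use assms in \<open>simp add: reach_0\<close>)

text \<open>Balls growing strictly for ever would outnumber \<open>V\<close>. The index is raised by
  one so that the final ball has radius at least 1 and contains the neighbours of the root.\<close>

lemma reach_stabilises:
  assumes gr: "simple_graph V E" and r: "r \<in> V"
  obtains n where "1 \<le> n" "reach E r (Suc n) = reach E r n"
proof -
  have fin: "finite (reach E r i)" for i
    using reach_subset[OF gr r] gr unfolding simple_graph_def by (metis finite_subset)
  have "\<exists>n. reach E r (Suc n) = reach E r n"
  proof (rule ccontr)
    assume "\<not> ?thesis"
    then have "reach E r i \<subset> reach E r (Suc i)" for i using reach_mono[of i "Suc i" E r] by auto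
    then have less: "card (reach E r i) < card (reach E r (Suc i))" for i using psubset_card_mono[OF fin] by blast
    have "i \<le> card (reach E r i)" for i
    proof (induction i)
      case (Suc i)
      then show ?case using less[of i] by simp
    qed simp
    then have "Suc (card V) \<le> card (reach E r (Suc (card V)))" .
    moreover have "card (reach E r (Suc (card V))) \<le> card V"
      using reach_subset[OF gr r] gr unfolding simple_graph_def by (intro card_mono) auto
    ultimately show False by simp
  qed
  then obtain n where "reach E r (Suc n) = reach E r n" by blast
  then have "reach E r (Suc (Suc n)) = reach E r (Suc n)" using reach_Suc[of E r n] reach_Suc[of E r "Suc n"] by simp
  then show ?thesis using that[of "Suc n"] by simp
qed

text \<open>A vertex of the new layer spends one of its two edges on the way inwards, so at most one
  edge leads out. This maps the edges leaving the larger ball injectively to those leaving the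
  smaller one: an edge of the smaller cut has a unique end outside that ball, and a third edge at
  this end would contradict the degree.\<close>

lemma cut_card_le_two:
  assumes gr: "simple_graph V E" and reg: "regular_graph 2 V E" and r: "r \<in> V"
  shows "card {e \<in> E. e \<inter> reach E r i \<noteq> {} \<and> \<not> e \<subseteq> reach E r i} \<le> 2"
proof (induction i)
  case 0
  have "{e \<in> E. e \<inter> reach E r 0 \<noteq> {} \<and> \<not> e \<subseteq> reach E r 0} \<subseteq> incident_edges E r"
    unfolding reach_0 incident_edges_def by auto
  then have "card {e \<in> E. e \<inter> reach E r 0 \<noteq> {} \<and> \<not> e \<subseteq> reach E r 0} \<le> card (incident_edges E r)"
    by (rule card_mono[OF finite_incident[OF finite_edges[OF gr]]])
  then show ?case using reg r unfolding regular_graph_def by simp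
next
  case (Suc i)
  define C C' where "C = {e \<in> E. e \<inter> reach E r i \<noteq> {} \<and> \<not> e \<subseteq> reach E r i}"
    and "C' = {e \<in> E. e \<inter> reach E r (Suc i) \<noteq> {} \<and> \<not> e \<subseteq> reach E r (Suc i)}"
  have finC: "finite C" unfolding C_def using finite_edges[OF gr] by simp
  have "\<exists>c\<in>C. \<exists>x. x \<in> c \<and> x \<in> e \<and> x \<notin> reach E r i \<and> e \<noteq> c" if e: "e \<in> C'" for e
  proof -
    obtain x where x: "e \<in> E" "x \<in> e" "x \<in> reach E r (Suc i)" using e unfolding C'_def by blast
    obtain y where y: "e = {x, y}" by (rule edge_endpoints[OF gr x(1,2)])
    then have "y \<notin> reach E r (Suc i)" using e x unfolding C'_def by auto
    then have xi: "x \<notin> reach E r i" using reach_step[of x E r i y] x(1) y by blast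
    then obtain z where z: "z \<in> reach E r i" "{z, x} \<in> E" using reach_pred x(3) by metis
    have "{z, x} \<in> C" using z xi unfolding C_def by auto
    moreover have "z \<in> reach E r (Suc i)" using z reach_mono[of i "Suc i" E r] by auto
    then have "e \<noteq> {z, x}" using \<open>y \<notin> reach E r (Suc i)\<close> x(3) unfolding y by (auto simp: doubleton_eq_iff)
    ultimately show ?thesis using xi x(2) by blast
  qed
  then obtain \<phi> where \<phi>: "\<phi> e \<in> C \<and> (\<exists>x. x \<in> \<phi> e \<and> x \<in> e \<and> x \<notin> reach E r i \<and> e \<noteq> \<phi> e)" if "e \<in> C'" for e
    by metis
  have "inj_on \<phi> C'"
  proof (rule inj_onI)
    fix e e' assume e: "e \<in> C'" "e' \<in> C'" "\<phi> e = \<phi> e'"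
    obtain x where x: "x \<in> \<phi> e" "x \<in> e" "x \<notin> reach E r i" "e \<noteq> \<phi> e" using \<phi>[OF e(1)] by blast
    obtain x' where x': "x' \<in> \<phi> e" "x' \<in> e'" "x' \<notin> reach E r i" "e' \<noteq> \<phi> e" using \<phi>[OF e(2)] e(3) by auto
    have c: "\<phi> e \<in> E" "\<phi> e \<inter> reach E r i \<noteq> {}" using \<phi>[OF e(1)] unfolding C_def by blast+
    obtain y where y: "\<phi> e = {x, y}" "x \<in> V" by (rule edge_endpoints[OF gr c(1) x(1)])
    have "y \<in> reach E r i" using y c(2) x(3) by auto
    then have xx: "x' = x" using x'(1,3) y by auto
    have sub: "{\<phi> e, e, e'} \<subseteq> incident_edges E x"
      using e(1,2) c(1) x(1,2) x'(2) xx unfolding incident_edges_def C'_def by auto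
    show "e = e'"
    proof (rule ccontr)
      assume "e \<noteq> e'"
      then have "card {\<phi> e, e, e'} = 3" using x(4) x'(4) by auto
      then show False using card_mono[OF finite_incident[OF finite_edges[OF gr]] sub] reg y(2)
        unfolding regular_graph_def by simp
    qed
  qed
  moreover have "\<phi> ` C' \<subseteq> C" using \<phi> by blast
  ultimately have "card C' \<le> card C" using finC by (rule card_inj_on_le)
  then show ?case using Suc unfolding C_def C'_def by simp
qed

text \<open>Since \<open>P\<close> is closed under adjacency, no ball around \<open>r\<close> meets
  it, and the ball at which the growth stops is a whole component, so closedness is passed
  on.\<close>

lemma component_step:
  assumes gr: "simple_graph V E" and reg: "regular_graph k V E" and k: "2 \<le> k"
    and st: "stage k V E P f" and closed: "\<forall>x y. {x, y} \<in> E \<longrightarrow> x \<in> P \<longrightarrow> y \<in> P" and PV: "P \<noteq> V"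
  shows "\<exists>Q g. stage k V E (P \<union> Q) g \<and> Q \<subseteq> V \<and> Q \<noteq> {} \<and> Q \<inter> P = {} \<and>
    (\<forall>x y. {x, y} \<in> E \<longrightarrow> x \<in> P \<union> Q \<longrightarrow> y \<in> P \<union> Q)"
proof -
  have closed: "y \<in> P" if "{x, y} \<in> E" "x \<in> P" for x y using closed that by blast
  obtain r where r: "r \<in> V" "r \<notin> P" using st PV unfolding stage_def by blast
  define Q where "Q = reach E r"
  obtain n where n: "1 \<le> n" "Q (Suc n) = Q n" unfolding Q_def by (rule reach_stabilises[OF gr r(1)])
  have Qc: "y \<in> Q n" if "x \<in> Q n" "{x, y} \<in> E" for x y
    using reach_step[of x E r n y] that n(2) unfolding Q_def by simp
  have mono: "Q i \<subseteq> Q j" if "i \<le> j" for i j unfolding Q_def by (rule reach_mono[OF that])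
  have swap: "{x, y} \<in> E \<Longrightarrow> {y, x} \<in> E" for x y by (simp add: insert_commute)
  have QP: "Q i \<inter> P = {}" for i
  proof (induction i)
    case (Suc i)
    have "y \<notin> P" if "x \<in> Q i" "{x, y} \<in> E" for x y using closed[OF swap[OF that(2)]] that(1) Suc by blast
    then show ?case using Suc unfolding Q_def reach_Suc by blast
  qed (use r in \<open>simp add: Q_def reach_0\<close>)
  \<comment> \<open>The vertices finished once all layers beyond radius \<open>i\<close> are done.
    As \<open>S n = P\<close>, the induction runs downwards and stops at \<open>S 1\<close>, where
    only the root and its neighbours are left.\<close>
  define S where "S i = P \<union> (Q n - Q i)" for i
  have "\<exists>g. stage k V E (S 1) g" using n(1)
  proof (induction rule: inc_induct)
    case base
    then show ?case using st unfolding S_def by auto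
  next
    case (step m)
    then obtain g where g: "stage k V E (S (Suc m)) g" by blast
    define U where "U = Q (Suc m) - Q m"
    have sub: "Q m \<subseteq> Q (Suc m)" "Q (Suc m) \<subseteq> Q n" using mono step.hyps by auto
    have SU: "S (Suc m) \<union> U = S m" using sub unfolding S_def U_def by blast
    have "\<exists>g. stage k V E (S (Suc m) \<union> U) g"
    proof (rule block_step[OF gr reg k g])
      show "U \<subseteq> V" unfolding U_def Q_def using reach_subset[OF gr r(1)] by blast
      show "U \<inter> S (Suc m) = {}" using QP[of "Suc m"] unfolding S_def U_def by blast
      show "y \<in> S (Suc m) \<union> U" if xy: "{x, y} \<in> E" "x \<in> S (Suc m)" for x y
      proof (cases "x \<in> P")
        case True
        then show ?thesis using closed[OF xy(1)] unfolding S_def by blast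
      next
        case False
        then have x: "x \<in> Q n" "x \<notin> Q (Suc m)" using xy(2) unfolding S_def by auto
        have "y \<notin> Q m" using reach_step[of y E r m x] swap[OF xy(1)] x(2) unfolding Q_def by blast
        then show ?thesis using Qc[OF x(1) xy(1)] unfolding SU unfolding S_def by blast
      qed
      show "\<exists>w. w \<notin> S (Suc m) \<union> U \<and> {u, w} \<in> E" if u: "u \<in> U" for u
      proof -
        obtain x where x: "x \<in> Q m" "{x, u} \<in> E" using u reach_pred[of u E r m] unfolding U_def Q_def by blast
        then have "x \<notin> S m" using QP[of m] unfolding S_def by blast
        then show ?thesis using swap[OF x(2)] unfolding SU by blast
      qed
      have inner: "w \<in> Q m" if "u \<in> U" "w \<notin> S m" "{u, w} \<in> E" for u w
      proof -
        have "w \<in> Q n" using Qc[OF _ that(3)] that(1) sub(2) unfolding U_def by blast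
        then show ?thesis using that(2) unfolding S_def by blast
      qed
      show "\<exists>x. x \<notin> U \<and> {w, x} \<in> E" if uw: "u \<in> U" "w \<notin> S (Suc m) \<union> U" "{u, w} \<in> E" for u w
      proof -
        \<comment> \<open>As \<open>m \<ge> 1\<close>, a vertex \<open>w\<close> facing
          \<open>U\<close> is not the root and has a neighbour one layer further in. At the root
          this would fail, which is why it has a step of its own.\<close>
        obtain m' where m': "m = Suc m'" using step.hyps(1) by (cases m) auto
        have w: "w \<in> Q m" using inner uw unfolding SU by blast
        have "w \<notin> Q m'"
          using reach_step[of w E r m' u] swap[OF uw(3)] uw(1) unfolding m' U_def Q_def by blast
        then obtain x where x: "x \<in> Q m'" "{x, w} \<in> E" using w reach_pred[of w E r m'] unfolding m' Q_def by blast
        have "x \<in> Q m" using x(1) mono[of m' m] m' by auto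
        then show ?thesis using swap[OF x(2)] unfolding U_def by blast
      qed
      show "card {e \<in> E. e \<inter> U \<noteq> {} \<and> \<not> e \<subseteq> S (Suc m) \<union> U} \<le> 2" if k2: "k = 2"
      proof -
        \<comment> \<open>Every block edge has its inner end in the ball of radius \<open>m\<close>
          and its outer end beyond it.\<close>
        have "{e \<in> E. e \<inter> U \<noteq> {} \<and> \<not> e \<subseteq> S m} \<subseteq> {e \<in> E. e \<inter> Q m \<noteq> {} \<and> \<not> e \<subseteq> Q m}"
        proof
          fix e assume "e \<in> {e \<in> E. e \<inter> U \<noteq> {} \<and> \<not> e \<subseteq> S m}"
          then obtain u w where e: "e \<in> E" "u \<in> e" "u \<in> U" "w \<in> e" "w \<notin> S m" by blast
          obtain y where y: "e = {u, y}" by (rule edge_endpoints[OF gr e(1,2)])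
          have "u \<in> S m" using e(3) unfolding SU[symmetric] by blast
          then have "y = w" using y e by auto
          then have "w \<in> Q m" using inner[OF e(3,5)] e(1) y by blast
          then show "e \<in> {e \<in> E. e \<inter> Q m \<noteq> {} \<and> \<not> e \<subseteq> Q m}" using e unfolding U_def by blast
        qed
        then have "card {e \<in> E. e \<inter> U \<noteq> {} \<and> \<not> e \<subseteq> S m} \<le> card {e \<in> E. e \<inter> Q m \<noteq> {} \<and> \<not> e \<subseteq> Q m}"
          by (rule card_mono[rotated]) (use finite_edges[OF gr] in simp)
        also have "\<dots> \<le> 2" unfolding Q_def by (rule cut_card_le_two[OF gr reg[unfolded k2] r(1)])
        finally show ?thesis unfolding SU .
      qed
    qed
    then show ?case unfolding SU .
  qed
  then obtain g where g: "stage k V E (S 1) g" by blast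
  define N where "N = {x. {r, x} \<in> E}"
  have Q1: "Q 1 = insert r N" unfolding Q_def N_def using reach_Suc[of E r 0] reach_0[of E r] by auto
  have QN: "S 1 \<union> insert r N = P \<union> Q n" using mono[OF n(1)] unfolding S_def Q1 by blast
  have "\<exists>g. stage k V E (S 1 \<union> insert r N) g"
  proof (rule star_step[OF gr reg k g r(1) N_def])
    show "insert r N \<inter> S 1 = {}" using QP[of 1] unfolding S_def Q1 by blast
    show "y \<in> S 1 \<union> N" if xy: "{x, y} \<in> E" "x \<in> S 1" for x y
    proof (cases "x \<in> P")
      case True
      then show ?thesis using closed[OF xy(1)] unfolding S_def by blast
    next
      case False
      then have x: "x \<in> Q n" "x \<notin> insert r N" using xy(2) unfolding S_def Q1 by auto
      then have "y \<noteq> r" using swap[OF xy(1)] unfolding N_def by blast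
      then show ?thesis using Qc[OF x(1) xy(1)] QN by blast
    qed
    show "y \<in> S 1 \<union> insert r N" if "{x, y} \<in> E" "x \<in> N" for x y
      using Qc[OF _ that(1)] that(2) mono[OF n(1)] unfolding QN Q1 by blast
  qed
  then obtain g' where "stage k V E (P \<union> Q n) g'" unfolding QN by blast
  moreover have "Q n \<subseteq> V" unfolding Q_def by (rule reach_subset[OF gr r(1)])
  moreover have "Q n \<noteq> {}" using mono[OF n(1)] unfolding Q1 by blast
  moreover have "y \<in> P \<union> Q n" if "{x, y} \<in> E" "x \<in> P \<union> Q n" for x y
    using closed[OF that(1)] Qc[OF _ that(1)] that(2) by blast
  ultimately show ?thesis using QP by blast
qed

lemma stage_complete:
  assumes gr: "simple_graph V E" and reg: "regular_graph k V E" and k: "2 \<le> k"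
    and st: "stage k V E P f" and closed: "\<forall>x y. {x, y} \<in> E \<longrightarrow> x \<in> P \<longrightarrow> y \<in> P"
  shows "\<exists>g. stage k V E V g"
  using st closed
proof (induction "card (V - P)" arbitrary: P f rule: less_induct)
  case less
  show ?case
  proof (cases "P = V")
    case False
    obtain Q g where Q: "stage k V E (P \<union> Q) g" "Q \<subseteq> V" "Q \<noteq> {}" "Q \<inter> P = {}"
      "\<forall>x y. {x, y} \<in> E \<longrightarrow> x \<in> P \<union> Q \<longrightarrow> y \<in> P \<union> Q"
      using component_step[OF gr reg k less.prems False] by blast
    have "V - (P \<union> Q) \<subset> V - P" using Q(2-4) by blast
    then have "card (V - (P \<union> Q)) < card (V - P)"
      using gr unfolding simple_graph_def by (intro psubset_card_mono) auto
    from less.hyps[OF this Q(1,5)] show ?thesis .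
  qed (use less.prems in blast)
qed

theorem theorem1:
  fixes k :: nat and V :: "'a set" and E :: "'a set set"
  assumes "k \<ge> 2"
    and "simple_graph V E"
    and "regular_graph k V E"
  shows "antimagic V E"
proof -
  have "stage k V E {} (\<lambda>_. 0)" unfolding stage_def touching_def by (simp add: bij_betw_def)
  then obtain g where st: "stage k V E V g" using stage_complete[OF assms(2,3,1)] by blast
  have E: "touching E V = E" using assms(2) unfolding touching_def simple_graph_def
    by (auto simp: Int_absorb2)
  have bij: "bij_betw g E {1..int (card E)}" and inj: "inj_on (vsum E g) V"
    using st unfolding stage_def E by blast+
  \<comment> \<open>Integers were used because of the nonpositive \<open>p\<close> and the
    differences; the labels themselves are at least 1, so \<open>nat\<close> loses nothing.\<close>
  define f where "f = nat \<circ> g"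
  have g1: "1 \<le> g e" "g e \<le> int (card E)" if "e \<in> E" for e using bij that unfolding bij_betw_def by auto
  have "labeling E f" unfolding labeling_def
  proof
    show "inj_on f E"
    proof (rule inj_onI)
      fix x y assume xy: "x \<in> E" "y \<in> E" "f x = f y"
      then have "g x = g y" using g1[OF xy(1)] g1[OF xy(2)] unfolding f_def by simp
      then show "x = y" using inj_onD[OF bij_betw_imp_inj_on[OF bij]] xy by blast
    qed
    show "f ` E \<subseteq> {1..card E}"
    proof
      fix y assume "y \<in> f ` E"
      then obtain e where "e \<in> E" "y = nat (g e)" unfolding f_def by auto
      then show "y \<in> {1..card E}" using g1[of e] by auto
    qed
  qed
  moreover have "int (sum f (incident_edges E v)) = vsum E g v" for v
    unfolding vsum_def of_nat_sum
  proof (rule sum.cong)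
    fix e assume "e \<in> incident_edges E v"
    then have "e \<in> E" unfolding incident_edges_def by simp
    then show "int (f e) = g e" using g1[of e] unfolding f_def by simp
  qed simp
  then have "sum f (incident_edges E u) \<noteq> sum f (incident_edges E v)" if "u \<in> V" "v \<in> V" "u \<noteq> v" for u v
    using inj_onD[OF inj _ that(1,2)] that(3) by metis
  ultimately show ?thesis unfolding antimagic_def antimagic_labeling_def by blast
qed

end
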